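(* Let $G=(V,E)$ be a directed simple graph on vertex set $[n]$ defining a linear compartment model in which input and output take place only in compartment $1$ and every compartment has a leak with independent parameter. If $G$ has a nontrivial ear decomposition, then $G$ has an identifiable scaling reparametrization; equivalently, the image of the double characteristic polynomial map $c$ has dimension $m+1$, where $m=|E|$.
   Context: An ear decomposition of a directed graph $G=(V,E)$ is a sequence $P_0,P_1,\ldots,P_t$ ($t\ge 0$) of subgraphs with $G_i=(V_i,E_i):=P_0\cup\cdots\cup P_i$, such that $P_0$ is a directed cycle, $G_t=G$, and each $P_i$ ($i\ge1$) is a directed path $(v_0,v_1,\ldots,v_k)$, $k\ge1$, with $v_0,v_k\in V_{i-1}$ (not necessarily distinct), the internal vertices $v_1,\ldots,v_{k-1}$ pairwise distinct and not in $V_{i-1}$, and the edges $v_{r}\to v_{r+1}$ not in $E_{i-1}$. An ear $P_i=(v_0,v_1)$ with $k=1$ is called trivial. A nontrivial ear decomposition is an ear decomposition with no trivial ears whose initial cycle $P_0$ contains vertex $1$. Parameter matrix: $A(G)$ has $A_{ii}=a_{ii}$, $A_{ij}=a_{ij}$ if $j\to i\in E$, $0$ otherwise, all $n+m$ nonzero entries independent parameters; $\Theta_G$ is the set of matrices with this zero pattern. The double characteristic polynomial map $c:\Theta_G\to\mathbb{C}^{2n-1}$ sends $A$ to the non-leading coefficients of the characteristic polynomials of $A$ and of $A_1$ ($A$ with first row and column deleted). A scaling reparametrization consists of functions $f_1,\ldots,f_n$ on $\Theta_G$ with $f_1\equiv1$, sending $A$ to $(a_{ij}f_i(A)/f_j(A))_{ij}$;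 it is identifiable if the map induced by $c$ on the image of this map is injective on a neighborhood of each point of a dense subset. (The equivalence of existence of an identifiable scaling reparametrization with $\dim\operatorname{im}c=m+1$ is a known criterion of Meshkat and Sullivant.) *)

theory Defs
  imports
    "HOL-Analysis.Function_Topology"
    "HOL-Analysis.Abstract_Topology_2"
    "HOL-Library.Extended_Nat"
    "Jordan_Normal_Form.Char_Poly"
    "Graph_Theory.Pair_Digraph"
    "Graph_Theory.Vertex_Walk"
begin

section \<open>Ear decompositions\<close>

text \<open>
  A directed cycle and an ear are both given by their vertex sequence; \<open>vwalk_arcs\<close> yields the arcs
  between consecutive vertices. A cycle repeats its first vertex at the end and, as in a simple
  digraph, has length at least two; a 2-cycle \<open>u \<rightarrow> v \<rightarrow> u\<close> is a cycle.
\<close>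

definition directed_cycle :: "'a vwalk \<Rightarrow> bool" where
  "directed_cycle p \<longleftrightarrow> 3 \<le> length p \<and> hd p = last p \<and> distinct (tl p)"

text \<open>The end points \<open>hd p\<close> and \<open>last p\<close> may coincide.\<close>

definition is_ear :: "'a set \<Rightarrow> ('a \<times> 'a) set \<Rightarrow> 'a vwalk \<Rightarrow> bool" where
  "is_ear V E p \<longleftrightarrow>
     2 \<le> length p \<and> hd p \<in> V \<and> last p \<in> V \<and>
     distinct (butlast (tl p)) \<and> set (butlast (tl p)) \<inter> V = {} \<and>
     set (vwalk_arcs p) \<inter> E = {}"

definition verts_upto :: "'a vwalk list \<Rightarrow> nat \<Rightarrow> 'a set" where
  "verts_upto Ps i = (\<Union>j\<le>i. set (Ps ! j))"

definition arcs_upto :: "'a vwalk list \<Rightarrow> nat \<Rightarrow> ('a \<times> 'a) set" where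
  "arcs_upto Ps i = (\<Union>j\<le>i. set (vwalk_arcs (Ps ! j)))"

definition ear_decomposition :: "'a pair_pre_digraph \<Rightarrow> 'a vwalk list \<Rightarrow> bool" where
  "ear_decomposition G Ps \<longleftrightarrow>
     Ps \<noteq> [] \<and> directed_cycle (Ps ! 0) \<and>
     (\<forall>i. 1 \<le> i \<and> i < length Ps \<longrightarrow>
        is_ear (verts_upto Ps (i - 1)) (arcs_upto Ps (i - 1)) (Ps ! i)) \<and>
     verts_upto Ps (length Ps - 1) = pverts G \<and>
     arcs_upto Ps (length Ps - 1) = parcs G"

definition trivial_ear :: "'a vwalk \<Rightarrow> bool" where
  "trivial_ear p \<longleftrightarrow> length p = 2"

definition nontrivial_ear_decomposition :: "nat pair_pre_digraph \<Rightarrow> nat vwalk list \<Rightarrow> bool" where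
  "nontrivial_ear_decomposition G Ps \<longleftrightarrow>
     ear_decomposition G Ps \<and> 1 \<in> set (Ps ! 0) \<and>
     (\<forall>i. 1 \<le> i \<and> i < length Ps \<longrightarrow> \<not> trivial_ear (Ps ! i))"


section \<open>The parameter space and the double characteristic polynomial map\<close>

text \<open>
  Vertices are \<open>1, \<dots>, n\<close>. A matrix \<open>A = (a\<^sub>i\<^sub>j)\<close> is a function of its two indices that vanishes
  outside the zero pattern (in particular outside \<open>{1..n}\<close>), so that the product topology on
  functions induces the Euclidean topology of \<open>\<complex>\<^bsup>n+m\<^esup>\<close> on the parameter space. Note that
  the arc \<open>j \<rightarrow> i\<close> corresponds to the entry in row \<open>i\<close> and column \<open>j\<close>.
\<close>

definition Theta :: "nat pair_pre_digraph \<Rightarrow> (nat \<Rightarrow> nat \<Rightarrow> complex) set" where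
  "Theta G = {A. \<forall>i j. A i j \<noteq> 0 \<longrightarrow> (i = j \<and> i \<in> pverts G) \<or> (j, i) \<in> parcs G}"

definition to_mat :: "nat \<Rightarrow> (nat \<Rightarrow> nat \<Rightarrow> complex) \<Rightarrow> complex mat" where
  "to_mat n A = mat n n (\<lambda>(i, j). A (Suc i) (Suc j))"

text \<open>
  Characteristic polynomials are monic, so the non-leading coefficients are those of degree
  \<open>0, \<dots>, n - 1\<close> for \<open>A\<close> and \<open>0, \<dots>, n - 2\<close> for \<open>A\<^sub>1\<close>.
\<close>

definition double_char_map :: "nat \<Rightarrow> (nat \<Rightarrow> nat \<Rightarrow> complex) \<Rightarrow> complex Matrix.vec" where
  "double_char_map n A = Matrix.vec (2 * n - 1) (\<lambda>k.
     if k < n then coeff (char_poly (to_mat n A)) k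
     else coeff (char_poly (mat_delete (to_mat n A) 0 0)) (k - n))"


section \<open>Scaling reparametrizations\<close>

definition rescale ::
  "(nat \<Rightarrow> (nat \<Rightarrow> nat \<Rightarrow> complex) \<Rightarrow> complex) \<Rightarrow> (nat \<Rightarrow> nat \<Rightarrow> complex) \<Rightarrow> (nat \<Rightarrow> nat \<Rightarrow> complex)"
where
  "rescale f A = (\<lambda>i j. A i j * f i A / f j A)"

text \<open>
  The scaling functions are functions on the parameter space such as monomials in the entries of
  \<open>A\<close>, which may vanish somewhere; the rescaled matrix makes sense where none of them does. As usual
  for reparametrizations this is understood generically: the locus where no \<open>f\<^sub>i\<close> vanishes is
  open and dense, and the \<open>f\<^sub>i\<close> are continuous there. Rational functions (extended by zero
  to their poles) are included. Without any regularity of the \<open>f\<^sub>i\<close> the image could be an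
  arbitrarily wild set of representatives of the scaling orbits.
\<close>

definition rescale_domain ::
  "nat pair_pre_digraph \<Rightarrow> (nat \<Rightarrow> (nat \<Rightarrow> nat \<Rightarrow> complex) \<Rightarrow> complex) \<Rightarrow> (nat \<Rightarrow> nat \<Rightarrow> complex) set"
where
  "rescale_domain G f = {A \<in> Theta G. \<forall>i\<in>pverts G. f i A \<noteq> 0}"

definition scaling_reparametrization ::
  "nat pair_pre_digraph \<Rightarrow> (nat \<Rightarrow> (nat \<Rightarrow> nat \<Rightarrow> complex) \<Rightarrow> complex) \<Rightarrow> bool"
where
  "scaling_reparametrization G f \<longleftrightarrow>
     (\<forall>A\<in>Theta G. f 1 A = 1) \<and>
     openin (top_of_set (Theta G)) (rescale_domain G f) \<and>
     Theta G \<subseteq> closure (rescale_domain G f) \<and>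
     (\<forall>i\<in>pverts G. continuous_on (rescale_domain G f) (f i))"

definition generically_locally_injective ::
  "'a::topological_space set \<Rightarrow> ('a \<Rightarrow> 'b) \<Rightarrow> bool"
where
  "generically_locally_injective R c \<longleftrightarrow>
     (\<exists>D\<subseteq>R. R \<subseteq> closure D \<and>
        (\<forall>B\<in>D. \<exists>W. openin (top_of_set R) W \<and> B \<in> W \<and> inj_on c W))"

definition identifiable_scaling_reparametrization ::
  "nat \<Rightarrow> nat pair_pre_digraph \<Rightarrow> (nat \<Rightarrow> (nat \<Rightarrow> nat \<Rightarrow> complex) \<Rightarrow> complex) \<Rightarrow> bool"
where
  "identifiable_scaling_reparametrization n G f \<longleftrightarrow>
     scaling_reparametrization G f \<and>
     generically_locally_injective (rescale f ` rescale_domain G f) (double_char_map n)"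


section \<open>Dimension of a subset of affine space\<close>

inductive_set poly_functions :: "nat \<Rightarrow> (complex Matrix.vec \<Rightarrow> complex) set" for N where
  const: "(\<lambda>_. a) \<in> poly_functions N"
| coord: "i < N \<Longrightarrow> (\<lambda>v. vec_index v i) \<in> poly_functions N"
| add: "p \<in> poly_functions N \<Longrightarrow> q \<in> poly_functions N \<Longrightarrow> (\<lambda>v. p v + q v) \<in> poly_functions N"
| mult: "p \<in> poly_functions N \<Longrightarrow> q \<in> poly_functions N \<Longrightarrow> (\<lambda>v. p v * q v) \<in> poly_functions N"

definition zero_locus :: "nat \<Rightarrow> (complex Matrix.vec \<Rightarrow> complex) set \<Rightarrow> complex Matrix.vec set" where
  "zero_locus N S = {v \<in> carrier_vec N. \<forall>p\<in>S. p v = 0}"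

definition zariski :: "nat \<Rightarrow> complex Matrix.vec topology" where
  "zariski N = topology (\<lambda>U. \<exists>S\<subseteq>poly_functions N. U = carrier_vec N - zero_locus N S)"

lemma openin_zariski:
  "openin (zariski N) U \<longleftrightarrow> (\<exists>S\<subseteq>poly_functions N. U = carrier_vec N - zero_locus N S)"
proof -
  have "istopology (\<lambda>U. \<exists>S\<subseteq>poly_functions N. U = carrier_vec N - zero_locus N S)"
    unfolding istopology_def
  proof (intro conjI allI impI)
    fix U U'
    assume "\<exists>S\<subseteq>poly_functions N. U = carrier_vec N - zero_locus N S"
      and "\<exists>S\<subseteq>poly_functions N. U' = carrier_vec N - zero_locus N S"
    then obtain S S' where S: "S \<subseteq> poly_functions N" "U = carrier_vec N - zero_locus N S"
      and S': "S' \<subseteq> poly_functions N" "U' = carrier_vec N - zero_locus N S'" by blast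
    let ?T = "(\<lambda>(p, q) v. p v * q v) ` (S \<times> S')"
    have "?T \<subseteq> poly_functions N"
      using S(1) S'(1) by (auto intro: poly_functions.mult)
    moreover have "U \<inter> U' = carrier_vec N - zero_locus N ?T"
      unfolding S(2) S'(2) zero_locus_def by fastforce
    ultimately show "\<exists>S\<subseteq>poly_functions N. U \<inter> U' = carrier_vec N - zero_locus N S"
      by blast
  next
    fix K
    assume "\<forall>U\<in>K. \<exists>S\<subseteq>poly_functions N. U = carrier_vec N - zero_locus N S"
    then obtain S where S: "\<And>U. U \<in> K \<Longrightarrow> S U \<subseteq> poly_functions N"
      "\<And>U. U \<in> K \<Longrightarrow> U = carrier_vec N - zero_locus N (S U)" by metis
    have "\<Union>(S ` K) \<subseteq> poly_functions N"
      using S(1) by blast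
    moreover have "\<Union>K = (\<Union>U\<in>K. carrier_vec N - zero_locus N (S U))"
      using S(2) by auto
    then have "\<Union>K = carrier_vec N - zero_locus N (\<Union>(S ` K))"
      by (auto simp: zero_locus_def)
    ultimately show "\<exists>S\<subseteq>poly_functions N. \<Union>K = carrier_vec N - zero_locus N S"
      by blast
  qed
  then show ?thesis
    by (simp add: zariski_def)
qed

lemma topspace_zariski [simp]: "topspace (zariski N) = carrier_vec N"
proof
  show "topspace (zariski N) \<subseteq> carrier_vec N"
    unfolding topspace_def openin_zariski by blast
  have "carrier_vec N = carrier_vec N - zero_locus N {\<lambda>_. 1}"
    by (simp add: zero_locus_def)
  then have "openin (zariski N) (carrier_vec N)"
    unfolding openin_zariski by (intro exI[of _ "{\<lambda>_. 1}"]) (auto intro: poly_functions.const)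
  then show "carrier_vec N \<subseteq> topspace (zariski N)"
    by (rule openin_subset)
qed

lemma closedin_zariski:
  "closedin (zariski N) Z \<longleftrightarrow> (\<exists>S\<subseteq>poly_functions N. Z = zero_locus N S)"
proof -
  have "zero_locus N S \<subseteq> carrier_vec N" for S
    by (auto simp: zero_locus_def)
  then show ?thesis
    unfolding closedin_def topspace_zariski openin_zariski
    by (metis Diff_Diff_Int inf.absorb_iff2)
qed

definition irreducible_in :: "'a topology \<Rightarrow> 'a set \<Rightarrow> bool" where
  "irreducible_in T Z \<longleftrightarrow>
     Z \<noteq> {} \<and> Z \<subseteq> topspace T \<and>
     (\<forall>C D. closedin T C \<and> closedin T D \<and> Z \<subseteq> C \<union> D \<longrightarrow> Z \<subseteq> C \<or> Z \<subseteq> D)"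

text \<open>
  Krull dimension: the supremum of the lengths \<open>d\<close> of chains \<open>Z\<^sub>0 \<subset> \<dots> \<subset> Z\<^sub>d\<close> of irreducible
  closed sets. The empty space gets dimension 0 here instead of \<open>-\<infinity>\<close>.
\<close>

definition krull_dim :: "'a topology \<Rightarrow> enat" where
  "krull_dim T = Sup {enat (length Zs - 1) | Zs.
     Zs \<noteq> [] \<and> (\<forall>Z\<in>set Zs. closedin T Z \<and> irreducible_in T Z) \<and> sorted_wrt (\<subset>) Zs}"

text \<open>The dimension of an arbitrary subset of \<open>\<complex>\<^sup>N\<close> is that of its Zariski closure.\<close>

definition zariski_dim :: "nat \<Rightarrow> complex Matrix.vec set \<Rightarrow> enat" where
  "zariski_dim N S = krull_dim (subtopology (zariski N) (zariski N closure_of S))"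

end

(*
Write X = lambda - A, let p and q be the first row and the first column of the adjugate of X, and
let F_(j,i) = p_i * q_j, a polynomial in lambda. The resolvent identity X^-1 - Y^-1 = X^-1 (Y - X) Y^-1
shows that the F_(j,i), with j = i or j -> i an arc, span the image of the differential of c, and that
for matrices normalized to 1 along a spanning arborescence a linear relation between the remaining
F_(j,i) is the only obstruction to local injectivity. They are independent at a suitable matrix, by
induction on the ears: give the new vertices w_1, ..., w_K distinct leaks d_r, put weight 1 on the ear
except for weight eps on its last arc, and let eps -> 0. With R = prod_r (lambda - d_r), the old
products become R^2 F_b, and the new ones span p_v q_u times all polynomials of degree at most K
(after division by eps where needed). If the d_r are not roots of p_v q_u, a combination of the
latter that is divisible by R^2 vanishes, because K < 2K; this is where nontriviality K >= 1 enters.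
*)
theory Submission
  imports Defs
begin

section \<open>Polynomial functions\<close>

text \<open>The resolvent identity is exact for any two matrices, not only infinitesimally, so
  neither Jacobians nor an inverse function theorem occur: if A and B have the same image, the
  entries of A - B are the coefficients of a vanishing combination of products p_i(A) q_j(B), and
  independence at (A, A) persists at nearby pairs (A, B). The Krull dimension has to be bounded from
  both sides with chains of irreducible closed sets. A chain of length d yields d algebraically
  independent functions on its top member, and counting monomials bounds d by the number of free
  coordinates of the normalized matrices. The bound is attained by closures of images of coordinate
  subspaces through one good matrix; functions whose linear parts there are the free coordinates
  keep these closures distinct. The constant m + 1 is the number of free coordinates: a spanning
  arborescence uses n - 1 arcs, which leaves n diagonal entries and m - n + 1 arcs. The initial
  cycle needs no separate treatment: rotated to start at 1, it is an ear with both ends at 1,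
  attached to a graph with a single vertex and no arcs.\<close>

inductive_set polyfun :: "('a \<Rightarrow> complex) set \<Rightarrow> ('a \<Rightarrow> complex) set" for X where
  const: "(\<lambda>_. a) \<in> polyfun X"
| gen: "f \<in> X \<Longrightarrow> f \<in> polyfun X"
| add: "f \<in> polyfun X \<Longrightarrow> g \<in> polyfun X \<Longrightarrow> (\<lambda>x. f x + g x) \<in> polyfun X"
| mult: "f \<in> polyfun X \<Longrightarrow> g \<in> polyfun X \<Longrightarrow> (\<lambda>x. f x * g x) \<in> polyfun X"

lemma polyfun_uminus: "f \<in> polyfun X \<Longrightarrow> (\<lambda>x. - f x) \<in> polyfun X"
  using polyfun.mult[OF polyfun.const[of "-1"]] by simp

lemma polyfun_diff: "f \<in> polyfun X \<Longrightarrow> g \<in> polyfun X \<Longrightarrow> (\<lambda>x. f x - g x) \<in> polyfun X"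
  using polyfun.add[OF _ polyfun_uminus] by fastforce

lemma polyfun_sum: "(\<And>i. i \<in> I \<Longrightarrow> f i \<in> polyfun X) \<Longrightarrow> (\<lambda>x. \<Sum>i\<in>I. f i x) \<in> polyfun X"
  by (induction I rule: infinite_finite_induct) (auto intro: polyfun.intros)

lemma polyfun_prod: "(\<And>i. i \<in> I \<Longrightarrow> f i \<in> polyfun X) \<Longrightarrow> (\<lambda>x. \<Prod>i\<in>I. f i x) \<in> polyfun X"
  by (induction I rule: infinite_finite_induct) (auto intro: polyfun.intros)

lemma polyfun_power: "f \<in> polyfun X \<Longrightarrow> (\<lambda>x. f x ^ k) \<in> polyfun X"
  by (induction k) (auto intro: polyfun.intros)

text \<open>Agreement is asked only on \<open>S\<close>, so a generator that is constant on
  \<open>S\<close> may be replaced by that constant. This is how the number of generators drops on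
  coordinate subspaces.\<close>

lemma polyfun_subst:
  assumes "f \<in> polyfun X" "\<And>g. g \<in> X \<Longrightarrow> \<exists>h\<in>polyfun Y. \<forall>x\<in>S. g (\<phi> x) = h x"
  shows "\<exists>h\<in>polyfun Y. \<forall>x\<in>S. f (\<phi> x) = h x"
  using assms(1)
proof induction
  case (const a)
  show ?case by (rule bexI[OF _ polyfun.const[of a]]) simp
next
  case (gen f)
  then show ?case by (rule assms(2))
next
  case (add f g)
  then obtain f' g' where "f' \<in> polyfun Y" "\<forall>x\<in>S. f (\<phi> x) = f' x"
    "g' \<in> polyfun Y" "\<forall>x\<in>S. g (\<phi> x) = g' x" by blast
  then show ?case by (intro bexI[OF _ polyfun.add[of f' _ g']]) auto
next
  case (mult f g)
  then obtain f' g' where "f' \<in> polyfun Y" "\<forall>x\<in>S. f (\<phi> x) = f' x"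
    "g' \<in> polyfun Y" "\<forall>x\<in>S. g (\<phi> x) = g' x" by blast
  then show ?case by (intro bexI[OF _ polyfun.mult[of f' _ g']]) auto
qed

lemma polyfun_comp:
  assumes "f \<in> polyfun X" "\<And>g. g \<in> X \<Longrightarrow> (\<lambda>x. g (\<phi> x)) \<in> polyfun Y"
  shows "(\<lambda>x. f (\<phi> x)) \<in> polyfun Y"
  using assms(1) by induction (auto intro: polyfun.intros assms(2))

lemma polyfun_continuous_on:
  assumes "f \<in> polyfun X" "\<And>g. g \<in> X \<Longrightarrow> continuous_on S g"
  shows "continuous_on S f"
  using assms(1) by induction (auto intro: continuous_on_add continuous_on_mult assms(2))

text \<open>Restriction to a curve with polynomial coordinates gives an honest one-variable
  polynomial, whose finite root set replaces any argument about dense open sets in many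
  variables.\<close>

lemma polyfun_univariate:
  assumes "f \<in> polyfun X" "\<And>g. g \<in> X \<Longrightarrow> \<exists>P. \<forall>t. g (\<phi> t) = poly P t"
  shows "\<exists>P. \<forall>t. f (\<phi> t) = poly P t"
  using assms(1)
proof induction
  case (const a)
  show ?case by (rule exI[of _ "[:a:]"]) simp
next
  case (gen f)
  then show ?case by (rule assms(2))
next
  case (add f g)
  then show ?case by (metis poly_add)
next
  case (mult f g)
  then show ?case by (metis poly_mult)
qed

text \<open>Polynomials in lambda whose coefficients depend polynomially on a parameter. No uniform
  degree bound is demanded, since coefficients are only ever used one at a time.\<close>

definition polyfun_poly :: "('a \<Rightarrow> complex) set \<Rightarrow> ('a \<Rightarrow> complex poly) set" where
  "polyfun_poly X = {P. \<forall>k. (\<lambda>x. coeff (P x) k) \<in> polyfun X}"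

lemma polyfun_polyD: "P \<in> polyfun_poly X \<Longrightarrow> (\<lambda>x. coeff (P x) k) \<in> polyfun X"
  by (simp add: polyfun_poly_def)

lemma polyfun_poly_const: "(\<lambda>_. p) \<in> polyfun_poly X"
  by (simp add: polyfun_poly_def polyfun.const)

lemma polyfun_poly_monom0:
  assumes "f \<in> polyfun X"
  shows "(\<lambda>x. [:f x:]) \<in> polyfun_poly X"
  unfolding polyfun_poly_def
proof (intro CollectI allI)
  fix k
  show "(\<lambda>x. coeff [:f x:] k) \<in> polyfun X"
    using assms by (cases k) (auto intro: polyfun.const)
qed

lemma polyfun_poly_add:
  "P \<in> polyfun_poly X \<Longrightarrow> Q \<in> polyfun_poly X \<Longrightarrow> (\<lambda>x. P x + Q x) \<in> polyfun_poly X"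
  by (auto simp: polyfun_poly_def intro: polyfun.add)

lemma polyfun_poly_diff:
  "P \<in> polyfun_poly X \<Longrightarrow> Q \<in> polyfun_poly X \<Longrightarrow> (\<lambda>x. P x - Q x) \<in> polyfun_poly X"
  by (auto simp: polyfun_poly_def intro: polyfun_diff)

lemma polyfun_poly_mult:
  "P \<in> polyfun_poly X \<Longrightarrow> Q \<in> polyfun_poly X \<Longrightarrow> (\<lambda>x. P x * Q x) \<in> polyfun_poly X"
  by (auto simp: polyfun_poly_def coeff_mult intro!: polyfun_sum polyfun.mult)

lemma polyfun_poly_sum:
  "(\<And>i. i \<in> I \<Longrightarrow> P i \<in> polyfun_poly X) \<Longrightarrow> (\<lambda>x. \<Sum>i\<in>I. P i x) \<in> polyfun_poly X"
  by (auto simp: polyfun_poly_def coeff_sum intro!: polyfun_sum)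

lemma polyfun_poly_prod:
  "(\<And>i. i \<in> I \<Longrightarrow> P i \<in> polyfun_poly X) \<Longrightarrow> (\<lambda>x. \<Prod>i\<in>I. P i x) \<in> polyfun_poly X"
  by (induction I rule: infinite_finite_induct)
    (auto intro: polyfun_poly_mult polyfun_poly_const)

lemma polyfun_poly_det:
  assumes "\<And>x. M x \<in> carrier_mat n n"
    and "\<And>i j. i < n \<Longrightarrow> j < n \<Longrightarrow> (\<lambda>x. M x $$ (i, j)) \<in> polyfun_poly X"
  shows "(\<lambda>x. det (M x)) \<in> polyfun_poly X"
proof -
  have "(\<lambda>x. \<Sum>\<pi>\<in>{\<pi>. \<pi> permutes {0..<n}}. signof \<pi> * (\<Prod>i=0..<n. M x $$ (i, \<pi> i)))
      \<in> polyfun_poly X"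
    by (intro polyfun_poly_sum polyfun_poly_mult polyfun_poly_const polyfun_poly_prod assms(2))
      (auto dest: permutes_in_image)
  then show ?thesis
    by (simp add: det_def'[OF assms(1)])
qed

section \<open>Linearly independent families\<close>

text \<open>Independence of an indexed family, so that two indices carrying the same vector count as
  dependent. The coordinate \<open>k\<close> will be the position of a coefficient in a polynomial
  in lambda.\<close>

definition indep_family :: "'b set \<Rightarrow> ('b \<Rightarrow> 'c \<Rightarrow> complex) \<Rightarrow> bool" where
  "indep_family B F \<longleftrightarrow>
     (\<forall>c. (\<forall>k. (\<Sum>b\<in>B. c b * F b k) = 0) \<longrightarrow> (\<forall>b\<in>B. c b = 0))"

lemma indep_familyD:
  "indep_family B F \<Longrightarrow> (\<And>k. (\<Sum>b\<in>B. c b * F b k) = 0) \<Longrightarrow> b \<in> B \<Longrightarrow> c b = 0"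
  unfolding indep_family_def by blast

lemma indep_family_subset:
  assumes "indep_family B F" "C \<subseteq> B" "finite B"
  shows "indep_family C F"
  unfolding indep_family_def
proof (intro allI impI ballI)
  fix c b assume c: "\<forall>k. (\<Sum>b\<in>C. c b * F b k) = 0" and b: "b \<in> C"
  have "(\<Sum>b\<in>B. (if b \<in> C then c b else 0) * F b k) = (\<Sum>b\<in>C. c b * F b k)" for k
    using assms(2,3) by (intro sum.mono_neutral_cong_right) auto
  with indep_familyD[OF assms(1), of "\<lambda>b. if b \<in> C then c b else 0" b] c b assms(2)
  show "c b = 0" by auto
qed

lemma indep_family_nonzero:
  assumes "indep_family B F" "finite B" "b \<in> B"
  obtains k where "F b k \<noteq> 0"
proof -
  have "\<exists>k. F b k \<noteq> 0"
  proof (rule ccontr)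
    assume *: "\<nexists>k. F b k \<noteq> 0"
    have "(\<Sum>a\<in>B. (if a = b then 1 else 0) * F a k) = 0" for k
      using * by (intro sum.neutral) auto
    from indep_familyD[OF assms(1) this assms(3)] show False by simp
  qed
  then show ?thesis using that by blast
qed

lemma indep_family_poly:
  "indep_family B (\<lambda>b. coeff (P b)) \<longleftrightarrow>
     (\<forall>c. (\<Sum>b\<in>B. Polynomial.smult (c b) (P b)) = 0 \<longrightarrow> (\<forall>b\<in>B. c b = 0))"
  by (simp add: indep_family_def poly_eq_iff coeff_sum)

lemma indep_family_polyD:
  assumes "indep_family B (\<lambda>b. coeff (P b))" "(\<Sum>b\<in>B. Polynomial.smult (c b) (P b)) = 0" "b \<in> B"
  shows "c b = 0"
  using assms unfolding indep_family_poly by blast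

text \<open>
  Gaussian elimination with polynomial coefficients: independence is certified by the
  non-vanishing of one polynomial, the product of the pivots.
\<close>

lemma indep_family_certificate:
  fixes F :: "'b \<Rightarrow> 'c \<Rightarrow> 'a \<Rightarrow> complex"
  assumes "finite B" "\<And>b k. b \<in> B \<Longrightarrow> F b k \<in> polyfun X"
    and "indep_family B (\<lambda>b k. F b k x0)"
  obtains \<Delta> where "\<Delta> \<in> polyfun X" "\<Delta> x0 \<noteq> 0"
    "\<And>x. \<Delta> x \<noteq> 0 \<Longrightarrow> indep_family B (\<lambda>b k. F b k x)"
proof -
  have "\<exists>\<Delta>\<in>polyfun X. \<Delta> x0 \<noteq> 0 \<and> (\<forall>x. \<Delta> x \<noteq> 0 \<longrightarrow> indep_family B (\<lambda>b k. F b k x))"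
    using assms
  proof (induction B arbitrary: F rule: finite_induct)
    case empty
    show ?case
      by (intro bexI[OF _ polyfun.const[of 1]]) (auto simp: indep_family_def)
  next
    case (insert a B F)
    obtain k0 where k0: "F a k0 x0 \<noteq> 0"
      using indep_family_nonzero[OF insert.prems(2), of a] insert.hyps(1) by auto
    \<comment> \<open>Fraction-free elimination of coordinate \<open>k0\<close>: multiplying by the
      pivot instead of dividing by it keeps the entries polynomial in \<open>x\<close>.\<close>
    define G where "G b k x = F a k0 x * F b k x - F b k0 x * F a k x" for b k x
    have combG: "(\<Sum>b\<in>B. c b * G b k x) =
        F a k0 x * (\<Sum>b\<in>B. c b * F b k x) - (\<Sum>b\<in>B. c b * F b k0 x) * F a k x" for c k x
      unfolding G_def by (simp add: sum_distrib_left sum_distrib_right sum_subtractf algebra_simps)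
    have ins: "(\<Sum>b\<in>insert a B. c b * F b k x) = c a * F a k x + (\<Sum>b\<in>B. c b * F b k x)" for c k x
      using insert.hyps by simp
    have "indep_family B (\<lambda>b k. G b k x0)"
      unfolding indep_family_def
    proof (intro allI impI ballI)
      fix c b assume c: "\<forall>k. (\<Sum>b\<in>B. c b * G b k x0) = 0" and b: "b \<in> B"
      \<comment> \<open>A relation between the eliminated rows becomes one between the original rows
        once \<open>a\<close> receives the coefficient collected by the subtracted pivot
        rows.\<close>
      let ?c = "\<lambda>b. if b = a then - (\<Sum>b\<in>B. c b * F b k0 x0) else F a k0 x0 * c b"
      have "(\<Sum>b\<in>insert a B. ?c b * F b k x0) = 0" for k
      proof -
        have "(\<Sum>b\<in>B. ?c b * F b k x0) = F a k0 x0 * (\<Sum>b\<in>B. c b * F b k x0)"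
          using insert.hyps by (auto simp: sum_distrib_left intro!: sum.cong)
        then show ?thesis
          using c combG[of c k x0] ins[of ?c k x0] by (simp add: algebra_simps)
      qed
      from indep_familyD[OF insert.prems(2) this, of b] b insert.hyps k0
      show "c b = 0" by (auto split: if_splits)
    qed
    moreover have "G b k \<in> polyfun X" if "b \<in> B" for b k
      unfolding G_def using that insert.prems(1)
      by (intro polyfun_diff polyfun.mult) auto
    ultimately obtain \<Delta> where D: "\<Delta> \<in> polyfun X" "\<Delta> x0 \<noteq> 0"
      "\<forall>x. \<Delta> x \<noteq> 0 \<longrightarrow> indep_family B (\<lambda>b k. G b k x)"
      using insert.IH[of G] by blast
    have "indep_family (insert a B) (\<lambda>b k. F b k x)" if x: "\<Delta> x * F a k0 x \<noteq> 0" for x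
      unfolding indep_family_def
    proof (intro allI impI)
      fix c assume c: "\<forall>k. (\<Sum>b\<in>insert a B. c b * F b k x) = 0"
      have rest: "(\<Sum>b\<in>B. c b * F b k x) = - c a * F a k x" for k
        using c ins[of c k x] by (simp add: add_eq_0_iff)
      have "(\<Sum>b\<in>B. c b * G b k x) = 0" for k
        unfolding combG rest by simp
      then have cB: "\<forall>b\<in>B. c b = 0"
        using D(3) x indep_familyD[of B "\<lambda>b k. G b k x" c] by auto
      then have "c a * F a k0 x = 0"
        using rest[of k0] by simp
      then show "\<forall>b\<in>insert a B. c b = 0"
        using cB x by auto
    qed
    then show ?case
      using D(1,2) k0 insert.prems(1)
      by (intro bexI[of _ "\<lambda>x. \<Delta> x * F a k0 x"] polyfun.mult) auto
  qed
  then show ?thesis using that by blast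
qed

text \<open>A dual basis of functionals, each supported on finitely many coordinates. By induction:
  the new vector differs from its projection onto the old ones at some coordinate, and evaluation of
  the residual there separates it from them.\<close>

lemma indep_family_dual:
  fixes F :: "'b \<Rightarrow> 'c \<Rightarrow> complex"
  assumes "finite B" "indep_family B F"
  obtains K w where "finite K"
    "\<And>a b. a \<in> B \<Longrightarrow> b \<in> B \<Longrightarrow> (\<Sum>k\<in>K. w a k * F b k) = (if a = b then 1 else 0)"
proof -
  have "\<exists>K w. finite K \<and>
    (\<forall>a\<in>B. \<forall>b\<in>B. (\<Sum>k\<in>K. w a k * F b k) = (if a = b then 1 else (0::complex)))"
    using assms
  proof (induction B rule: finite_induct)
    case empty
    then show ?case by auto
  next
    case (insert a B)
    obtain K w where Kw: "finite K"
      "\<And>b c. b \<in> B \<Longrightarrow> c \<in> B \<Longrightarrow> (\<Sum>k\<in>K. w b k * F c k) = (if b = c then 1 else 0)"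
      using insert.IH indep_family_subset[OF insert.prems] insert.hyps by blast
    define l where "l b f = (\<Sum>k\<in>K. w b k * f k)" for b f
    have "\<exists>k. F a k - (\<Sum>b\<in>B. l b (F a) * F b k) \<noteq> 0"
    proof (rule ccontr)
      assume *: "\<nexists>k. F a k - (\<Sum>b\<in>B. l b (F a) * F b k) \<noteq> 0"
      let ?c = "\<lambda>b. if b = a then 1 else - l b (F a)"
      have "(\<Sum>b\<in>B. ?c b * F b k) = - (\<Sum>b\<in>B. l b (F a) * F b k)" for k
        unfolding sum_negf[symmetric] using insert.hyps(2) by (intro sum.cong) auto
      then have "(\<Sum>b\<in>insert a B. ?c b * F b k) = 0" for k
        using * insert.hyps by auto
      from indep_familyD[OF insert.prems this, of a] show False by simp
    qed
    then obtain k0 where k0: "F a k0 - (\<Sum>b\<in>B. l b (F a) * F b k0) \<noteq> 0" by blast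
    define v where "v = F a k0 - (\<Sum>b\<in>B. l b (F a) * F b k0)"
    \<comment> \<open>The residual of \<open>f\<close> at \<open>k0\<close>, normalized: it is 1 at
      the new vector and 0 at every old one, which equals its own projection.\<close>
    define la where "la f = (f k0 - (\<Sum>b\<in>B. l b f * F b k0)) / v" for f
    define K' where "K' = insert k0 K"
    define W where "W b k = (if k \<in> K then w b k else 0)" for b k
    define wa where "wa k = ((if k = k0 then 1 else 0) - (\<Sum>b\<in>B. W b k * F b k0)) / v" for k
    have lW: "l b f = (\<Sum>k\<in>K'. W b k * f k)" for b f
      unfolding l_def K'_def W_def using Kw(1)
      by (intro sum.mono_neutral_cong_left) auto
    have finK': "finite K'" using Kw(1) by (simp add: K'_def)
    have law: "la f = (\<Sum>k\<in>K'. wa k * f k)" for f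
    proof -
      have "(\<Sum>k\<in>K'. wa k * f k) =
        ((\<Sum>k\<in>K'. (if k = k0 then 1 else 0) * f k) - (\<Sum>k\<in>K'. (\<Sum>b\<in>B. W b k * F b k0) * f k)) / v"
        unfolding wa_def sum_divide_distrib sum_subtractf[symmetric]
        by (intro sum.cong) (auto simp: field_simps)
      also have "(\<Sum>k\<in>K'. (if k = k0 then 1 else 0) * f k) = f k0"
        using finK' by (simp add: K'_def if_distrib[of "\<lambda>x. x * _"] cong: if_cong)
      also have "(\<Sum>k\<in>K'. (\<Sum>b\<in>B. W b k * F b k0) * f k) = (\<Sum>b\<in>B. l b f * F b k0)"
        unfolding lW sum_distrib_right sum_distrib_left
        by (subst sum.swap) (auto intro!: sum.cong simp: algebra_simps)
      finally show ?thesis unfolding la_def ..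
    qed
    have la_a: "la (F a) = 1"
      using k0 by (simp add: la_def v_def)
    have lF: "l b (F c) = (if b = c then 1 else 0)" if "b \<in> B" "c \<in> B" for b c
      using Kw(2)[OF that] by (simp add: l_def)
    have la_b: "la (F c) = 0" if "c \<in> B" for c
    proof -
      have "(\<Sum>b\<in>B. l b (F c) * F b k0) = (\<Sum>b\<in>B. (if b = c then 1 else 0) * F b k0)"
        using lF that by (intro sum.cong) auto
      then have "(\<Sum>b\<in>B. l b (F c) * F b k0) = F c k0"
        using that insert.hyps(1) by (simp add: if_distrib[of "\<lambda>x. x * _"] cong: if_cong)
      then show ?thesis by (simp add: la_def)
    qed
    \<comment> \<open>The old functionals are corrected by a multiple of \<open>la\<close> so that
      they vanish at the new vector; \<open>la\<close> vanishes at the old ones, so their old values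
      stay.\<close>
    define w' where "w' b k = (if b = a then wa k else W b k - l b (F a) * wa k)" for b k
    have w'a: "(\<Sum>k\<in>K'. w' a k * f k) = la f" for f
      by (simp add: w'_def law)
    have w'b: "(\<Sum>k\<in>K'. w' b k * f k) = l b f - l b (F a) * la f" if "b \<noteq> a" for b f
    proof -
      have "(\<Sum>k\<in>K'. w' b k * f k) = (\<Sum>k\<in>K'. W b k * f k) - (\<Sum>k\<in>K'. l b (F a) * (wa k * f k))"
        using that by (simp add: w'_def left_diff_distrib mult.assoc sum_subtractf)
      then show ?thesis
        by (simp only: lW[symmetric] law[symmetric] sum_distrib_left[symmetric])
    qed
    have "\<forall>b\<in>insert a B. \<forall>c\<in>insert a B. (\<Sum>k\<in>K'. w' b k * F c k) = (if b = c then 1 else 0)"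
    proof (intro ballI)
      fix b c assume "b \<in> insert a B" "c \<in> insert a B"
      then show "(\<Sum>k\<in>K'. w' b k * F c k) = (if b = c then 1 else 0)"
        using la_a la_b lF w'a w'b insert.hyps(2) by (cases "b = a"; cases "c = a") auto
    qed
    then show ?case using finK' by blast
  qed
  then show ?thesis using that by blast
qed

lemma homogeneous_system_nontrivial:
  fixes C :: "'j \<Rightarrow> 'k \<Rightarrow> complex"
  assumes "finite K" "finite J" "card K < card J"
  obtains a j where "j \<in> J" "a j \<noteq> 0" "\<And>k. k \<in> K \<Longrightarrow> (\<Sum>j\<in>J. a j * C j k) = 0"
proof -
  have "\<exists>a. (\<exists>j\<in>J. a j \<noteq> 0) \<and> (\<forall>k\<in>K. (\<Sum>j\<in>J. a j * C j k) = 0)"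
    using assms
  proof (induction K arbitrary: J C rule: finite_induct)
    case empty
    then show ?case by (intro exI[of _ "\<lambda>_. 1"]) (auto simp: card_gt_0_iff)
  next
    case (insert k K)
    show ?case
    proof (cases "\<forall>j\<in>J. C j k = 0")
      case True
      with insert.IH[of J C] insert.prems insert.hyps show ?thesis by auto
    next
      case False
      then obtain i where i: "i \<in> J" "C i k \<noteq> 0" by blast
      define J' where "J' = J - {i}"
      have J: "J = insert i J'" "i \<notin> J'" "finite J'"
        using i insert.prems by (auto simp: J'_def)
      have "card K < card J'" using insert.prems insert.hyps J by simp
      from insert.IH[OF J(3) this, of "\<lambda>j l. C j l - C j k / C i k * C i l"]
      obtain a where a: "\<exists>j\<in>J'. a j \<noteq> 0"
        "\<forall>l\<in>K. (\<Sum>j\<in>J'. a j * (C j l - C j k / C i k * C i l)) = 0" by blast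
      \<comment> \<open>The unknown \<open>i\<close> is solved from equation \<open>k\<close>; the
        remaining unknowns have to satisfy the equations reduced by this pivot.\<close>
      define s where "s = (\<Sum>j\<in>J'. a j * C j k) / C i k"
      define a' where "a' j = (if j = i then - s else a j)" for j
      have comb: "(\<Sum>j\<in>J. a' j * C j l) = - s * C i l + (\<Sum>j\<in>J'. a j * C j l)" for l
        unfolding J(1) using J(2,3) by (auto simp: a'_def intro!: sum.cong)
      have "(\<Sum>j\<in>J. a' j * C j l) = 0" if "l \<in> insert k K" for l
      proof (cases "l = k")
        case True
        then show ?thesis unfolding comb s_def using i(2) by simp
      next
        case False
        have "(\<Sum>j\<in>J'. a j * (C j l - C j k / C i k * C i l)) =
            (\<Sum>j\<in>J'. a j * C j l) - (\<Sum>j\<in>J'. a j * C j k) / C i k * C i l"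
          by (simp add: right_diff_distrib sum_subtractf sum_divide_distrib sum_distrib_right
              mult.assoc)
        also have "\<dots> = (\<Sum>j\<in>J. a' j * C j l)"
          unfolding comb s_def by simp
        finally show ?thesis using a(2) False that by (metis insertE)
      qed
      moreover have "\<exists>j\<in>J. a' j \<noteq> 0"
        using a(1) J(1,2) by (auto simp: a'_def)
      ultimately show ?thesis by (intro exI[of _ a'] conjI ballI) blast+
    qed
  qed
  then show ?thesis using that by blast
qed

section \<open>Algebraic independence\<close>

lemma poly_eq_0_if_cofinite:
  fixes P :: "complex poly"
  assumes "finite S" "\<And>t. t \<notin> S \<Longrightarrow> poly P t = 0"
  shows "P = 0"
proof (rule ccontr)
  assume "P \<noteq> 0"
  then have "finite {t. poly P t = 0}" by (rule poly_roots_finite)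
  moreover have "UNIV \<subseteq> S \<union> {t. poly P t = 0}" using assms(2) by blast
  ultimately have "finite (UNIV :: complex set)"
    using assms(1) by (meson finite_Un finite_subset)
  then show False using infinite_UNIV_char_0 by blast
qed

text \<open>Independence modulo the functions vanishing on \<open>X\<close>. Exponents are taken in
  \<open>extensional I\<close> because two exponents that differ only outside \<open>I\<close> would
  give the same monomial and hence a spurious relation.\<close>

definition alg_indep :: "'a set \<Rightarrow> 'i set \<Rightarrow> ('i \<Rightarrow> 'a \<Rightarrow> complex) \<Rightarrow> bool" where
  "alg_indep X I y \<longleftrightarrow>
     (\<forall>E a. finite E \<and> E \<subseteq> extensional I \<and>
        (\<forall>x\<in>X. (\<Sum>e\<in>E. a e * (\<Prod>i\<in>I. y i x ^ (e i :: nat))) = 0) \<longrightarrow> (\<forall>e\<in>E. a e = 0))"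

text \<open>Discarding zero coefficients ensures that minimal exponents and minimal degrees of a
  relation are attained by genuine terms.\<close>

lemma alg_indepI:
  assumes "\<And>E a. finite E \<Longrightarrow> E \<subseteq> extensional I \<Longrightarrow> (\<And>e. e \<in> E \<Longrightarrow> a e \<noteq> 0) \<Longrightarrow> E \<noteq> {} \<Longrightarrow>
      (\<And>x. x \<in> X \<Longrightarrow> (\<Sum>e\<in>E. a e * (\<Prod>i\<in>I. y i x ^ (e i :: nat))) = 0) \<Longrightarrow> False"
  shows "alg_indep X I y"
  unfolding alg_indep_def
proof (intro allI impI ballI, elim conjE, rule ccontr)
  fix E a e
  assume E: "finite E" "E \<subseteq> extensional I" "e \<in> E" "a e \<noteq> 0"
    and 0: "\<forall>x\<in>X. (\<Sum>e\<in>E. a e * (\<Prod>i\<in>I. y i x ^ (e i :: nat))) = 0"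
  have "(\<Sum>e | e \<in> E \<and> a e \<noteq> 0. a e * (\<Prod>i\<in>I. y i x ^ e i)) = 0" if "x \<in> X" for x
  proof -
    have "(\<Sum>e | e \<in> E \<and> a e \<noteq> 0. a e * (\<Prod>i\<in>I. y i x ^ e i)) =
        (\<Sum>e\<in>E. a e * (\<Prod>i\<in>I. y i x ^ e i))"
      using E(1) by (intro sum.mono_neutral_left) auto
    then show ?thesis using 0 that by simp
  qed
  with E show False
    by (intro assms[of "{e \<in> E. a e \<noteq> 0}" a]) auto
qed

lemma alg_indepD:
  assumes "alg_indep X I y" "finite E" "E \<subseteq> extensional I" "e \<in> E"
    and "\<And>x. x \<in> X \<Longrightarrow> (\<Sum>e\<in>E. a e * (\<Prod>i\<in>I. y i x ^ (e i :: nat))) = 0"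
  shows "a e = 0"
  using assms unfolding alg_indep_def by blast

lemma alg_indep_empty:
  assumes "X \<noteq> {}"
  shows "alg_indep X {} y"
proof (rule alg_indepI)
  fix E and a :: "_ \<Rightarrow> complex"
  assume E: "E \<subseteq> extensional {}" "\<And>e. e \<in> E \<Longrightarrow> a e \<noteq> 0" "E \<noteq> {}"
    "\<And>x. x \<in> X \<Longrightarrow> (\<Sum>e\<in>E. a e * (\<Prod>i\<in>{}. y i x ^ (e i :: nat))) = 0"
  have "E = {\<lambda>_. undefined}" using E(1,3) by auto
  then show False using E(2,4) assms by auto
qed

text \<open>A relation on \<open>Y\<close> is itself a polynomial in the \<open>z i\<close>
  vanishing on \<open>Y\<close>, hence gives a relation on \<open>X\<close>. It is applied with
  images that have the same Zariski closure or a closure that contains \<open>X\<close>.\<close>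

lemma alg_indep_transfer:
  assumes "alg_indep X I y"
    and "\<And>Q. Q \<in> polyfun (z ` I) \<Longrightarrow> (\<And>x. x \<in> Y \<Longrightarrow> Q x = 0) \<Longrightarrow> (\<And>x. x \<in> X \<Longrightarrow> Q (\<phi> x) = 0)"
    and "\<And>i x. i \<in> I \<Longrightarrow> x \<in> X \<Longrightarrow> y i x = z i (\<phi> x)"
  shows "alg_indep Y I z"
proof (rule alg_indepI)
  fix E a
  assume E: "finite E" "E \<subseteq> extensional I" "\<And>e. e \<in> E \<Longrightarrow> a e \<noteq> 0" "E \<noteq> {}"
    "\<And>x. x \<in> Y \<Longrightarrow> (\<Sum>e\<in>E. a e * (\<Prod>i\<in>I. z i x ^ (e i :: nat))) = 0"
  let ?Q = "\<lambda>x. \<Sum>e\<in>E. a e * (\<Prod>i\<in>I. z i x ^ (e i :: nat))"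
  have "?Q \<in> polyfun (z ` I)"
    by (intro polyfun_sum polyfun.mult polyfun.const polyfun_prod polyfun_power polyfun.gen) auto
  then have "?Q (\<phi> x) = 0" if "x \<in> X" for x
    using assms(2)[of ?Q x] E(5) that by blast
  then have "(\<Sum>e\<in>E. a e * (\<Prod>i\<in>I. y i x ^ (e i :: nat))) = 0" if "x \<in> X" for x
    using that assms(3) by simp
  with alg_indepD[OF assms(1) E(1,2)] E(3,4) show False by blast
qed

text \<open>
  The function \<open>y i0\<close> vanishes on \<open>Z\<close> but is a non-zero-divisor on \<open>Z'\<close>: dividing a
  relation on \<open>Z'\<close> by a power of it leaves a nontrivial relation after restriction to \<open>Z\<close>.
\<close>

lemma alg_indep_extend:
  assumes "finite I" "i0 \<notin> I" "alg_indep Z I y" "Z \<subseteq> Z'" "\<And>x. x \<in> Z \<Longrightarrow> y i0 x = 0"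
    and nzd: "\<And>Q. Q \<in> polyfun (y ` insert i0 I) \<Longrightarrow> (\<And>x. x \<in> Z' \<Longrightarrow> y i0 x * Q x = 0) \<Longrightarrow>
      (\<And>x. x \<in> Z' \<Longrightarrow> Q x = 0)"
  shows "alg_indep Z' (insert i0 I) y"
proof (rule alg_indepI)
  fix E a
  assume E: "finite E" "E \<subseteq> extensional (insert i0 I)" "\<And>e. e \<in> E \<Longrightarrow> a e \<noteq> 0" "E \<noteq> {}"
    and rel: "\<And>x. x \<in> Z' \<Longrightarrow> (\<Sum>e\<in>E. a e * (\<Prod>i\<in>insert i0 I. y i x ^ (e i :: nat))) = 0"
  \<comment> \<open>The largest power of \<open>y i0\<close> that divides the whole
    relation.\<close>
  define s where "s = Min ((\<lambda>e. e i0) ` E)"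
  have s_le: "s \<le> e i0" if "e \<in> E" for e
    unfolding s_def using E(1) that by simp
  obtain e0 where e0: "e0 \<in> E" "e0 i0 = s"
    using Min_in[of "(\<lambda>e. e i0) ` E"] E(1,4) unfolding s_def[symmetric] by auto
  define Q where "Q x = (\<Sum>e\<in>E. a e * (y i0 x ^ (e i0 - s) * (\<Prod>i\<in>I. y i x ^ e i)))" for x
  have Q: "Q \<in> polyfun (y ` insert i0 I)"
    unfolding Q_def
    by (intro polyfun_sum polyfun.mult polyfun.const polyfun_prod polyfun_power polyfun.gen) auto
  have split: "(\<Sum>e\<in>E. a e * (\<Prod>i\<in>insert i0 I. y i x ^ e i)) = y i0 x ^ s * Q x" for x
    unfolding Q_def sum_distrib_left
  proof (intro sum.cong refl)
    fix e assume "e \<in> E"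
    then have "y i0 x ^ e i0 = y i0 x ^ s * y i0 x ^ (e i0 - s)"
      using s_le by (simp flip: power_add)
    then show "a e * (\<Prod>i\<in>insert i0 I. y i x ^ e i) =
        y i0 x ^ s * (a e * (y i0 x ^ (e i0 - s) * (\<Prod>i\<in>I. y i x ^ e i)))"
      using assms(1,2) by simp
  qed
  have "\<forall>x\<in>Z'. y i0 x ^ k * Q x = 0 \<Longrightarrow> \<forall>x\<in>Z'. Q x = 0" for k
  proof (induction k)
    case (Suc k)
    have pf: "(\<lambda>x. y i0 x ^ k * Q x) \<in> polyfun (y ` insert i0 I)"
      by (intro polyfun.mult polyfun_power polyfun.gen Q) auto
    have "y i0 x * (y i0 x ^ k * Q x) = 0" if "x \<in> Z'" for x
      using Suc.prems that by auto
    then have "\<forall>x\<in>Z'. y i0 x ^ k * Q x = 0"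
      using nzd[OF pf] by blast
    then show ?case by (rule Suc.IH)
  qed simp
  then have Q0: "Q x = 0" if "x \<in> Z'" for x
    using rel that unfolding split by blast
  \<comment> \<open>On \<open>Z\<close> the function \<open>y i0\<close> vanishes, so only the terms
    where nothing of it is left after the division survive.\<close>
  define E0 where "E0 = {e \<in> E. e i0 = s}"
  have Z0: "(\<Sum>e\<in>E0. a e * (\<Prod>i\<in>I. y i x ^ e i)) = 0" if "x \<in> Z" for x
  proof -
    have "Q x = (\<Sum>e\<in>E0. a e * (\<Prod>i\<in>I. y i x ^ e i))"
      unfolding Q_def
    proof (rule sum.mono_neutral_cong_right)
      show "\<forall>e\<in>E - E0. a e * (y i0 x ^ (e i0 - s) * (\<Prod>i\<in>I. y i x ^ e i)) = 0"
        using assms(5)[OF that] s_le unfolding E0_def by (fastforce simp: le_less)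
    qed (use E(1) in \<open>auto simp: E0_def\<close>)
    then show ?thesis using Q0 that assms(4) by auto
  qed
  define r where "r e = e(i0 := undefined)" for e :: "_ \<Rightarrow> nat"
  \<comment> \<open>All exponents in \<open>E0\<close> have the same value at \<open>i0\<close>, so
    forgetting that value loses nothing and \<open>r'\<close> restores it.\<close>
  define r' where "r' e = e(i0 := s)" for e :: "_ \<Rightarrow> nat"
  have r'r: "r' (r e) = e" if "e \<in> E0" for e
    using that by (auto simp: r_def r'_def E0_def)
  have inj: "inj_on r E0" by (metis inj_onI r'r)
  have "a (r' (r e0)) = 0"
  proof (rule alg_indepD[OF assms(3), where a = "\<lambda>e. a (r' e)"])
    show "finite (r ` E0)" using E(1) by (simp add: E0_def)
    show "r ` E0 \<subseteq> extensional I"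
      using E(2) by (fastforce simp: r_def E0_def extensional_def)
    show "r e0 \<in> r ` E0" using e0 by (simp add: E0_def)
    fix x assume x: "x \<in> Z"
    have "(\<Sum>e\<in>r ` E0. a (r' e) * (\<Prod>i\<in>I. y i x ^ e i)) =
        (\<Sum>e\<in>E0. a (r' (r e)) * (\<Prod>i\<in>I. y i x ^ r e i))"
      by (simp add: sum.reindex[OF inj])
    also have "\<dots> = (\<Sum>e\<in>E0. a e * (\<Prod>i\<in>I. y i x ^ e i))"
      using assms(2) by (intro sum.cong arg_cong2[of _ _ _ _ "(*)"] prod.cong)
        (auto simp: r'r, auto simp: r_def)
    finally show "(\<Sum>e\<in>r ` E0. a (r' e) * (\<Prod>i\<in>I. y i x ^ e i)) = 0"
      using Z0[OF x] by simp
  qed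
  then show False using r'r e0 E(3) by (simp add: E0_def)
qed

text \<open>Adding one coordinate at a time, with \<open>Z\<close> the hyperplane where the new
  coordinate is zero. The coordinate is a non-zero-divisor because a one-variable polynomial
  vanishing for all nonzero arguments is zero.\<close>

lemma alg_indep_coordinates:
  assumes "finite I"
  shows "alg_indep UNIV I (\<lambda>i \<xi>. \<xi> i)"
  using assms
proof induction
  case empty
  show ?case by (rule alg_indep_empty) simp
next
  case (insert i0 I)
  show ?case
  proof (rule alg_indep_extend[OF insert.hyps, of "{\<xi>. \<xi> i0 = 0}"])
    show "alg_indep {\<xi>. \<xi> i0 = 0} I (\<lambda>i \<xi>. \<xi> i)"
    proof (rule alg_indepI)
      fix E and a :: "_ \<Rightarrow> complex"
      assume E: "finite E" "E \<subseteq> extensional I" "\<And>e. e \<in> E \<Longrightarrow> a e \<noteq> 0" "E \<noteq> {}"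
        and rel: "\<And>x. x \<in> {\<xi>. \<xi> i0 = 0} \<Longrightarrow> (\<Sum>e\<in>E. a e * (\<Prod>i\<in>I. x i ^ (e i :: nat))) = 0"
      have rel': "(\<Sum>e\<in>E. a e * (\<Prod>i\<in>I. x i ^ e i)) = 0" for x
      proof -
        have "(\<Prod>i\<in>I. (x(i0 := 0)) i ^ e i) = (\<Prod>i\<in>I. x i ^ e i)" for e :: "_ \<Rightarrow> nat"
          using insert.hyps by (intro prod.cong) auto
        then show ?thesis using rel[of "x(i0 := 0)"] by simp
      qed
      obtain e where "e \<in> E" using E(4) by blast
      then show False using alg_indepD[OF insert.IH E(1,2) _, of _ a] rel' E(3) by blast
    qed
    fix Q \<xi>
    assume Q: "Q \<in> polyfun ((\<lambda>i \<xi>. \<xi> i) ` insert i0 I)"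
      and 0: "\<And>x. x \<in> UNIV \<Longrightarrow> x i0 * Q x = 0"
    have "\<exists>P. \<forall>t. Q (\<xi>(i0 := t)) = poly P t"
    proof (rule polyfun_univariate[OF Q])
      fix g :: "(_ \<Rightarrow> complex) \<Rightarrow> complex"
      assume "g \<in> (\<lambda>i \<xi>. \<xi> i) ` insert i0 I"
      then obtain i where "g = (\<lambda>\<xi>. \<xi> i)" by blast
      then show "\<exists>P. \<forall>t. g (\<xi>(i0 := t)) = poly P t"
        by (intro exI[of _ "if i = i0 then [:0, 1:] else [:\<xi> i:]"]) auto
    qed
    then obtain P where P: "\<And>t. Q (\<xi>(i0 := t)) = poly P t" by blast
    have "poly P t = 0" if "t \<notin> {0}" for t
      using 0[of "\<xi>(i0 := t)"] P that by auto
    then have "P = 0" by (intro poly_eq_0_if_cofinite[of "{0}"]) auto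
    then show "Q \<xi> = 0" using P[of "\<xi> i0"] by simp
  qed auto
qed

text \<open>Compares lowest order terms at \<open>t = 0\<close> along the curves.\<close>

lemma alg_indep_if_tangents:
  assumes "finite I"
    and curves: "\<And>\<xi>. \<exists>\<gamma>. (\<forall>t. \<gamma> t \<in> X) \<and> (\<forall>i\<in>I. ((\<lambda>t. y i (\<gamma> t) / t) \<longlongrightarrow> \<xi> i) (at 0))"
  shows "alg_indep X I y"
proof (rule alg_indepI)
  fix E a
  assume E: "finite E" "E \<subseteq> extensional I" "\<And>e. e \<in> E \<Longrightarrow> a e \<noteq> 0" "E \<noteq> {}"
    and rel: "\<And>x. x \<in> X \<Longrightarrow> (\<Sum>e\<in>E. a e * (\<Prod>i\<in>I. y i x ^ (e i :: nat))) = 0"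
  define N where "N e = (\<Sum>i\<in>I. e i)" for e :: "_ \<Rightarrow> nat"
  define d where "d = Min (N ` E)"
  have d_le: "d \<le> N e" if "e \<in> E" for e
    unfolding d_def using E(1) that by simp
  obtain e0 where e0: "e0 \<in> E" "N e0 = d"
    using Min_in[of "N ` E"] E(1,4) unfolding d_def[symmetric] by auto
  define E0 where "E0 = {e \<in> E. N e = d}"
  have "(\<Sum>e\<in>E0. a e * (\<Prod>i\<in>I. \<xi> i ^ e i)) = 0" for \<xi>
  proof -
    obtain \<gamma> where \<gamma>: "\<And>t. \<gamma> t \<in> X" "\<And>i. i \<in> I \<Longrightarrow> ((\<lambda>t. y i (\<gamma> t) / t) \<longlongrightarrow> \<xi> i) (at 0)"
      using curves by blast
    \<comment> \<open>The relation along the curve divided by \<open>t ^ d\<close>, where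
      \<open>d\<close> is the lowest total degree; each monomial absorbs one factor \<open>t\<close>
      per variable.\<close>
    define h where "h t = (\<Sum>e\<in>E. a e * (t ^ (N e - d) * (\<Prod>i\<in>I. (y i (\<gamma> t) / t) ^ e i)))" for t
    have "h t = 0" if "t \<noteq> 0" for t
    proof -
      have "t ^ d * (t ^ (N e - d) * (\<Prod>i\<in>I. (y i (\<gamma> t) / t) ^ e i)) = (\<Prod>i\<in>I. y i (\<gamma> t) ^ e i)"
        if "e \<in> E" for e
      proof -
        have "t ^ d * t ^ (N e - d) = (\<Prod>i\<in>I. t ^ e i)"
          using d_le[OF that] by (simp add: N_def power_sum flip: power_add)
        then show ?thesis
          using \<open>t \<noteq> 0\<close> by (simp add: power_divide prod_dividef mult.assoc[symmetric] assms(1))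
      qed
      then have "t ^ d * h t = (\<Sum>e\<in>E. a e * (\<Prod>i\<in>I. y i (\<gamma> t) ^ e i))"
        unfolding h_def sum_distrib_left
        by (intro sum.cong refl) (simp add: mult.left_commute[of "t ^ d"])
      then show ?thesis using rel[OF \<gamma>(1)] that by simp
    qed
    then have "(h \<longlongrightarrow> 0) (at 0)"
      by (intro tendsto_eventually) (auto simp: eventually_at_filter)
    moreover have "(h \<longlongrightarrow> (\<Sum>e\<in>E. a e * (0 ^ (N e - d) * (\<Prod>i\<in>I. \<xi> i ^ e i)))) (at 0)"
      unfolding h_def
      by (intro tendsto_sum tendsto_mult tendsto_const tendsto_power tendsto_prod tendsto_ident_at \<gamma>(2))
    \<comment> \<open>Here \<open>0 ^ 0 = 1\<close> keeps exactly the terms of lowest degree,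
      leaving a relation between the coordinates of \<xi>.\<close>
    moreover have "(\<Sum>e\<in>E. a e * (0 ^ (N e - d) * (\<Prod>i\<in>I. \<xi> i ^ e i))) =
        (\<Sum>e\<in>E0. a e * (\<Prod>i\<in>I. \<xi> i ^ e i))"
    proof (rule sum.mono_neutral_cong_right)
      show "\<forall>e\<in>E - E0. a e * (0 ^ (N e - d) * (\<Prod>i\<in>I. \<xi> i ^ e i)) = 0"
        using d_le unfolding E0_def by (fastforce simp: le_less)
    qed (use E(1) in \<open>auto simp: E0_def\<close>)
    ultimately show ?thesis
      using tendsto_unique[of "at (0::complex)"] by fastforce
  qed
  moreover have "finite E0" "E0 \<subseteq> extensional I" "e0 \<in> E0"
    using E e0 by (auto simp: E0_def)
  ultimately have "a e0 = 0"
    using alg_indepD[OF alg_indep_coordinates[OF assms(1)], of E0 e0 a] by blast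
  then show False using E(3) e0 by blast
qed

section \<open>Counting monomials to bound the number of algebraically independent functions\<close>

text \<open>The degree is bounded in each variable separately, so that the number of monomials is
  exactly a power, \<open>(D + 1) ^ card B\<close>.\<close>

definition box_span :: "'b set \<Rightarrow> ('b \<Rightarrow> 'a \<Rightarrow> complex) \<Rightarrow> nat \<Rightarrow> ('a \<Rightarrow> complex) set" where
  "box_span B \<gamma> D = {h. \<exists>c. \<forall>x. h x = (\<Sum>e\<in>B \<rightarrow>\<^sub>E {..D}. c e * (\<Prod>b\<in>B. \<gamma> b x ^ e b))}"

context
  fixes B :: "'b set" and \<gamma> :: "'b \<Rightarrow> 'a \<Rightarrow> complex"
  assumes finite_B: "finite B"
begin

lemma finite_box: "finite (B \<rightarrow>\<^sub>E {..D::nat})"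
  using finite_B by (intro finite_PiE) auto

lemma box_span_monomial:
  assumes "e \<in> B \<rightarrow>\<^sub>E {..D}"
  shows "(\<lambda>x. \<Prod>b\<in>B. \<gamma> b x ^ e b) \<in> box_span B \<gamma> D"
  unfolding box_span_def
proof (intro CollectI exI allI)
  fix x
  show "(\<Prod>b\<in>B. \<gamma> b x ^ e b) =
      (\<Sum>e'\<in>B \<rightarrow>\<^sub>E {..D}. (if e' = e then 1 else 0) * (\<Prod>b\<in>B. \<gamma> b x ^ e' b))"
    using assms finite_box by (simp add: if_distrib[of "\<lambda>x. x * _"] cong: if_cong)
qed

lemma box_span_add:
  assumes "f \<in> box_span B \<gamma> D" "g \<in> box_span B \<gamma> D"
  shows "(\<lambda>x. f x + g x) \<in> box_span B \<gamma> D"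
proof -
  obtain c d where "\<forall>x. f x = (\<Sum>e\<in>B \<rightarrow>\<^sub>E {..D}. c e * (\<Prod>b\<in>B. \<gamma> b x ^ e b))"
    "\<forall>x. g x = (\<Sum>e\<in>B \<rightarrow>\<^sub>E {..D}. d e * (\<Prod>b\<in>B. \<gamma> b x ^ e b))"
    using assms unfolding box_span_def by blast
  then show ?thesis
    unfolding box_span_def
    by (intro CollectI exI[of _ "\<lambda>e. c e + d e"]) (simp add: distrib_right sum.distrib)
qed

lemma box_span_scale:
  assumes "f \<in> box_span B \<gamma> D"
  shows "(\<lambda>x. a * f x) \<in> box_span B \<gamma> D"
proof -
  obtain c where "\<forall>x. f x = (\<Sum>e\<in>B \<rightarrow>\<^sub>E {..D}. c e * (\<Prod>b\<in>B. \<gamma> b x ^ e b))"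
    using assms unfolding box_span_def by blast
  then show ?thesis
    unfolding box_span_def
    by (intro CollectI exI[of _ "\<lambda>e. a * c e"]) (simp add: sum_distrib_left mult.assoc)
qed

lemma box_span_sum:
  assumes "\<And>j. j \<in> J \<Longrightarrow> f j \<in> box_span B \<gamma> D"
  shows "(\<lambda>x. \<Sum>j\<in>J. f j x) \<in> box_span B \<gamma> D"
proof -
  have "(\<lambda>x. 0) \<in> box_span B \<gamma> D"
    unfolding box_span_def by (intro CollectI exI[of _ "\<lambda>_. 0"]) simp
  with assms show ?thesis
    by (induction J rule: infinite_finite_induct) (auto intro: box_span_add)
qed

lemma box_span_mult:
  assumes "f \<in> box_span B \<gamma> D" "g \<in> box_span B \<gamma> D'"
  shows "(\<lambda>x. f x * g x) \<in> box_span B \<gamma> (D + D')"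
proof -
  obtain c d where f: "\<And>x. f x = (\<Sum>e\<in>B \<rightarrow>\<^sub>E {..D}. c e * (\<Prod>b\<in>B. \<gamma> b x ^ e b))"
    and g: "\<And>x. g x = (\<Sum>e\<in>B \<rightarrow>\<^sub>E {..D'}. d e * (\<Prod>b\<in>B. \<gamma> b x ^ e b))"
    using assms unfolding box_span_def by blast
  have "f x * g x = (\<Sum>e\<in>B \<rightarrow>\<^sub>E {..D}. \<Sum>e'\<in>B \<rightarrow>\<^sub>E {..D'}.
      (c e * d e') * (\<Prod>b\<in>B. \<gamma> b x ^ (\<lambda>b\<in>B. e b + e' b) b))" for x
    unfolding f g sum_product by (simp add: power_add prod.distrib mult_ac)
  moreover have "(\<lambda>x. \<Sum>e\<in>B \<rightarrow>\<^sub>E {..D}. \<Sum>e'\<in>B \<rightarrow>\<^sub>E {..D'}.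
      (c e * d e') * (\<Prod>b\<in>B. \<gamma> b x ^ (\<lambda>b\<in>B. e b + e' b) b)) \<in> box_span B \<gamma> (D + D')"
  proof (intro box_span_sum box_span_scale box_span_monomial)
    fix e e' assume "e \<in> B \<rightarrow>\<^sub>E {..D}" "e' \<in> B \<rightarrow>\<^sub>E {..D'}"
    then have "e b \<le> D" "e' b \<le> D'" if "b \<in> B" for b
      using that by auto
    then show "(\<lambda>b\<in>B. e b + e' b) \<in> B \<rightarrow>\<^sub>E {..D + D'}"
      by (auto intro: add_mono)
  qed
  ultimately show ?thesis by simp
qed

lemma box_span_mono:
  assumes "f \<in> box_span B \<gamma> D" "D \<le> D'"
  shows "f \<in> box_span B \<gamma> D'"
proof -
  obtain c where f: "\<And>x. f x = (\<Sum>e\<in>B \<rightarrow>\<^sub>E {..D}. c e * (\<Prod>b\<in>B. \<gamma> b x ^ e b))"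
    using assms unfolding box_span_def by blast
  have "(\<lambda>x. \<Sum>e\<in>B \<rightarrow>\<^sub>E {..D}. c e * (\<Prod>b\<in>B. \<gamma> b x ^ e b)) \<in> box_span B \<gamma> D'"
    using assms(2) by (intro box_span_sum box_span_scale box_span_monomial)
      (auto simp: PiE_iff)
  then show ?thesis unfolding f[symmetric] .
qed

lemma box_span_const: "(\<lambda>_. a) \<in> box_span B \<gamma> D"
  using box_span_scale[OF box_span_monomial[of "\<lambda>b\<in>B. 0" D], of a] by simp

lemma box_span_power:
  assumes "f \<in> box_span B \<gamma> D"
  shows "(\<lambda>x. f x ^ k) \<in> box_span B \<gamma> (D * k)"
proof (induction k)
  case (Suc k)
  show ?case using box_span_mult[OF assms Suc] by simp
qed (simp add: box_span_const)

lemma box_span_prod: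
  assumes "finite I" "\<And>i. i \<in> I \<Longrightarrow> f i \<in> box_span B \<gamma> (D i)"
  shows "(\<lambda>x. \<Prod>i\<in>I. f i x) \<in> box_span B \<gamma> (\<Sum>i\<in>I. D i)"
  using assms
proof induction
  case (insert i I)
  then show ?case using box_span_mult[of "f i" "D i" "\<lambda>x. \<Prod>i\<in>I. f i x"] by simp
qed (simp add: box_span_const)

lemma polyfun_box_span:
  assumes "h \<in> polyfun (\<gamma> ` B)"
  obtains D where "h \<in> box_span B \<gamma> D"
proof -
  have "\<exists>D. h \<in> box_span B \<gamma> D"
    using assms
  proof induction
    case (const a)
    show ?case using box_span_const by blast
  next
    case (gen f)
    then obtain b where b: "b \<in> B" "f = \<gamma> b" by blast
    have "(\<Prod>a\<in>B. \<gamma> a x ^ (\<lambda>a\<in>B. if a = b then 1 else 0) a) = \<gamma> b x" for x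
    proof -
      have "(\<Prod>a\<in>B. \<gamma> a x ^ (\<lambda>a\<in>B. if a = b then 1 else 0) a) = (\<Prod>a\<in>B. if a = b then \<gamma> b x else 1)"
        by (intro prod.cong) auto
      then show ?thesis using b finite_B by simp
    qed
    then have "f \<in> box_span B \<gamma> 1"
      using box_span_monomial[of "\<lambda>a\<in>B. if a = b then 1 else 0" 1] b by auto
    then show ?case by blast
  next
    case (add f g)
    then obtain D D' where "f \<in> box_span B \<gamma> D" "g \<in> box_span B \<gamma> D'" by blast
    then have "f \<in> box_span B \<gamma> (D + D')" "g \<in> box_span B \<gamma> (D + D')"
      by (auto intro: box_span_mono)
    then show ?case using box_span_add by blast
  next
    case (mult f g)
    then show ?case using box_span_mult by blast
  qed
  then show ?thesis using that by blast
qed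

text \<open>
  Monomials in the \<open>y i\<close> with exponents up to \<open>M\<close> number \<open>(M + 1)\<^bsup>|I|\<^esup>\<close>, but they lie
  in a space of dimension \<open>O(M\<^bsup>|B|\<^esup>)\<close>.
\<close>

lemma not_alg_indep:
  assumes "finite I" "card B < card I"
    and y: "\<And>i. i \<in> I \<Longrightarrow> \<exists>h\<in>polyfun (\<gamma> ` B). \<forall>x\<in>X. y i x = h x"
  shows "\<not> alg_indep X I y"
proof
  assume indep: "alg_indep X I y"
  obtain h where h: "\<And>i. i \<in> I \<Longrightarrow> h i \<in> polyfun (\<gamma> ` B)"
    "\<And>i x. i \<in> I \<Longrightarrow> x \<in> X \<Longrightarrow> y i x = h i x"
    using y by metis
  have "\<exists>D. h i \<in> box_span B \<gamma> D" if "i \<in> I" for i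
    using polyfun_box_span h(1)[OF that] by blast
  then obtain D0 where D0: "\<And>i. i \<in> I \<Longrightarrow> h i \<in> box_span B \<gamma> (D0 i)" by metis
  define D where "D = (\<Sum>i\<in>I. D0 i)"
  have D: "h i \<in> box_span B \<gamma> D" if "i \<in> I" for i
    unfolding D_def using D0[OF that] that assms(1)
    by (elim box_span_mono) (simp add: member_le_sum)
  \<comment> \<open>With this \<open>q\<close> one gets \<open>L + 1 \<le> q * (M + 1)\<close>. The
    choice of \<open>M\<close> as \<open>q ^ card B\<close> then turns the constant factor into one
    that is smaller than a single further factor \<open>M + 1\<close>, and \<open>card I\<close>
    supplies that further factor.\<close>
  define q where "q = D * card I + 1"
  define M where "M = q ^ card B"
  define L where "L = D * M * card I"
  define J where "J = I \<rightarrow>\<^sub>E {..M}"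
  define K where "K = B \<rightarrow>\<^sub>E {..L}"
  have finJ: "finite J" unfolding J_def using assms(1) by (intro finite_PiE) auto
  have finK: "finite K" unfolding K_def by (rule finite_box)
  have "(\<lambda>x. \<Prod>i\<in>I. h i x ^ e i) \<in> box_span B \<gamma> L" if "e \<in> J" for e
  proof -
    have "(\<lambda>x. \<Prod>i\<in>I. h i x ^ e i) \<in> box_span B \<gamma> (\<Sum>i\<in>I. D * e i)"
      using assms(1) D by (intro box_span_prod box_span_power) auto
    moreover have "(\<Sum>i\<in>I. D * e i) \<le> (\<Sum>i\<in>I. D * M)"
      using that by (intro sum_mono mult_left_mono) (auto simp: J_def)
    ultimately show ?thesis
      by (elim box_span_mono) (simp add: L_def mult_ac)
  qed
  then have "\<forall>e\<in>J. \<exists>c. \<forall>x. (\<Prod>i\<in>I. h i x ^ e i) = (\<Sum>k\<in>K. c k * (\<Prod>b\<in>B. \<gamma> b x ^ k b))"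
    unfolding box_span_def K_def by blast
  then obtain C where C: "\<And>e x. e \<in> J \<Longrightarrow>
      (\<Prod>i\<in>I. h i x ^ e i) = (\<Sum>k\<in>K. C e k * (\<Prod>b\<in>B. \<gamma> b x ^ k b))"
    by metis
  have "card K = (L + 1) ^ card B"
    unfolding K_def using finite_B by (simp add: card_PiE)
  also have "L + 1 \<le> q * (M + 1)"
    unfolding L_def q_def by (simp add: algebra_simps)
  then have "(L + 1) ^ card B \<le> (q * (M + 1)) ^ card B"
    by (rule power_mono) simp
  also have "\<dots> = M * (M + 1) ^ card B"
    unfolding power_mult_distrib by (simp add: M_def)
  also have "\<dots> < (M + 1) ^ Suc (card B)" by simp
  also have "\<dots> \<le> (M + 1) ^ card I"
    using assms(2) by (intro power_increasing) auto
  also have "\<dots> = card J"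
    unfolding J_def using assms(1) by (simp add: card_PiE)
  finally obtain a e where a: "e \<in> J" "a e \<noteq> 0" "\<And>k. k \<in> K \<Longrightarrow> (\<Sum>e\<in>J. a e * C e k) = 0"
    using homogeneous_system_nontrivial[OF finK finJ, of C] by blast
  have "(\<Sum>e\<in>J. a e * (\<Prod>i\<in>I. y i x ^ e i)) = 0" if x: "x \<in> X" for x
  proof -
    have "(\<Sum>e\<in>J. a e * (\<Prod>i\<in>I. y i x ^ e i)) =
        (\<Sum>e\<in>J. \<Sum>k\<in>K. a e * C e k * (\<Prod>b\<in>B. \<gamma> b x ^ k b))"
      using h(2) x C by (intro sum.cong refl) (simp add: sum_distrib_left mult.assoc)
    also have "\<dots> = (\<Sum>k\<in>K. (\<Sum>e\<in>J. a e * C e k) * (\<Prod>b\<in>B. \<gamma> b x ^ k b))"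
      by (subst sum.swap) (simp add: sum_distrib_right)
    finally show ?thesis using a(3) by simp
  qed
  moreover have "J \<subseteq> extensional I" by (auto simp: J_def PiE_def)
  ultimately show False
    using alg_indepD[OF indep finJ, of e a] a(1,2) by blast
qed

end

section \<open>The resolvent of a compartment matrix\<close>

definition entries :: "((nat \<Rightarrow> nat \<Rightarrow> complex) \<Rightarrow> complex) set" where
  "entries = {\<lambda>A. A i j | i j. True}"

text \<open>Entries of the matrix lambda - A in vertex numbering from 1; \<open>adj_entry\<close>
  makes the shift to matrix indices from 0.\<close>

definition resolvent_entry :: "(nat \<Rightarrow> nat \<Rightarrow> complex) \<Rightarrow> nat \<Rightarrow> nat \<Rightarrow> complex poly" where
  "resolvent_entry A i j = (if i = j then [:0, 1:] else 0) - [:A i j:]"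

definition adj_entry :: "nat \<Rightarrow> (nat \<Rightarrow> nat \<Rightarrow> complex) \<Rightarrow> nat \<Rightarrow> nat \<Rightarrow> complex poly" where
  "adj_entry n A i j = adj_mat (char_poly_matrix (to_mat n A)) $$ (i - 1, j - 1)"

definition charpoly :: "nat \<Rightarrow> (nat \<Rightarrow> nat \<Rightarrow> complex) \<Rightarrow> complex poly" where
  "charpoly n A = char_poly (to_mat n A)"

definition charpoly1 :: "nat \<Rightarrow> (nat \<Rightarrow> nat \<Rightarrow> complex) \<Rightarrow> complex poly" where
  "charpoly1 n A = char_poly (mat_delete (to_mat n A) 0 0)"

lemma to_mat_carrier [simp]: "to_mat n A \<in> carrier_mat n n"
  by (simp add: to_mat_def)

lemma mat_delete_to_mat_carrier [simp]: "mat_delete (to_mat n A) 0 0 \<in> carrier_mat (n - 1) (n - 1)"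
  by (simp add: to_mat_def mat_delete_def)

lemma charpoly_degree: "degree (charpoly n A) = n" "coeff (charpoly n A) n = 1"
  using degree_monic_char_poly[OF to_mat_carrier[of n A]] by (simp_all add: charpoly_def)

lemma charpoly1_degree: "degree (charpoly1 n A) = n - 1" "coeff (charpoly1 n A) (n - 1) = 1"
  using degree_monic_char_poly[OF mat_delete_to_mat_carrier[of n A]] by (simp_all add: charpoly1_def)

lemma charpoly_nonzero: "charpoly n A \<noteq> 0"
  using charpoly_degree(2)[of n A] by auto

lemma charpoly1_nonzero: "charpoly1 n A \<noteq> 0"
  using charpoly1_degree(2)[of n A] by auto

lemma char_poly_matrix_to_mat:
  assumes "i \<in> {1..n}" "j \<in> {1..n}"
  shows "char_poly_matrix (to_mat n A) $$ (i - 1, j - 1) = resolvent_entry A i j"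
  using assms by (auto simp: char_poly_matrix_def to_mat_def resolvent_entry_def)

lemma sum_shift1: "(\<Sum>k=1..n. f k) = (\<Sum>k=0..<n. f (Suc k))"
  by (simp add: sum.atLeast1_atMost_eq atLeast0LessThan)

lemma mult_mat_index:
  assumes "A \<in> carrier_mat n n" "B \<in> carrier_mat n n" "i < n" "j < n"
  shows "(A * B) $$ (i, j) = (\<Sum>k=0..<n. A $$ (i, k) * B $$ (k, j))"
  using assms by (auto simp: scalar_prod_def)

lemma adj_entry_right:
  assumes "i \<in> {1..n}" "j \<in> {1..n}"
  shows "(\<Sum>k=1..n. resolvent_entry A i k * adj_entry n A k j) = (if i = j then charpoly n A else 0)"
proof -
  let ?X = "char_poly_matrix (to_mat n A)"
  have X: "?X \<in> carrier_mat n n" by simp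
  have "(?X * adj_mat ?X) $$ (i - 1, j - 1) =
      (\<Sum>k=0..<n. ?X $$ (i - 1, k) * adj_mat ?X $$ (k, j - 1))"
    using assms by (intro mult_mat_index[OF X adj_mat(1)[OF X]]) auto
  also have "\<dots> = (\<Sum>k=1..n. resolvent_entry A i k * adj_entry n A k j)"
    unfolding sum_shift1
  proof (rule sum.cong[OF refl])
    fix k assume "k \<in> {0..<n}"
    then show "?X $$ (i - 1, k) * adj_mat ?X $$ (k, j - 1) =
        resolvent_entry A i (Suc k) * adj_entry n A (Suc k) j"
      using char_poly_matrix_to_mat[OF assms(1), of "Suc k" A] by (simp add: adj_entry_def)
  qed
  also have "(?X * adj_mat ?X) $$ (i - 1, j - 1) = (if i = j then charpoly n A else 0)"
    unfolding adj_mat(2)[OF X] using assms by (auto simp: charpoly_def char_poly_def)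
  finally show ?thesis by simp
qed

lemma adj_entry_left:
  assumes "i \<in> {1..n}" "j \<in> {1..n}"
  shows "(\<Sum>k=1..n. adj_entry n A i k * resolvent_entry A k j) = (if i = j then charpoly n A else 0)"
proof -
  let ?X = "char_poly_matrix (to_mat n A)"
  have X: "?X \<in> carrier_mat n n" by simp
  have "(adj_mat ?X * ?X) $$ (i - 1, j - 1) =
      (\<Sum>k=0..<n. adj_mat ?X $$ (i - 1, k) * ?X $$ (k, j - 1))"
    using assms by (intro mult_mat_index[OF adj_mat(1)[OF X] X]) auto
  also have "\<dots> = (\<Sum>k=1..n. adj_entry n A i k * resolvent_entry A k j)"
    unfolding sum_shift1
  proof (rule sum.cong[OF refl])
    fix k assume "k \<in> {0..<n}"
    then show "adj_mat ?X $$ (i - 1, k) * ?X $$ (k, j - 1) =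
        adj_entry n A i (Suc k) * resolvent_entry A (Suc k) j"
      using char_poly_matrix_to_mat[OF _ assms(2), of "Suc k" A] by (simp add: adj_entry_def)
  qed
  also have "(adj_mat ?X * ?X) $$ (i - 1, j - 1) = (if i = j then charpoly n A else 0)"
    unfolding adj_mat(3)[OF X] using assms by (auto simp: charpoly_def char_poly_def)
  finally show ?thesis by simp
qed

text \<open>Deleting the first row and column commutes with passing to lambda - A. This is how the
  second characteristic polynomial in the map enters the resolvent.\<close>

lemma adj_entry_11:
  assumes "1 \<le> n"
  shows "adj_entry n A 1 1 = charpoly1 n A"
proof -
  have "char_poly_matrix (mat_delete (to_mat n A) 0 0) =
      mat_delete (char_poly_matrix (to_mat n A)) 0 0"
    by (rule eq_matI) (auto simp: char_poly_matrix_def to_mat_def mat_delete_def)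
  then show ?thesis
    using assms
    by (simp add: adj_entry_def adj_mat_def cofactor_def charpoly1_def char_poly_def to_mat_def
        char_poly_matrix_def)
qed

lemma polyfun_poly_resolvent: "(\<lambda>A. resolvent_entry A i j) \<in> polyfun_poly entries"
  unfolding resolvent_entry_def
  by (intro polyfun_poly_diff polyfun_poly_const polyfun_poly_monom0 polyfun.gen)
    (auto simp: entries_def)

lemma polyfun_poly_char_poly_matrix:
  assumes "i < n" "j < n"
  shows "(\<lambda>A. char_poly_matrix (to_mat n A) $$ (i, j)) \<in> polyfun_poly entries"
  using polyfun_poly_resolvent[of "Suc i" "Suc j"] assms
    char_poly_matrix_to_mat[of "Suc i" n "Suc j"] by simp

lemma polyfun_poly_charpoly: "(\<lambda>A. charpoly n A) \<in> polyfun_poly entries"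
  unfolding charpoly_def char_poly_def
  by (rule polyfun_poly_det[of _ n]) (auto intro: polyfun_poly_char_poly_matrix)

lemma polyfun_poly_adj_entry:
  assumes "i \<in> {1..n}" "j \<in> {1..n}"
  shows "(\<lambda>A. adj_entry n A i j) \<in> polyfun_poly entries"
proof -
  let ?M = "\<lambda>A. mat_delete (char_poly_matrix (to_mat n A)) (j - 1) (i - 1)"
  have "(\<lambda>A. (-1) ^ (j - 1 + (i - 1)) * det (?M A)) \<in> polyfun_poly entries"
  proof (intro polyfun_poly_mult polyfun_poly_const polyfun_poly_det[of _ "n - 1"])
    show "?M A \<in> carrier_mat (n - 1) (n - 1)" for A
      by (rule mat_delete_carrier) simp
    fix k l assume "k < n - 1" "l < n - 1"
    then have kl: "(if k < j - 1 then k else Suc k) < n" "(if l < i - 1 then l else Suc l) < n"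
      and "?M A $$ (k, l) = char_poly_matrix (to_mat n A) $$
        (if k < j - 1 then k else Suc k, if l < i - 1 then l else Suc l)" for A
      by (auto simp: mat_delete_def char_poly_matrix_def to_mat_def)
    then show "(\<lambda>A. ?M A $$ (k, l)) \<in> polyfun_poly entries"
      using polyfun_poly_char_poly_matrix[OF kl] by (simp only:)
  qed
  moreover have "(\<lambda>A. adj_entry n A i j) = (\<lambda>A. (-1) ^ (j - 1 + (i - 1)) * det (?M A))"
    using assms by (intro ext)
      (simp add: adj_entry_def adj_mat_def cofactor_def char_poly_matrix_def to_mat_def less_diff_conv2)
  ultimately show ?thesis by simp
qed

text \<open>The resolvent identity \<open>X\<inverse> - Y\<inverse> = X\<inverse> (Y - X) Y\<inverse>\<close> with denominators cleared.\<close>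

lemma two_point_identity:
  assumes "1 \<le> n"
  shows "(\<Sum>i=1..n. \<Sum>j=1..n. Polynomial.smult (A i j - B i j) (adj_entry n A 1 i * adj_entry n B j 1)) =
    charpoly1 n A * charpoly n B - charpoly n A * charpoly1 n B"
proof -
  have 1: "(1::nat) \<in> {1..n}" using assms by simp
  have "(\<Sum>i=1..n. \<Sum>j=1..n. Polynomial.smult (A i j - B i j) (adj_entry n A 1 i * adj_entry n B j 1)) =
    (\<Sum>i=1..n. \<Sum>j=1..n. adj_entry n A 1 i * (resolvent_entry B i j * adj_entry n B j 1)) -
    (\<Sum>i=1..n. \<Sum>j=1..n. (adj_entry n A 1 i * resolvent_entry A i j) * adj_entry n B j 1)"
    unfolding sum_subtractf[symmetric]
  proof (intro sum.cong refl)
    fix i j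
    have "[:A i j - B i j:] = resolvent_entry B i j - resolvent_entry A i j"
      by (simp add: resolvent_entry_def)
    moreover have "Polynomial.smult (A i j - B i j) (adj_entry n A 1 i * adj_entry n B j 1) =
        [:A i j - B i j:] * (adj_entry n A 1 i * adj_entry n B j 1)"
      by simp
    ultimately show "Polynomial.smult (A i j - B i j) (adj_entry n A 1 i * adj_entry n B j 1) =
        adj_entry n A 1 i * (resolvent_entry B i j * adj_entry n B j 1) -
        (adj_entry n A 1 i * resolvent_entry A i j) * adj_entry n B j 1"
      by (simp only:) (simp add: algebra_simps)
  qed
  also have "(\<Sum>i=1..n. \<Sum>j=1..n. adj_entry n A 1 i * (resolvent_entry B i j * adj_entry n B j 1)) =
      (\<Sum>i=1..n. adj_entry n A 1 i * (if i = 1 then charpoly n B else 0))"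
    using adj_entry_right[OF _ 1, of _ B] by (intro sum.cong refl) (simp flip: sum_distrib_left)
  also have "\<dots> = charpoly1 n A * charpoly n B"
    using assms adj_entry_11[OF assms] by (simp add: if_distrib[of "\<lambda>x. _ * x"] cong: if_cong)
  also have "(\<Sum>i=1..n. \<Sum>j=1..n. (adj_entry n A 1 i * resolvent_entry A i j) * adj_entry n B j 1) =
      (\<Sum>j=1..n. (if 1 = j then charpoly n A else 0) * adj_entry n B j 1)"
    using adj_entry_left[OF 1, of _ A]
    by (subst sum.swap) (intro sum.cong refl, simp flip: sum_distrib_right)
  also have "\<dots> = charpoly n A * charpoly1 n B"
    using assms adj_entry_11[OF assms] by (simp add: if_distrib[of "\<lambda>x. x * _"] cong: if_cong)
  finally show ?thesis .
qed

text \<open>Multiplying the equation p X = c e_1 by the adjugate from the right solves it. Rows of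
  the adjugate can thus be identified from the linear system they satisfy, without expanding
  determinants.\<close>

lemma adj_entry_row_unique:
  assumes "1 \<le> n" "i \<in> {1..n}"
    and "\<And>j. j \<in> {1..n} \<Longrightarrow> (\<Sum>k=1..n. p k * resolvent_entry A k j) = (if j = 1 then c else 0)"
  shows "charpoly n A * p i = c * adj_entry n A 1 i"
proof -
  have "(\<Sum>j=1..n. (\<Sum>k=1..n. p k * resolvent_entry A k j) * adj_entry n A j i) =
      (\<Sum>k=1..n. p k * (\<Sum>j=1..n. resolvent_entry A k j * adj_entry n A j i))"
    unfolding sum_distrib_right sum_distrib_left by (subst sum.swap) (simp add: mult.assoc)
  also have "\<dots> = (\<Sum>k=1..n. p k * (if k = i then charpoly n A else 0))"
    using assms(2) by (intro sum.cong refl) (simp add: adj_entry_right del: One_nat_def)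
  also have "\<dots> = charpoly n A * p i"
    using assms(2) by (simp add: if_distrib[of "\<lambda>x. _ * x"] cong: if_cong)
  also have "(\<Sum>j=1..n. (\<Sum>k=1..n. p k * resolvent_entry A k j) * adj_entry n A j i) =
      (\<Sum>j=1..n. (if j = 1 then c else 0) * adj_entry n A j i)"
    by (intro sum.cong refl) (simp add: assms(3) del: One_nat_def)
  also have "\<dots> = c * adj_entry n A 1 i"
    using assms(1) by (simp add: if_distrib[of "\<lambda>x. x * _"] cong: if_cong)
  finally show ?thesis by simp
qed

lemma adj_entry_column_unique:
  assumes "1 \<le> n" "j \<in> {1..n}"
    and "\<And>i. i \<in> {1..n} \<Longrightarrow> (\<Sum>k=1..n. resolvent_entry A i k * q k) = (if i = 1 then c else 0)"
  shows "charpoly n A * q j = c * adj_entry n A j 1"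
proof -
  have "(\<Sum>i=1..n. adj_entry n A j i * (\<Sum>k=1..n. resolvent_entry A i k * q k)) =
      (\<Sum>k=1..n. (\<Sum>i=1..n. adj_entry n A j i * resolvent_entry A i k) * q k)"
    unfolding sum_distrib_right sum_distrib_left by (subst sum.swap) (simp add: mult.assoc)
  also have "\<dots> = (\<Sum>k=1..n. (if j = k then charpoly n A else 0) * q k)"
    using assms(2) by (intro sum.cong refl) (simp add: adj_entry_left del: One_nat_def)
  also have "\<dots> = charpoly n A * q j"
    using assms(2) by (simp add: if_distrib[of "\<lambda>x. x * _"] cong: if_cong)
  also have "(\<Sum>i=1..n. adj_entry n A j i * (\<Sum>k=1..n. resolvent_entry A i k * q k)) =
      (\<Sum>i=1..n. adj_entry n A j i * (if i = 1 then c else 0))"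
    by (intro sum.cong refl) (simp add: assms(3) del: One_nat_def)
  also have "\<dots> = c * adj_entry n A j 1"
    using assms(1) by (simp add: if_distrib[of "\<lambda>x. _ * x"] cong: if_cong)
  finally show ?thesis by simp
qed

section \<open>Arborescences\<close>

text \<open>Trees rooted at 1 that grow leaf by leaf, which is how the arcs of an ear without its
  last one extend a spanning tree.\<close>

inductive arborescence :: "nat set \<Rightarrow> (nat \<times> nat) set \<Rightarrow> bool" where
  root: "arborescence {1} {}"
| step: "arborescence V T \<Longrightarrow> u \<in> V \<Longrightarrow> w \<notin> V \<Longrightarrow> arborescence (insert w V) (insert (u, w) T)"

lemma arborescence_subset: "arborescence V T \<Longrightarrow> T \<subseteq> V \<times> V"
  by (induction rule: arborescence.induct) auto

lemma arborescence_card: "arborescence V T \<Longrightarrow> finite V \<and> finite T \<and> card V = Suc (card T)"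
proof (induction rule: arborescence.induct)
  case (step V T u w)
  then have "(u, w) \<notin> T" using arborescence_subset by blast
  with step show ?case by simp
qed simp

lemma arborescence_path:
  assumes "arborescence V T" "u \<in> V" "distinct ws" "set ws \<inter> V = {}"
  shows "arborescence (V \<union> set ws) (T \<union> set (vwalk_arcs (u # ws)))"
  using assms
proof (induction ws arbitrary: V T u)
  case (Cons w ws)
  have "arborescence (insert w V) (insert (u, w) T)"
    using Cons.prems by (intro arborescence.step) auto
  from Cons.IH[OF this, of w] Cons.prems show ?case by simp
qed simp

text \<open>\<open>\<rho> i\<close> is the product of the arc values along the tree path from \<open>1\<close> to \<open>i\<close>.\<close>

lemma arborescence_path_products:
  assumes "arborescence V T"
  obtains \<rho> :: "nat \<Rightarrow> (nat \<Rightarrow> nat \<Rightarrow> complex) \<Rightarrow> complex"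
  where "\<And>i. \<rho> i \<in> polyfun entries" "\<And>A. \<rho> 1 A = 1"
    "\<And>i j A. (j, i) \<in> T \<Longrightarrow> \<rho> i A = A i j * \<rho> j A"
    "\<And>i A. (\<And>j l. (j, l) \<in> T \<Longrightarrow> A l j = 1) \<Longrightarrow> i \<in> V \<Longrightarrow> \<rho> i A = 1"
proof -
  have "\<exists>\<rho> :: nat \<Rightarrow> (nat \<Rightarrow> nat \<Rightarrow> complex) \<Rightarrow> complex. (\<forall>i. \<rho> i \<in> polyfun entries) \<and> (\<forall>A. \<rho> 1 A = 1) \<and>
    (\<forall>i j A. (j, i) \<in> T \<longrightarrow> \<rho> i A = A i j * \<rho> j A) \<and>
    (\<forall>i\<in>V. \<forall>A. (\<forall>j l. (j, l) \<in> T \<longrightarrow> A l j = 1) \<longrightarrow> \<rho> i A = 1)"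
    using assms
  proof induction
    case root
    show ?case by (intro exI[of _ "\<lambda>_ _. 1"]) (auto intro: polyfun.const)
  next
    case (step V T u w)
    have T: "T \<subseteq> V \<times> V" and 1: "1 \<in> V"
      using step(1) arborescence_subset by (blast, induction rule: arborescence.induct, auto)
    obtain \<rho> :: "nat \<Rightarrow> (nat \<Rightarrow> nat \<Rightarrow> complex) \<Rightarrow> complex" where
      \<rho>: "\<And>i. \<rho> i \<in> polyfun entries" "\<And>A. \<rho> 1 A = 1"
      "\<And>i j A. (j, i) \<in> T \<Longrightarrow> \<rho> i A = A i j * \<rho> j A"
      "\<And>i A. i \<in> V \<Longrightarrow> \<forall>j l. (j, l) \<in> T \<longrightarrow> A l j = 1 \<Longrightarrow> \<rho> i A = 1"
      using step.IH by blast
    define \<rho>' where "\<rho>' = \<rho>(w := \<lambda>A. A w u * \<rho> u A)"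
    have old: "\<rho>' i = \<rho> i" if "i \<in> V" for i
      using that step(3) by (auto simp: \<rho>'_def)
    have new: "\<rho>' w A = A w u * \<rho> u A" for A
      by (simp add: \<rho>'_def)
    have "(\<lambda>A. A w u * \<rho> u A) \<in> polyfun entries"
      by (intro polyfun.mult polyfun.gen \<rho>(1)) (auto simp: entries_def)
    then have "\<forall>i. \<rho>' i \<in> polyfun entries"
      using \<rho>(1) by (simp add: \<rho>'_def)
    moreover have "\<forall>A. \<rho>' 1 A = 1" using old[OF 1] \<rho>(2) by simp
    moreover have "\<forall>i j A. (j, i) \<in> insert (u, w) T \<longrightarrow> \<rho>' i A = A i j * \<rho>' j A"
    proof (intro allI impI)
      fix i j A assume "(j, i) \<in> insert (u, w) T"
      then consider "j = u" "i = w" | "(j, i) \<in> T" "i \<in> V" "j \<in> V" using T by auto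
      then show "\<rho>' i A = A i j * \<rho>' j A"
      proof cases
        case 1
        then show ?thesis using new[of A] old[OF step(2)] by (simp only:)
      next
        case 2
        then show ?thesis using \<rho>(3)[OF 2(1), of A] old[OF 2(2)] old[OF 2(3)] by (simp only:)
      qed
    qed
    moreover have "\<forall>i\<in>insert w V. \<forall>A. (\<forall>j l. (j, l) \<in> insert (u, w) T \<longrightarrow> A l j = 1) \<longrightarrow> \<rho>' i A = 1"
    proof (intro ballI allI impI)
      fix i and A :: "nat \<Rightarrow> nat \<Rightarrow> complex"
      assume i: "i \<in> insert w V"
        and A: "\<forall>j l. (j, l) \<in> insert (u, w) T \<longrightarrow> A l j = 1"
      then have "\<rho> k A = 1" if "k \<in> V" for k
        by (intro \<rho>(4) that) blast
      moreover have "A w u = 1" using A by blast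
      ultimately show "\<rho>' i A = 1"
        using i old[of i] new[of A] step(2) by (cases "i = w") auto
    qed
    ultimately show ?case by blast
  qed
  then obtain \<rho> :: "nat \<Rightarrow> (nat \<Rightarrow> nat \<Rightarrow> complex) \<Rightarrow> complex" where
    "\<forall>i. \<rho> i \<in> polyfun entries" "\<forall>A. \<rho> 1 A = 1"
    "\<forall>i j A. (j, i) \<in> T \<longrightarrow> \<rho> i A = A i j * \<rho> j A"
    "\<forall>i\<in>V. \<forall>A. (\<forall>j l. (j, l) \<in> T \<longrightarrow> A l j = 1) \<longrightarrow> \<rho> i A = 1"
    by (elim exE conjE)
  then show ?thesis by (intro that[of \<rho>]) simp_all
qed

section \<open>Attaching an ear\<close>

text \<open>Arcs list the source first, whereas matrix entries have the target as row; hence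
  \<open>snd b\<close> goes with the row \<open>p\<close> and \<open>fst b\<close> with the column
  \<open>q\<close>.\<close>

definition arc_product :: "nat \<Rightarrow> (nat \<Rightarrow> nat \<Rightarrow> complex) \<Rightarrow> nat \<times> nat \<Rightarrow> complex poly" where
  "arc_product n A b = adj_entry n A 1 (snd b) * adj_entry n A (fst b) 1"

text \<open>The diagonal entry \<open>a\<^sub>i\<^sub>i\<close> is addressed by the pair \<open>(i, i)\<close>.\<close>

definition free_arcs :: "nat set \<Rightarrow> (nat \<times> nat) set \<Rightarrow> (nat \<times> nat) set \<Rightarrow> (nat \<times> nat) set" where
  "free_arcs V E T = (Id_on V \<union> E) - T"

text \<open>The invariant of the induction on ears. The size \<open>n\<close> is that of the final
  graph from the start: vertices not yet reached have zero rows and columns, so that no stage needs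
  a renumbering of the vertices.\<close>

definition independent_at ::
  "nat \<Rightarrow> nat set \<Rightarrow> (nat \<times> nat) set \<Rightarrow> (nat \<times> nat) set \<Rightarrow> (nat \<Rightarrow> nat \<Rightarrow> complex) \<Rightarrow> bool"
where
  "independent_at n V E T A \<longleftrightarrow>
     1 \<in> V \<and> V \<subseteq> {1..n} \<and> E \<subseteq> V \<times> V \<and> (\<forall>v. (v, v) \<notin> E) \<and> arborescence V T \<and> T \<subseteq> E \<and>
     (\<forall>i j. A i j \<noteq> 0 \<longrightarrow> (i = j \<and> i \<in> V) \<or> (j, i) \<in> E) \<and> (\<forall>i j. (j, i) \<in> T \<longrightarrow> A i j = 1) \<and>
     indep_family (free_arcs V E T) (\<lambda>b. coeff (arc_product n A b))"

lemma free_arcs_disjoint_union: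
  assumes "independent_at n V E T A"
  shows "free_arcs V E T = Id_on V \<union> (E - T)" "Id_on V \<inter> (E - T) = {}"
  using assms by (auto simp: independent_at_def free_arcs_def)

text \<open>There are \<open>card V\<close> diagonal positions, and the tree removes
  \<open>card V - 1\<close> of the arcs.\<close>

lemma card_free_arcs:
  assumes "independent_at n V E T A"
  shows "finite (free_arcs V E T)" "card (free_arcs V E T) = card E + 1"
proof -
  have T: "arborescence V T" "T \<subseteq> E" and E: "E \<subseteq> V \<times> V"
    using assms by (auto simp: independent_at_def)
  have V: "finite V" "finite T" "card V = Suc (card T)"
    using arborescence_card[OF T(1)] by auto
  have finE: "finite E" using E V(1) by (meson finite_SigmaI finite_subset)
  have Id: "Id_on V = (\<lambda>v. (v, v)) ` V" by auto
  have "card (Id_on V) = card V"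
    unfolding Id by (rule card_image) (auto intro: inj_onI)
  moreover have "card (E - T) = card E - card T"
    using T(2) V(2) by (rule card_Diff_subset[rotated])
  moreover have "card T \<le> card E" using T(2) finE by (rule card_mono[rotated])
  moreover have "finite (Id_on V)" unfolding Id using V(1) by simp
  ultimately show "finite (free_arcs V E T)" "card (free_arcs V E T) = card E + 1"
    unfolding free_arcs_disjoint_union(1)[OF assms] using finE V(3)
      card_Un_disjoint[OF _ _ free_arcs_disjoint_union(2)[OF assms]] by auto
qed

text \<open>For the zero matrix the only product is the square of the nonzero polynomial
  \<open>charpoly1\<close>. This is the graph to which the initial cycle is attached.\<close>

lemma independent_at_root:
  assumes "1 \<le> n"
  shows "independent_at n {1} {} {} (\<lambda>_ _. 0)"
proof -
  have "arc_product n (\<lambda>_ _. 0) (1, 1) \<noteq> 0"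
    unfolding arc_product_def using charpoly1_nonzero by (simp add: adj_entry_11[OF assms, simplified])
  then have "indep_family {(1, 1)} (\<lambda>b. coeff (arc_product n (\<lambda>_ _. 0) b))"
    unfolding indep_family_poly by simp
  moreover have "free_arcs {1} {} {} = {(1, 1)}" by (auto simp: free_arcs_def)
  ultimately show ?thesis
    using assms arborescence.root by (simp add: independent_at_def)
qed

lemma set_vwalk_arcs: "set (vwalk_arcs p) = {(p ! r, p ! Suc r) | r. Suc r < length p}"
proof (induction p)
  case (Cons u p)
  show ?case
  proof (cases p)
    case (Cons w p')
    have "{((u # p) ! r, (u # p) ! Suc r) | r. Suc r < length (u # p)} =
        insert (u, w) {(p ! r, p ! Suc r) | r. Suc r < length p}" (is "?L = ?R")
    proof
      show "?L \<subseteq> ?R"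
      proof
        fix x assume "x \<in> ?L"
        then obtain r where r: "x = ((u # p) ! r, (u # p) ! Suc r)" "Suc r < length (u # p)" by blast
        show "x \<in> ?R"
        proof (cases r)
          case 0
          then show ?thesis using r Cons by simp
        next
          case (Suc s)
          then have "x = (p ! s, p ! Suc s)" "Suc s < length p" using r by simp_all
          then show ?thesis by blast
        qed
      qed
      show "?R \<subseteq> ?L"
      proof
        fix x assume "x \<in> ?R"
        then consider "x = (u, w)" | r where "x = (p ! r, p ! Suc r)" "Suc r < length p" by blast
        then show "x \<in> ?L"
        proof cases
          case 1
          then show ?thesis using Cons by (intro CollectI exI[of _ 0]) auto
        next
          case (2 r)
          then show ?thesis by (intro CollectI exI[of _ "Suc r"]) auto
        qed
      qed
    qed
    then show ?thesis using Cons.IH Cons by simp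
  qed simp
qed simp

lemma poly_prod_linear: "poly (\<Prod>x\<in>S. [:- d x, 1:]) t = (\<Prod>x\<in>S. t - d x :: complex)"
  by (simp add: poly_prod)

lemma prod_linear_nonzero: "(\<Prod>x\<in>S. [:- d x, 1 :: complex:]) \<noteq> 0"
proof (cases "finite S")
  case True
  then show ?thesis by (simp add: prod_zero_iff)
qed simp

section \<open>Extension of an independent matrix by a single ear from \<open>u\<close> through
  \<open>ws\<close> to \<open>v\<close>\<close>

context
  fixes n :: nat and V :: "nat set" and E T :: "(nat \<times> nat) set" and A :: "nat \<Rightarrow> nat \<Rightarrow> complex"
    and u v :: nat and ws :: "nat list" and d :: "nat \<Rightarrow> complex"
  assumes old: "independent_at n V E T A"
    and ends: "u \<in> V" "v \<in> V"
    and ws: "ws \<noteq> []" "distinct ws" "set ws \<inter> V = {}" "set ws \<subseteq> {1..n}"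
    and d_inj: "inj d"
    and d_root: "\<And>w. poly (arc_product n A (u, v)) (d w) \<noteq> 0"
begin

abbreviation "stem \<equiv> set (vwalk_arcs (u # ws))"

definition "ear_poly = (\<Prod>x\<in>set ws. [:- d x, 1:])"

text \<open>Up to scalars the Lagrange polynomials for the nodes \<open>d w\<close>. Together with
  \<open>ear_poly\<close> they form a basis of the polynomials of degree at most
  \<open>length ws\<close>.\<close>

definition "ear_poly_but w = (\<Prod>x\<in>set ws - {w}. [:- d x, 1:])"

text \<open>The arcs in \<open>stem\<close> join the arborescence and therefore need weight 1; only
  the arc that closes the ear stays free and carries \<epsilon>. Between old vertices nothing
  changes.\<close>

definition attach :: "complex \<Rightarrow> nat \<Rightarrow> nat \<Rightarrow> complex" where
  "attach \<epsilon> i j = (if i = j \<and> i \<in> set ws then d i else if (j, i) \<in> stem then 1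
     else if j = last ws \<and> i = v then \<epsilon> else A i j)"

lemma V_facts: "1 \<in> V" "V \<subseteq> {1..n}" "E \<subseteq> V \<times> V" "(x, x) \<notin> E" "arborescence V T" "T \<subseteq> E"
  and A_support: "A i j \<noteq> 0 \<Longrightarrow> (i = j \<and> i \<in> V) \<or> (j, i) \<in> E"
  and A_tree: "(j, i) \<in> T \<Longrightarrow> A i j = 1"
  and A_indep: "indep_family (free_arcs V E T) (\<lambda>b. coeff (arc_product n A b))"
  using old unfolding independent_at_def by blast+

lemma A_outside: "i \<notin> V \<or> j \<notin> V \<Longrightarrow> A i j = 0"
  using A_support V_facts(3) by blast

lemma n_ge_1: "1 \<le> n"
  using V_facts(1,2) by auto

lemma stem_nth: "stem = {((u # ws) ! r, ws ! r) | r. r < length ws}"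
  unfolding set_vwalk_arcs by auto

lemma stem_into: "(j, i) \<in> stem \<Longrightarrow> i \<in> set ws"
  unfolding stem_nth by auto

lemma last_in: "last ws \<in> set ws"
  using ws(1) by simp

lemma ws_not_V: "w \<in> set ws \<Longrightarrow> w \<notin> V"
  using ws(3) by blast

lemma stem_nth_iff:
  assumes "r < length ws"
  shows "(j, ws ! r) \<in> stem \<longleftrightarrow> j = (u # ws) ! r"
  unfolding stem_nth using assms ws(2) by (auto simp: nth_eq_iff_index_eq)

lemma stem_source_iff:
  assumes "r < length ws"
  shows "(ws ! r, i) \<in> stem \<longleftrightarrow> Suc r < length ws \<and> i = ws ! Suc r"
proof
  assume "(ws ! r, i) \<in> stem"
  then obtain s where s: "s < length ws" "ws ! r = (u # ws) ! s" "i = ws ! s"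
    unfolding stem_nth by blast
  show "Suc r < length ws \<and> i = ws ! Suc r"
  proof (cases s)
    case 0
    then have "ws ! r = u" using s(2) by simp
    then show ?thesis using ends(1) ws_not_V[OF nth_mem[OF assms]] by simp
  next
    case (Suc t)
    then have "ws ! r = ws ! t" using s(2) by simp
    then have "r = t" using assms s(1) Suc ws(2) by (simp add: nth_eq_iff_index_eq)
    then show ?thesis using s Suc by simp
  qed
next
  assume "Suc r < length ws \<and> i = ws ! Suc r"
  then show "(ws ! r, i) \<in> stem" unfolding stem_nth by (intro CollectI exI[of _ "Suc r"]) simp
qed

lemma ws_index:
  assumes "w \<in> set ws"
  obtains r where "r < length ws" "w = ws ! r"
  using assms by (auto simp: in_set_conv_nth)

lemma stem_irrefl: "(x, x) \<notin> stem"
proof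
  assume x: "(x, x) \<in> stem"
  then obtain r where r: "r < length ws" "x = ws ! r" by (rule ws_index[OF stem_into])
  then have "x = ws ! Suc r" "Suc r < length ws" using x stem_source_iff by auto
  then show False using r ws(2) by (simp add: nth_eq_iff_index_eq)
qed

lemma last_v_not_stem: "(last ws, v) \<notin> stem"
  using stem_into ws_not_V ends(2) by blast

abbreviation "prow \<epsilon> i \<equiv> adj_entry n (attach \<epsilon>) 1 i"
abbreviation "qcol \<epsilon> j \<equiv> adj_entry n (attach \<epsilon>) j 1"

lemma attach_old:
  assumes "i \<in> V" "j \<in> V"
  shows "attach \<epsilon> i j = A i j"
  using assms ws_not_V stem_into last_in unfolding attach_def by metis

text \<open>A new vertex has a single incoming arc, so its row of lambda - A has just two nonzero
  entries and its equation in X q = det(X) e_1 is a two-term recurrence along the ear.\<close>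

lemma q_step:
  assumes "r < length ws"
  shows "[:- d (ws ! r), 1:] * qcol \<epsilon> (ws ! r) = qcol \<epsilon> ((u # ws) ! r)"
proof -
  let ?w = "ws ! r" and ?y = "(u # ws) ! r"
  have w: "?w \<in> set ws" "?w \<in> {1..n}" "?w \<noteq> 1"
    using ws(4) ws_not_V[OF nth_mem[OF assms]] V_facts(1) nth_mem[OF assms] by (blast, blast, metis)
  have "?y \<in> insert u (set ws)" using assms by (cases r) auto
  then have w0: "?y \<in> {1..n}" using ends(1) V_facts(2) ws(4) by auto
  have ne: "?y \<noteq> ?w" using stem_nth_iff[OF assms] stem_irrefl by metis
  have val: "resolvent_entry (attach \<epsilon>) ?w k =
      (if k = ?w then [:- d ?w, 1:] else if k = ?y then -1 else 0)" for k
    using w(1) stem_nth_iff[OF assms, of k] A_outside[of ?w k] ws_not_V[OF w(1)] ends(2) ne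
    by (auto simp: resolvent_entry_def attach_def one_pCons)
  have "0 = (\<Sum>k=1..n. resolvent_entry (attach \<epsilon>) ?w k * qcol \<epsilon> k)"
    using adj_entry_right[of ?w n 1 "attach \<epsilon>"] w n_ge_1 by simp
  also have "\<dots> = (\<Sum>k\<in>{?w, ?y}. resolvent_entry (attach \<epsilon>) ?w k * qcol \<epsilon> k)"
    using w w0 by (intro sum.mono_neutral_right) (auto simp: val)
  also have "\<dots> = [:- d ?w, 1:] * qcol \<epsilon> ?w - qcol \<epsilon> ?y"
    using ne by (simp add: val)
  finally show ?thesis by (simp add: algebra_simps)
qed

text \<open>A new vertex also has a single outgoing arc, so its column gives a two-term recurrence
  for the row \<open>p\<close>; at the last vertex the arc leads to \<open>v\<close> and contributes
  \<epsilon>.\<close>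

lemma p_step:
  assumes "r < length ws"
  shows "[:- d (ws ! r), 1:] * prow \<epsilon> (ws ! r) =
    (if Suc r < length ws then prow \<epsilon> (ws ! Suc r) else [:\<epsilon>:] * prow \<epsilon> v)"
proof -
  let ?w = "ws ! r" and ?y = "if Suc r < length ws then ws ! Suc r else v"
  let ?c = "if Suc r < length ws then 1 else \<epsilon>"
  have w: "?w \<in> set ws" "?w \<in> {1..n}" "?w \<noteq> 1"
    using ws(4) ws_not_V[OF nth_mem[OF assms]] V_facts(1) nth_mem[OF assms] by (blast, blast, metis)
  have w1: "?y \<in> {1..n}"
  proof (cases "Suc r < length ws")
    case True
    then show ?thesis using subsetD[OF ws(4) nth_mem[OF True]] by simp
  next
    case False
    then show ?thesis using subsetD[OF V_facts(2) ends(2)] by simp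
  qed
  have lst: "?w = last ws \<longleftrightarrow> \<not> Suc r < length ws"
    using assms ws(1,2) by (auto simp: last_conv_nth nth_eq_iff_index_eq)
  have ne: "?y \<noteq> ?w"
    using ws_not_V[OF w(1)] ends(2) ws(2) assms by (auto simp: nth_eq_iff_index_eq)
  have val: "resolvent_entry (attach \<epsilon>) k ?w =
      (if k = ?w then [:- d ?w, 1:] else if k = ?y then [:- ?c:] else 0)" for k
    using w(1) stem_source_iff[OF assms, of k] A_outside[of k ?w] ws_not_V[OF w(1)] ends(2) ne lst
      last_v_not_stem
    by (auto simp: resolvent_entry_def attach_def one_pCons)
  have "0 = (\<Sum>k=1..n. prow \<epsilon> k * resolvent_entry (attach \<epsilon>) k ?w)"
    using adj_entry_left[of 1 n ?w "attach \<epsilon>"] w n_ge_1 by simp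
  also have "\<dots> = (\<Sum>k\<in>{?w, ?y}. prow \<epsilon> k * resolvent_entry (attach \<epsilon>) k ?w)"
    using w w1 by (intro sum.mono_neutral_right) (auto simp: val)
  also have "\<dots> = [:- d ?w, 1:] * prow \<epsilon> ?w - [:?c:] * prow \<epsilon> ?y"
    using ne by (simp add: val)
  finally show ?thesis by (auto simp: algebra_simps)
qed

text \<open>Telescoping from \<open>u\<close> forwards: the linear factors of all vertices up to and
  including position \<open>r\<close> accumulate.\<close>

lemma q_chain:
  assumes "r < length ws"
  shows "(\<Prod>s\<le>r. [:- d (ws ! s), 1:]) * qcol \<epsilon> (ws ! r) = qcol \<epsilon> u"
  using assms
proof (induction r)
  case 0
  then show ?case using q_step[of 0] by simp
next
  case (Suc r)
  have "(\<Prod>s\<le>Suc r. [:- d (ws ! s), 1:]) * qcol \<epsilon> (ws ! Suc r) =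
      (\<Prod>s\<le>r. [:- d (ws ! s), 1:]) * ([:- d (ws ! Suc r), 1:] * qcol \<epsilon> (ws ! Suc r))"
    by (simp only: prod.atMost_Suc mult.assoc)
  also have "[:- d (ws ! Suc r), 1:] * qcol \<epsilon> (ws ! Suc r) = qcol \<epsilon> (ws ! r)"
    using q_step[OF Suc.prems] by simp
  finally show ?case using Suc by simp
qed

text \<open>Telescoping from \<open>v\<close> backwards: the linear factors from position
  \<open>r\<close> on accumulate, and \<epsilon> enters once.\<close>

lemma p_chain:
  assumes "r < length ws"
  shows "(\<Prod>s\<in>{r..<length ws}. [:- d (ws ! s), 1:]) * prow \<epsilon> (ws ! r) = [:\<epsilon>:] * prow \<epsilon> v"
  using assms
proof (induction "length ws - r" arbitrary: r)
  case (Suc k)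
  have "{r..<length ws} = insert r {Suc r..<length ws}" using Suc.prems by auto
  then have "(\<Prod>s\<in>{r..<length ws}. [:- d (ws ! s), 1:]) * prow \<epsilon> (ws ! r) =
      (\<Prod>s\<in>{Suc r..<length ws}. [:- d (ws ! s), 1:]) * ([:- d (ws ! r), 1:] * prow \<epsilon> (ws ! r))"
    by (simp only: prod.insert finite_atLeastLessThan) (simp add: mult_ac del: mult_pCons_left mult_pCons_right)
  also have "[:- d (ws ! r), 1:] * prow \<epsilon> (ws ! r) =
      (if Suc r < length ws then prow \<epsilon> (ws ! Suc r) else [:\<epsilon>:] * prow \<epsilon> v)"
    by (rule p_step[OF Suc.prems])
  finally show ?case
    using Suc.hyps(1)[of "Suc r"] Suc.hyps(2) by (cases "Suc r < length ws") auto
qed simp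

lemma ear_poly_nth: "ear_poly = (\<Prod>s\<in>{..<length ws}. [:- d (ws ! s), 1:])"
proof -
  have "inj_on ((!) ws) {..<length ws}" using ws(2) by (simp add: inj_on_nth)
  moreover have "(!) ws ` {..<length ws} = set ws"
    by (auto simp: set_conv_nth)
  ultimately show ?thesis
    unfolding ear_poly_def using prod.reindex[of "(!) ws" "{..<length ws}" "\<lambda>x. [:- d x, 1:]"] by simp
qed

lemma ear_poly_split: "w \<in> set ws \<Longrightarrow> ear_poly = [:- d w, 1:] * ear_poly_but w"
  unfolding ear_poly_def ear_poly_but_def by (rule prod.remove) simp_all

lemma q_last: "ear_poly * qcol \<epsilon> (last ws) = qcol \<epsilon> u"
proof -
  have "{..<length ws} = {..length ws - 1}" using ws(1) by (cases ws) auto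
  then show ?thesis
    using q_chain[of "length ws - 1"] ws(1) unfolding ear_poly_nth by (simp add: last_conv_nth)
qed

text \<open>The factors up to \<open>r\<close> from \<open>q\<close> and from \<open>r\<close> on
  from \<open>p\<close> cover the ear, the one of \<open>w\<close> twice. So p_w q_w is \<epsilon>
  p_v q_u divided by \<open>ear_poly\<close> and once more by lambda - d_w, and multiplication by
  the square of \<open>ear_poly\<close> leaves \<open>ear_poly_but w\<close>.\<close>

lemma new_diagonal_product:
  assumes "w \<in> set ws"
  shows "ear_poly * ear_poly * arc_product n (attach \<epsilon>) (w, w) = [:\<epsilon>:] * (ear_poly_but w * arc_product n (attach \<epsilon>) (u, v))"
proof -
  obtain r where r: "r < length ws" "w = ws ! r" by (rule ws_index[OF assms])
  let ?L = "\<lambda>s. [:- d (ws ! s), 1:]"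
  have "{..r} = insert r {..<r}" by auto
  then have "prod ?L {..r} * prod ?L {r..<length ws} = ?L r * (prod ?L {..<r} * prod ?L {r..<length ws})"
    by (simp only: prod.insert finite_lessThan lessThan_iff less_irrefl not_False_eq_True mult.assoc)
  also have "prod ?L {..<r} * prod ?L {r..<length ws} = ear_poly"
    unfolding ear_poly_nth using r(1)
    by (subst prod.union_disjoint[symmetric]) (auto simp: ivl_disj_un)
  finally have prods: "prod ?L {..r} * prod ?L {r..<length ws} = [:- d w, 1:] * ear_poly"
    by (simp only: r(2))
  have "ear_poly * ear_poly * arc_product n (attach \<epsilon>) (w, w) =
      ear_poly_but w * (([:- d w, 1:] * ear_poly) * (prow \<epsilon> w * qcol \<epsilon> w))"
    by (subst ear_poly_split[OF assms]) (simp only: arc_product_def fst_conv snd_conv mult_ac)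
  also have "([:- d w, 1:] * ear_poly) * (prow \<epsilon> w * qcol \<epsilon> w) =
      (prod ?L {r..<length ws} * prow \<epsilon> w) * (prod ?L {..r} * qcol \<epsilon> w)"
    unfolding prods[symmetric] by (simp only: mult_ac)
  also have "\<dots> = ([:\<epsilon>:] * prow \<epsilon> v) * qcol \<epsilon> u"
    unfolding r(2) p_chain[OF r(1)] q_chain[OF r(1)] ..
  finally show ?thesis by (simp only: arc_product_def fst_conv snd_conv mult_ac)
qed

text \<open>Only the \<open>q\<close> factor lies on the ear, and it costs \<open>ear_poly\<close>
  once. The remaining \<open>ear_poly\<close> is the element of top degree missing from the Lagrange
  polynomials.\<close>

lemma last_arc_product:
  "ear_poly * ear_poly * arc_product n (attach \<epsilon>) (last ws, v) = ear_poly * arc_product n (attach \<epsilon>) (u, v)"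
proof -
  have "ear_poly * ear_poly * arc_product n (attach \<epsilon>) (last ws, v) = ear_poly * prow \<epsilon> v * (ear_poly * qcol \<epsilon> (last ws))"
    by (simp only: arc_product_def fst_conv snd_conv mult_ac)
  then show ?thesis
    unfolding q_last by (simp only: arc_product_def fst_conv snd_conv mult_ac)
qed

section \<open>The limit in which the closing arc disappears\<close>

text \<open>Without the closing arc no path leads from the ear back to the old vertices, so
  \<open>p\<close> vanishes on the ear. Its restriction to \<open>V\<close> then satisfies the
  linear system of the old row and agrees with it up to the ratio of the determinants.\<close>

lemma p_old_at_0:
  assumes i: "i \<in> V"
  shows "charpoly n A * prow 0 i = charpoly n (attach 0) * adj_entry n A 1 i"
proof -
  have pw: "prow 0 w = 0" if w: "w \<in> set ws" for w
  proof -
    obtain r where r: "r < length ws" "w = ws ! r" by (rule ws_index[OF w])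
    have "(\<Prod>s\<in>{r..<length ws}. [:- d (ws ! s), 1:]) \<noteq> 0"
      by (rule prod_linear_nonzero)
    moreover have "(\<Prod>s\<in>{r..<length ws}. [:- d (ws ! s), 1:]) * prow 0 (ws ! r) = 0"
      using p_chain[OF r(1), of 0] by simp
    ultimately show ?thesis unfolding r(2) mult_eq_0_iff by blast
  qed
  define p0 where "p0 k = (if k \<in> V then prow 0 k else 0)" for k
  have "(\<Sum>k=1..n. p0 k * resolvent_entry A k j) = (if j = 1 then charpoly n (attach 0) else 0)"
    if j: "j \<in> {1..n}" for j
  proof (cases "j \<in> V")
    case True
    have "p0 k * resolvent_entry A k j = prow 0 k * resolvent_entry (attach 0) k j" for k
    proof (cases "k \<in> V")
      case True
      then show ?thesis using \<open>j \<in> V\<close> by (simp add: p0_def resolvent_entry_def attach_old)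
    next
      case False
      show ?thesis
      proof (cases "k \<in> set ws")
        case True
        then show ?thesis using False pw by (simp add: p0_def)
      next
        case nws: False
        have "attach 0 k j = 0"
          using False nws A_outside ends(2) stem_into by (auto simp: attach_def)
        then show ?thesis
          using False \<open>j \<in> V\<close> by (auto simp: p0_def resolvent_entry_def)
      qed
    qed
    then show ?thesis
      using adj_entry_left[of 1 n j "attach 0"] j n_ge_1 by auto
  next
    case False
    then have "p0 k * resolvent_entry A k j = 0" for k
      using A_outside[of k j] by (auto simp: p0_def resolvent_entry_def)
    then show ?thesis using False V_facts(1) by (auto intro!: sum.neutral simp del: mult_eq_0_iff)
  qed
  from adj_entry_row_unique[OF n_ge_1 _ this, of i] i V_facts(2) show ?thesis
    by (auto simp: p0_def)
qed

text \<open>Here \<open>q\<close> need not vanish on the ear, but the rows of old vertices have no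
  entry in the new columns, so restricting \<open>q\<close> to \<open>V\<close> keeps their
  equations.\<close>

lemma q_old_at_0:
  assumes j: "j \<in> V"
  shows "charpoly n A * qcol 0 j = charpoly n (attach 0) * adj_entry n A j 1"
proof -
  define q0 where "q0 k = (if k \<in> V then qcol 0 k else 0)" for k
  have "(\<Sum>k=1..n. resolvent_entry A i k * q0 k) = (if i = 1 then charpoly n (attach 0) else 0)"
    if i: "i \<in> {1..n}" for i
  proof (cases "i \<in> V")
    case True
    have "resolvent_entry A i k * q0 k = resolvent_entry (attach 0) i k * qcol 0 k" for k
    proof (cases "k \<in> V")
      case True
      then show ?thesis using \<open>i \<in> V\<close> by (simp add: q0_def resolvent_entry_def attach_old)
    next
      case False
      have "attach 0 i k = 0"
        using False \<open>i \<in> V\<close> A_outside ws_not_V stem_into by (auto simp: attach_def)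
      then show ?thesis
        using False \<open>i \<in> V\<close> by (auto simp: q0_def resolvent_entry_def)
    qed
    then show ?thesis
      using adj_entry_right[of i n 1 "attach 0"] i n_ge_1 by auto
  next
    case False
    then have "resolvent_entry A i k * q0 k = 0" for k
      using A_outside[of i k] by (auto simp: q0_def resolvent_entry_def)
    then show ?thesis using False V_facts(1) by (auto intro!: sum.neutral simp del: mult_eq_0_iff)
  qed
  from adj_entry_column_unique[OF n_ge_1 _ this, of j] j V_facts(2) show ?thesis
    by (auto simp: q0_def)
qed

lemma arc_product_old_at_0:
  assumes "i \<in> V" "j \<in> V"
  shows "(charpoly n A)\<^sup>2 * arc_product n (attach 0) (j, i) =
    (charpoly n (attach 0))\<^sup>2 * arc_product n A (j, i)"
proof -
  have "(charpoly n A)\<^sup>2 * arc_product n (attach 0) (j, i) =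
      (charpoly n A * prow 0 i) * (charpoly n A * qcol 0 j)"
    by (simp only: arc_product_def fst_conv snd_conv power2_eq_square mult_ac)
  then show ?thesis
    unfolding p_old_at_0[OF assms(1)] q_old_at_0[OF assms(2)]
    by (simp only: arc_product_def fst_conv snd_conv power2_eq_square mult_ac)
qed

section \<open>Independence on the enlarged graph\<close>

abbreviation "E' \<equiv> E \<union> set (vwalk_arcs (u # ws @ [v]))"

lemma E'_eq: "E' = insert (last ws, v) (E \<union> stem)"
proof -
  have "vwalk_arcs ((u # ws) @ [v]) = vwalk_arcs (u # ws) @ [(last ws, v)]"
    using ws(1) by (subst vwalk_arcs_append) auto
  then show ?thesis by auto
qed

text \<open>An ear with K inner vertices adds K diagonal entries and K + 1 arcs, K of which go to
  the tree. The K + 1 new free positions match the dimension of the polynomials of degree at most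
  K.\<close>

lemma free_arcs_attach:
  "free_arcs (V \<union> set ws) E' (T \<union> stem) = insert (last ws, v) (free_arcs V E T \<union> Id_on (set ws))"
proof -
  have 1: "(last ws, v) \<notin> T" "(last ws, v) \<notin> stem"
    using last_v_not_stem V_facts(3,6) ws_not_V last_in by blast+
  have 2: "stem \<inter> (Id_on V \<union> E) = {}" "stem \<inter> Id_on (set ws) = {}"
    using stem_into ws_not_V V_facts(3) stem_irrefl by blast+
  have 3: "T \<inter> Id_on (set ws) = {}" using V_facts(4,6) by blast
  show ?thesis
    unfolding free_arcs_def E'_eq using 1 2 3 by blast
qed

lemma finite_free: "finite (free_arcs V E T)"
  using card_free_arcs(1)[OF old] .

lemma free_subset: "free_arcs V E T \<subseteq> V \<times> V"
  unfolding free_arcs_def using V_facts(3) by blast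

lemma sum_free_arcs_attach:
  fixes f :: "nat \<times> nat \<Rightarrow> complex poly"
  shows "(\<Sum>b\<in>free_arcs (V \<union> set ws) E' (T \<union> stem). f b) =
    (\<Sum>b\<in>free_arcs V E T. f b) + (\<Sum>w\<in>set ws. f (w, w)) + f (last ws, v)"
proof -
  have 1: "(last ws, v) \<notin> free_arcs V E T \<union> Id_on (set ws)"
    using free_subset ws_not_V last_in ends(2) by blast
  have 2: "free_arcs V E T \<inter> Id_on (set ws) = {}"
    using free_subset ws_not_V by blast
  have Id: "Id_on (set ws) = (\<lambda>w. (w, w)) ` set ws" by auto
  have "sum f (Id_on (set ws)) = (\<Sum>w\<in>set ws. f (w, w))"
    unfolding Id by (subst sum.reindex) (auto intro: inj_onI)
  moreover have "finite (Id_on (set ws))" unfolding Id by simp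
  ultimately show ?thesis
    unfolding free_arcs_attach using 1 2 finite_free
    by (simp add: sum.union_disjoint add_ac)
qed

text \<open>
  The new diagonal products vanish at \<open>\<epsilon> = 0\<close>; dividing them by \<open>\<epsilon>\<close> keeps the family
  independent in the limit.
\<close>

definition scaled_product :: "complex \<Rightarrow> nat \<times> nat \<Rightarrow> complex poly" where
  "scaled_product \<epsilon> b =
     (if fst b = snd b \<and> fst b \<in> set ws then ear_poly_but (fst b) * arc_product n (attach \<epsilon>) (u, v)
      else if b = (last ws, v) then ear_poly * arc_product n (attach \<epsilon>) (u, v)
      else ear_poly * ear_poly * arc_product n (attach \<epsilon>) b)"

lemma scaled_product_eq:
  "ear_poly * ear_poly * arc_product n (attach \<epsilon>) b =
     [:if fst b = snd b \<and> fst b \<in> set ws then \<epsilon> else 1:] * scaled_product \<epsilon> b"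
proof (cases "fst b = snd b \<and> fst b \<in> set ws")
  case True
  then show ?thesis
    using new_diagonal_product[of "fst b" \<epsilon>] by (cases b) (simp add: scaled_product_def)
next
  case False
  then show ?thesis
    using last_arc_product[of \<epsilon>] by (auto simp: scaled_product_def)
qed

text \<open>After clearing determinants a relation reads R^2 \<Sigma> + P D + c R P = 0 with R for
  \<open>ear_poly\<close>. Evaluating at the roots of R kills \<open>D\<close>; after cancelling one
  R, a further evaluation kills \<open>c\<close>, and \<Sigma> is a relation of the old
  family.\<close>

lemma scaled_product_indep_at_0:
  "indep_family (free_arcs (V \<union> set ws) E' (T \<union> stem)) (\<lambda>b. coeff (scaled_product 0 b))"
  unfolding indep_family_poly
proof (intro allI impI)
  fix c assume rel: "(\<Sum>b\<in>free_arcs (V \<union> set ws) E' (T \<union> stem).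
      Polynomial.smult (c b) (scaled_product 0 b)) = 0"
  define P where "P = arc_product n A (u, v)"
  define \<Sigma> where "\<Sigma> = (\<Sum>b\<in>free_arcs V E T. Polynomial.smult (c b) (arc_product n A b))"
  define D where "D = (\<Sum>w\<in>set ws. Polynomial.smult (c (w, w)) (ear_poly_but w))"
  \<comment> \<open>Both \<open>p\<close> and \<open>q\<close> at \<epsilon> = 0 are old values
    times a ratio of determinants, so the squares of the two determinants clear all
    denominators.\<close>
  define X where "X = (charpoly n A)\<^sup>2"
  define X' where "X' = (charpoly n (attach 0))\<^sup>2"
  have X'0: "X' \<noteq> 0" by (simp add: X'_def charpoly_nonzero)
  have uv: "X * arc_product n (attach 0) (u, v) = X' * P"
    unfolding X_def X'_def P_def by (rule arc_product_old_at_0[OF ends(2,1)])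
  have "0 = X * (\<Sum>b\<in>free_arcs (V \<union> set ws) E' (T \<union> stem).
      Polynomial.smult (c b) (scaled_product 0 b))"
    unfolding rel by simp
  also have "\<dots> = (\<Sum>b\<in>free_arcs V E T. Polynomial.smult (c b) (X * scaled_product 0 b)) +
      (\<Sum>w\<in>set ws. Polynomial.smult (c (w, w)) (X * scaled_product 0 (w, w))) +
      Polynomial.smult (c (last ws, v)) (X * scaled_product 0 (last ws, v))"
    unfolding sum_free_arcs_attach by (simp add: distrib_left sum_distrib_left)
  also have "(\<Sum>b\<in>free_arcs V E T. Polynomial.smult (c b) (X * scaled_product 0 b)) = X' * (ear_poly * ear_poly * \<Sigma>)"
    unfolding \<Sigma>_def sum_distrib_left
  proof (rule sum.cong[OF refl])
    fix b assume b: "b \<in> free_arcs V E T"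
    then have bV: "snd b \<in> V" "fst b \<in> V" using free_subset by auto
    have "scaled_product 0 b = ear_poly * ear_poly * arc_product n (attach 0) b"
      using bV ws_not_V last_in unfolding scaled_product_def by auto
    then have "X * scaled_product 0 b = ear_poly * ear_poly * (X * arc_product n (attach 0) b)"
      by (simp only: mult_ac)
    also have "X * arc_product n (attach 0) b = X' * arc_product n A b"
      unfolding X_def X'_def using arc_product_old_at_0[OF bV] by simp
    finally show "Polynomial.smult (c b) (X * scaled_product 0 b) =
        X' * (ear_poly * ear_poly * Polynomial.smult (c b) (arc_product n A b))"
      by (simp add: mult_ac)
  qed
  also have "(\<Sum>w\<in>set ws. Polynomial.smult (c (w, w)) (X * scaled_product 0 (w, w))) = X' * (P * D)"
    unfolding D_def sum_distrib_left
  proof (rule sum.cong[OF refl])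
    fix w assume "w \<in> set ws"
    then have "X * scaled_product 0 (w, w) = ear_poly_but w * (X * arc_product n (attach 0) (u, v))"
      by (simp add: scaled_product_def mult_ac)
    then show "Polynomial.smult (c (w, w)) (X * scaled_product 0 (w, w)) =
        X' * (P * Polynomial.smult (c (w, w)) (ear_poly_but w))"
      unfolding uv by (simp add: mult_ac)
  qed
  also have "X * scaled_product 0 (last ws, v) = ear_poly * (X * arc_product n (attach 0) (u, v))"
    using ws_not_V last_in ends(2) by (auto simp: scaled_product_def mult_ac)
  also have "\<dots> = X' * (ear_poly * P)" unfolding uv by (simp only: mult_ac)
  also have "X' * (ear_poly * ear_poly * \<Sigma>) + X' * (P * D) + Polynomial.smult (c (last ws, v)) (X' * (ear_poly * P)) =
      X' * (ear_poly * ear_poly * \<Sigma> + P * D + Polynomial.smult (c (last ws, v)) (ear_poly * P))"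
    by (simp add: distrib_left)
  finally have eq: "ear_poly * ear_poly * \<Sigma> + P * D + Polynomial.smult (c (last ws, v)) (ear_poly * P) = 0"
    using X'0 by simp
  have W0: "poly ear_poly (d w) = 0" if "w \<in> set ws" for w
    using that by (simp add: ear_poly_split)
  have W'_ne: "poly (ear_poly_but w) (d w) \<noteq> 0" if "w \<in> set ws" for w
    using d_inj unfolding ear_poly_but_def poly_prod_linear by (auto simp: prod_zero_iff inj_eq)
  have W'_0: "poly (ear_poly_but x) (d w) = 0" if "w \<in> set ws" "x \<noteq> w" for w x
    using that unfolding ear_poly_but_def poly_prod_linear by (auto simp: prod_zero_iff)
  have P_ne: "poly P (d w) \<noteq> 0" for w
    unfolding P_def by (rule d_root)
  \<comment> \<open>At the node \<open>d w\<close> all Lagrange polynomials but that of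
    \<open>w\<close> vanish, and \<open>P\<close> is nonzero there by the choice of the
    leaks.\<close>
  have cw: "c (w, w) = 0" if w: "w \<in> set ws" for w
  proof -
    have "poly D (d w) = (\<Sum>x\<in>set ws. c (x, x) * poly (ear_poly_but x) (d w))"
      by (simp add: D_def poly_sum)
    also have "\<dots> = (\<Sum>x\<in>{w}. c (x, x) * poly (ear_poly_but x) (d w))"
      using w W'_0[OF w] by (intro sum.mono_neutral_right) auto
    finally have "poly D (d w) = c (w, w) * poly (ear_poly_but w) (d w)" by simp
    moreover have "poly P (d w) * poly D (d w) = 0"
      using arg_cong[OF eq, of "\<lambda>p. poly p (d w)"] W0[OF w] by simp
    ultimately show ?thesis using P_ne W'_ne[OF w] by simp
  qed
  then have "D = 0" by (simp add: D_def)
  then have "ear_poly * (ear_poly * \<Sigma> + Polynomial.smult (c (last ws, v)) P) = 0"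
    using eq by (simp add: distrib_left mult.assoc)
  moreover have Wne: "ear_poly \<noteq> 0" unfolding ear_poly_def by (rule prod_linear_nonzero)
  ultimately have eq2: "ear_poly * \<Sigma> + Polynomial.smult (c (last ws, v)) P = 0" by simp
  \<comment> \<open>One factor \<open>ear_poly\<close> is still left in front of \<Sigma>; any of
    its roots would do, and \<open>last ws\<close> provides one because \<open>ws\<close> is
    nonempty.\<close>
  have "c (last ws, v) * poly P (d (last ws)) = 0"
  proof -
    have "poly (ear_poly * \<Sigma> + Polynomial.smult (c (last ws, v)) P) (d (last ws)) = 0"
      unfolding eq2 by simp
    then show ?thesis
      by (simp only: poly_add poly_mult poly_smult W0[OF last_in] mult_zero_left add_0_left)
  qed
  then have cl: "c (last ws, v) = 0" using P_ne by simp
  then have "\<Sigma> = 0" using eq2 Wne by simp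
  then have "\<forall>b\<in>free_arcs V E T. c b = 0"
    using A_indep unfolding indep_family_poly \<Sigma>_def by blast
  then show "\<forall>b\<in>free_arcs (V \<union> set ws) E' (T \<union> stem). c b = 0"
    unfolding free_arcs_attach using cw cl by auto
qed

lemma polyfun_poly_attach:
  assumes "i \<in> {1..n}" "j \<in> {1..n}"
  shows "(\<lambda>\<epsilon>. adj_entry n (attach \<epsilon>) i j) \<in> polyfun_poly {\<lambda>x. x}"
  unfolding polyfun_poly_def
proof (intro CollectI allI)
  fix k
  show "(\<lambda>\<epsilon>. coeff (adj_entry n (attach \<epsilon>) i j) k) \<in> polyfun {\<lambda>x. x}"
  proof (rule polyfun_comp[OF polyfun_polyD[OF polyfun_poly_adj_entry[OF assms]]])
    fix g assume "g \<in> entries"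
    then obtain a b where g: "g = (\<lambda>A. A a b)" by (auto simp: entries_def)
    show "(\<lambda>\<epsilon>. g (attach \<epsilon>)) \<in> polyfun {\<lambda>x. x}"
    proof (cases "\<exists>z. \<forall>\<epsilon>. attach \<epsilon> a b = z")
      case True
      then show ?thesis unfolding g by (auto intro: polyfun.const)
    next
      case False
      then have "\<not> (a = b \<and> a \<in> set ws)" "(b, a) \<notin> stem" "b = last ws \<and> a = v"
        unfolding attach_def by metis+
      then have "attach \<epsilon> a b = \<epsilon>" for \<epsilon> unfolding attach_def
        by (simp only: if_False if_True HOL.simp_thms)
      then show ?thesis unfolding g by (simp add: polyfun.gen)
    qed
  qed
qed

text \<open>Independence of the scaled family at \<epsilon> = 0 is certified by a polynomial in
  \<epsilon>, which therefore has a nonzero argument where it does not vanish. There the scaled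
  products are nonzero multiples of the true ones, up to a common factor.\<close>

lemma independent_at_attach:
  obtains \<epsilon> where "independent_at n (V \<union> set ws) E' (T \<union> stem) (attach \<epsilon>)"
proof -
  let ?B = "free_arcs (V \<union> set ws) E' (T \<union> stem)"
  have fin: "finite ?B"
    unfolding free_arcs_attach using finite_free
    by (simp add: Id_on_def)
  have arc_pf: "(\<lambda>\<epsilon>. arc_product n (attach \<epsilon>) b) \<in> polyfun_poly {\<lambda>x. x}"
    if "fst b \<in> {1..n}" "snd b \<in> {1..n}" for b
    unfolding arc_product_def using that n_ge_1
    by (intro polyfun_poly_mult polyfun_poly_attach) auto
  have uv: "u \<in> {1..n}" "v \<in> {1..n}" using ends V_facts(2) by auto
  have "(\<lambda>\<epsilon>. scaled_product \<epsilon> b) \<in> polyfun_poly {\<lambda>x. x}" if "b \<in> ?B" for b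
  proof -
    have "b \<in> (V \<union> set ws) \<times> (V \<union> set ws)"
      using that free_subset last_in ends(2) unfolding free_arcs_attach by auto
    then have b: "fst b \<in> {1..n}" "snd b \<in> {1..n}" using V_facts(2) ws(4) by auto
    consider "fst b = snd b \<and> fst b \<in> set ws" | "\<not> (fst b = snd b \<and> fst b \<in> set ws)" "b = (last ws, v)"
      | "\<not> (fst b = snd b \<and> fst b \<in> set ws)" "b \<noteq> (last ws, v)" by blast
    then show ?thesis
    proof cases
      case 1
      then show ?thesis unfolding scaled_product_def using arc_pf[of "(u, v)"] uv
        by (auto intro!: polyfun_poly_mult polyfun_poly_const)
    next
      case 2
      then have "scaled_product \<epsilon> b = ear_poly * arc_product n (attach \<epsilon>) (u, v)" for \<epsilon>
        unfolding scaled_product_def by auto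
      then show ?thesis using arc_pf[of "(u, v)"] uv
        by (auto intro!: polyfun_poly_mult polyfun_poly_const)
    next
      case 3
      then have "scaled_product \<epsilon> b = ear_poly * ear_poly * arc_product n (attach \<epsilon>) b" for \<epsilon>
        unfolding scaled_product_def by auto
      then show ?thesis using arc_pf[OF b]
        by (auto intro!: polyfun_poly_mult polyfun_poly_const)
    qed
  qed
  then have pf: "(\<lambda>\<epsilon>. coeff (scaled_product \<epsilon> b) k) \<in> polyfun {\<lambda>x. x}" if "b \<in> ?B" for b k
    using that polyfun_polyD by blast
  obtain \<Delta> where \<Delta>: "\<Delta> \<in> polyfun {\<lambda>x. x}" "\<Delta> 0 \<noteq> 0"
    "\<And>\<epsilon>. \<Delta> \<epsilon> \<noteq> 0 \<Longrightarrow> indep_family ?B (\<lambda>b. coeff (scaled_product \<epsilon> b))"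
    using indep_family_certificate[of ?B "\<lambda>b k \<epsilon>. coeff (scaled_product \<epsilon> b) k", OF fin pf
        scaled_product_indep_at_0] by blast
  have "\<exists>P. \<forall>t. \<Delta> t = poly P t"
    by (rule polyfun_univariate[OF \<Delta>(1)]) (auto intro: exI[of _ "[:0, 1:]"])
  then obtain P where P: "\<And>t. \<Delta> t = poly P t" by blast
  have "P \<noteq> 0" using \<Delta>(2) P by auto
  then obtain \<epsilon> where \<epsilon>: "\<epsilon> \<noteq> 0" "\<Delta> \<epsilon> \<noteq> 0"
    using poly_eq_0_if_cofinite[of "{0}" P] P by auto
  have "indep_family ?B (\<lambda>b. coeff (arc_product n (attach \<epsilon>) b))"
    unfolding indep_family_poly
  proof (intro allI impI)
    fix c assume c: "(\<Sum>b\<in>?B. Polynomial.smult (c b) (arc_product n (attach \<epsilon>) b)) = 0"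
    define s where "s b = (if fst b = snd b \<and> fst b \<in> set ws then \<epsilon> else 1)" for b :: "nat \<times> nat"
    have "0 = (ear_poly * ear_poly) * (\<Sum>b\<in>?B. Polynomial.smult (c b) (arc_product n (attach \<epsilon>) b))"
      unfolding c by simp
    also have "\<dots> = (\<Sum>b\<in>?B. Polynomial.smult (c b) (ear_poly * ear_poly * arc_product n (attach \<epsilon>) b))"
      unfolding sum_distrib_left by (intro sum.cong refl) (simp add: mult_ac)
    also have "\<dots> = (\<Sum>b\<in>?B. Polynomial.smult (c b * s b) (scaled_product \<epsilon> b))"
      unfolding scaled_product_eq s_def by simp
    finally have "(\<Sum>b\<in>?B. Polynomial.smult (c b * s b) (scaled_product \<epsilon> b)) = 0"
      by (rule sym)
    then have "\<forall>b\<in>?B. c b * s b = 0"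
      using indep_family_polyD[OF \<Delta>(3)[OF \<epsilon>(2)], of "\<lambda>b. c b * s b"] by blast
    then show "\<forall>b\<in>?B. c b = 0" using \<epsilon>(1) by (auto simp: s_def split: if_splits)
  qed
  moreover have "arborescence (V \<union> set ws) (T \<union> stem)"
    using arborescence_path[OF V_facts(5) ends(1) ws(2,3)] .
  moreover have "stem \<subseteq> (V \<union> set ws) \<times> (V \<union> set ws)"
    using arborescence_subset[OF calculation(2)] by blast
  then have "E' \<subseteq> (V \<union> set ws) \<times> (V \<union> set ws)"
    unfolding E'_eq using V_facts(3) last_in ends(2) by blast
  moreover have "(x, x) \<notin> E'" for x
    unfolding E'_eq using V_facts(4) stem_irrefl ws_not_V last_in ends(2) by auto
  moreover have "T \<union> stem \<subseteq> E'"
    unfolding E'_eq using V_facts(6) by blast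
  moreover have "attach \<epsilon> i j \<noteq> 0 \<Longrightarrow> (i = j \<and> i \<in> V \<union> set ws) \<or> (j, i) \<in> E'" for i j
    unfolding E'_eq using A_support[of i j] by (auto simp: attach_def split: if_splits)
  moreover have "attach \<epsilon> i j = 1" if "(j, i) \<in> T \<union> stem" for i j
  proof (cases "(j, i) \<in> stem")
    case True
    then show ?thesis using stem_irrefl by (auto simp: attach_def)
  next
    case False
    then have t: "(j, i) \<in> T" using that by blast
    then have "j \<in> V" "i \<in> V" using V_facts(3,6) by auto
    then show ?thesis using attach_old A_tree[OF t] by simp
  qed
  ultimately have "independent_at n (V \<union> set ws) E' (T \<union> stem) (attach \<epsilon>)"
    unfolding independent_at_def using V_facts(1,2) ws(4) by blast
  then show ?thesis by (rule that)
qed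

end

text \<open>The pair of ends need not be a free position, so its product is not a member of the
  family. It is nonzero all the same: every diagonal position of \<open>V\<close> is free, hence p_x
  and q_x are nonzero for each old vertex.\<close>

lemma independent_at_ear:
  assumes "independent_at n V E T A" "u \<in> V" "v \<in> V"
    and "ws \<noteq> []" "distinct ws" "set ws \<inter> V = {}" "set ws \<subseteq> {1..n}"
  shows "\<exists>T' A'. independent_at n (V \<union> set ws) (E \<union> set (vwalk_arcs (u # ws @ [v]))) T' A'"
proof -
  have fin: "finite (free_arcs V E T)" using card_free_arcs(1)[OF assms(1)] .
  have "adj_entry n A 1 x \<noteq> 0 \<and> adj_entry n A x 1 \<noteq> 0" if "x \<in> V" for x
  proof -
    have "(x, x) \<in> free_arcs V E T"
      using assms(1) that by (auto simp: independent_at_def free_arcs_def)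
    moreover have "indep_family (free_arcs V E T) (\<lambda>b. coeff (arc_product n A b))"
      using assms(1) unfolding independent_at_def by blast
    ultimately obtain k where "coeff (arc_product n A (x, x)) k \<noteq> 0"
      using indep_family_nonzero[OF _ fin] by metis
    then show ?thesis by (auto simp: arc_product_def)
  qed
  then have ne: "arc_product n A (u, v) \<noteq> 0"
    using assms(2,3) by (simp add: arc_product_def)
  have "infinite (- {t. poly (arc_product n A (u, v)) t = 0})"
    using poly_roots_finite[OF ne] infinite_UNIV_char_0 by (simp add: Compl_eq_Diff_UNIV Diff_infinite_finite)
  \<comment> \<open>Only finitely many values are forbidden, which leaves room for an injective
    choice of leaks.\<close>
  then obtain d :: "nat \<Rightarrow> complex" where d: "inj d" "range d \<subseteq> - {t. poly (arc_product n A (u, v)) t = 0}"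
    using infinite_countable_subset by blast
  have "poly (arc_product n A (u, v)) (d w) \<noteq> 0" for w
    using d(2) by auto
  from independent_at_attach[OF assms d(1) this] show ?thesis by blast
qed

section \<open>Induction along an ear decomposition\<close>

text \<open>The start of the cycle reappears at its end, so the tail lists each vertex once.
  Exchanging the pieces of the tail before and after \<open>x\<close> gives the same cycle read as a
  closed ear at \<open>x\<close>.\<close>

lemma rotate_cycle:
  assumes "directed_cycle p" "x \<in> set p"
  obtains ws where "ws \<noteq> []" "distinct ws" "x \<notin> set ws" "set p = insert x (set ws)"
    "set (vwalk_arcs p) = set (vwalk_arcs (x # ws @ [x]))"
proof -
  obtain z t where p: "p = z # t" "2 \<le> length t" "last t = z" "distinct t"
    using assms(1) by (cases p) (auto simp: directed_cycle_def split: if_splits)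
  have tne: "t \<noteq> []" using p(2) by auto
  then have "z \<in> set t" using p(3) last_in_set by blast
  then have "x \<in> set t" using assms(2) p(1) by auto
  then obtain as bs where t: "t = as @ x # bs" by (meson split_list)
  show ?thesis
  proof (cases "bs = []")
    case True
    then have z: "z = x" using p(3) t by simp
    show ?thesis
      using p t z True by (intro that[of as]) auto
  next
    case False
    then have z: "last bs = z" using p(3) t by simp
    have 1: "vwalk_arcs ((x # bs) @ as @ [x]) =
        vwalk_arcs (x # bs) @ (last (x # bs), hd (as @ [x])) # vwalk_arcs (as @ [x])"
      by (rule vwalk_arcs_append) auto
    have 2: "vwalk_arcs ((z # as @ [x]) @ bs) =
        vwalk_arcs (z # as @ [x]) @ (last (z # as @ [x]), hd bs) # vwalk_arcs bs"
      by (rule vwalk_arcs_append) (use False in auto)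
    have "set (vwalk_arcs p) = set (vwalk_arcs (x # (bs @ as) @ [x]))"
      using 1 2 False z p(1) t by auto
    then show ?thesis
      using p t z False by (intro that[of "bs @ as"]) auto
  qed
qed

lemma independent_at_ear_decomposition:
  assumes "nontrivial_ear_decomposition G Ps" "pverts G = {1..n}"
  shows "\<exists>T A. independent_at n (pverts G) (parcs G) T A"
proof -
  have dec: "Ps \<noteq> []" "directed_cycle (Ps ! 0)" "1 \<in> set (Ps ! 0)"
    "\<And>i. 1 \<le> i \<Longrightarrow> i < length Ps \<Longrightarrow> is_ear (verts_upto Ps (i - 1)) (arcs_upto Ps (i - 1)) (Ps ! i)"
    "\<And>i. 1 \<le> i \<Longrightarrow> i < length Ps \<Longrightarrow> length (Ps ! i) \<noteq> 2"
    "verts_upto Ps (length Ps - 1) = pverts G" "arcs_upto Ps (length Ps - 1) = parcs G"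
    using assms(1) unfolding nontrivial_ear_decomposition_def ear_decomposition_def trivial_ear_def
    by blast+
  have mono: "verts_upto Ps i \<subseteq> {1..n}" if "i < length Ps" for i
    using that dec(6) assms(2) unfolding verts_upto_def by fastforce
  have vSuc: "verts_upto Ps (Suc i) = verts_upto Ps i \<union> set (Ps ! Suc i)" for i
    unfolding verts_upto_def by (auto simp: atMost_Suc)
  have aSuc: "arcs_upto Ps (Suc i) = arcs_upto Ps i \<union> set (vwalk_arcs (Ps ! Suc i))" for i
    unfolding arcs_upto_def by (auto simp: atMost_Suc)
  have "i < length Ps \<Longrightarrow> \<exists>T A. independent_at n (verts_upto Ps i) (arcs_upto Ps i) T A" for i
  proof (induction i)
    case 0
    have v0: "verts_upto Ps 0 = set (Ps ! 0)" "arcs_upto Ps 0 = set (vwalk_arcs (Ps ! 0))"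
      by (simp_all add: verts_upto_def arcs_upto_def)
    obtain ws where ws: "ws \<noteq> []" "distinct ws" "1 \<notin> set ws" "set (Ps ! 0) = insert 1 (set ws)"
      "set (vwalk_arcs (Ps ! 0)) = set (vwalk_arcs (1 # ws @ [1]))"
      by (rule rotate_cycle[OF dec(2,3)])
    have "insert 1 (set ws) \<subseteq> {1..n}" using mono[of 0] v0 ws(4) dec(1) by auto
    then have n: "1 \<le> n" and "set ws \<subseteq> {1..n}" by auto
    then have "\<exists>T A. independent_at n ({1} \<union> set ws) ({} \<union> set (vwalk_arcs (1 # ws @ [1]))) T A"
      using ws by (intro independent_at_ear[OF independent_at_root]) auto
    then show ?case unfolding v0 ws(4,5) by simp
  next
    case (Suc i)
    then obtain T A where IH: "independent_at n (verts_upto Ps i) (arcs_upto Ps i) T A" by auto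
    let ?p = "Ps ! Suc i"
    have ear: "is_ear (verts_upto Ps i) (arcs_upto Ps i) ?p" and len: "length ?p \<noteq> 2"
      using dec(4,5)[of "Suc i"] Suc.prems by auto
    obtain u r where p1: "?p = u # r" "r \<noteq> []"
      using ear unfolding is_ear_def by (cases ?p) (auto simp: Suc_le_length_iff)
    obtain ws v where r: "r = ws @ [v]" using p1(2) by (metis append_butlast_last_id)
    have p: "?p = u # ws @ [v]" using p1 r by simp
    have ws: "u \<in> verts_upto Ps i" "v \<in> verts_upto Ps i" "distinct ws"
      "set ws \<inter> verts_upto Ps i = {}" "ws \<noteq> []"
      \<comment> \<open>An ear of length other than two has inner vertices; this is what excluding
        trivial ears provides.\<close>
      using ear len unfolding is_ear_def p by auto
    have "set ws \<subseteq> {1..n}" using mono[OF Suc.prems] unfolding vSuc p by auto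
    from independent_at_ear[OF IH ws(1,2,5,3,4) this]
    have "\<exists>T A. independent_at n (verts_upto Ps i \<union> set ws)
        (arcs_upto Ps i \<union> set (vwalk_arcs (u # ws @ [v]))) T A" .
    moreover have "verts_upto Ps i \<union> set ws = verts_upto Ps (Suc i)"
      unfolding vSuc p using ws(1,2) by auto
    ultimately show ?case unfolding aSuc p by simp
  qed
  from this[of "length Ps - 1"] dec(1,6,7) show ?thesis by simp
qed

section \<open>The double characteristic polynomial map\<close>

text \<open>Reads the monic polynomial back from a point of the target space, so that expressions in
  the two characteristic polynomials become polynomial functions of that point. The second
  polynomial starts at offset \<open>n\<close>.\<close>

definition vec_charpoly :: "nat \<Rightarrow> complex Matrix.vec \<Rightarrow> complex poly" where
  "vec_charpoly n v = monom 1 n + (\<Sum>k<n. monom (vec_index v k) k)"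

definition vec_charpoly1 :: "nat \<Rightarrow> complex Matrix.vec \<Rightarrow> complex poly" where
  "vec_charpoly1 n v = monom 1 (n - 1) + (\<Sum>k<n - 1. monom (vec_index v (n + k)) k)"

lemma monic_poly_eq_sum:
  fixes p :: "complex poly"
  assumes "degree p = n" "coeff p n = 1"
  shows "p = monom 1 n + (\<Sum>k<n. monom (coeff p k) k)"
proof -
  have "p = (\<Sum>k\<le>n. monom (coeff p k) k)"
    using poly_as_sum_of_monoms[of p] assms(1) by simp
  also have "\<dots> = monom (coeff p n) n + (\<Sum>k<n. monom (coeff p k) k)"
    by (simp add: lessThan_Suc_atMost[symmetric] add.commute)
  finally show ?thesis using assms(2) by simp
qed

lemma vec_charpoly_double_char_map:
  assumes "1 \<le> n"
  shows "vec_charpoly n (double_char_map n A) = charpoly n A"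
    and "vec_charpoly1 n (double_char_map n A) = charpoly1 n A"
proof -
  have "vec_charpoly n (double_char_map n A) = monom 1 n + (\<Sum>k<n. monom (coeff (charpoly n A) k) k)"
    unfolding vec_charpoly_def using assms
    by (intro arg_cong2[of _ _ _ _ "(+)"] sum.cong refl) (simp add: double_char_map_def charpoly_def)
  also have "\<dots> = charpoly n A"
    using charpoly_degree by (rule monic_poly_eq_sum[symmetric])
  finally show "vec_charpoly n (double_char_map n A) = charpoly n A" .
  have "vec_charpoly1 n (double_char_map n A) =
      monom 1 (n - 1) + (\<Sum>k<n - 1. monom (coeff (charpoly1 n A) k) k)"
    unfolding vec_charpoly1_def using assms
    by (intro arg_cong2[of _ _ _ _ "(+)"] sum.cong refl) (simp add: double_char_map_def charpoly1_def)
  also have "\<dots> = charpoly1 n A"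
    using charpoly1_degree by (rule monic_poly_eq_sum[symmetric])
  finally show "vec_charpoly1 n (double_char_map n A) = charpoly1 n A" .
qed

lemma polyfun_double_char_map:
  assumes "1 \<le> n" "i < 2 * n - 1"
  shows "(\<lambda>A. vec_index (double_char_map n A) i) \<in> polyfun entries"
proof (cases "i < n")
  case True
  then show ?thesis
    using polyfun_polyD[OF polyfun_poly_charpoly[of n], of i] assms
    by (simp add: double_char_map_def charpoly_def)
next
  case False
  have "(\<lambda>A. charpoly1 n A) \<in> polyfun_poly entries"
    using polyfun_poly_adj_entry[of 1 n 1] adj_entry_11[OF assms(1)] assms(1) by simp
  from polyfun_polyD[OF this, of "i - n"] show ?thesis
    using False assms by (simp add: double_char_map_def charpoly1_def)
qed

lemma char_poly_diagonal_conjugate: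
  fixes M :: "complex mat"
  assumes M: "M \<in> carrier_mat n n" and f: "\<And>i. i < n \<Longrightarrow> f i \<noteq> 0"
  shows "char_poly (mat n n (\<lambda>(i, j). M $$ (i, j) * f i / f j)) = char_poly M"
proof (rule char_poly_similar)
  let ?N = "mat n n (\<lambda>(i, j). M $$ (i, j) * f i / f j)"
  let ?P = "mat n n (\<lambda>(i, j). if i = j then f i else 0)"
  let ?Q = "mat n n (\<lambda>(i, j). if i = j then 1 / f i else 0)"
  have PQ: "?P * ?Q = 1\<^sub>m n" "?Q * ?P = 1\<^sub>m n"
    using f by (auto intro!: eq_matI simp: scalar_prod_def sum.neutral if_distrib[of "\<lambda>x. x * _"] cong: if_cong)
  have "(?P * M * ?Q) $$ (i, j) = ?N $$ (i, j)" if "i < n" "j < n" for i j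
  proof -
    have PM: "(?P * M) $$ (i, k) = f i * M $$ (i, k)" if "k < n" for k
      using mult_mat_index[of ?P n M i k] M \<open>i < n\<close> that
      by (simp add: if_distrib[of "\<lambda>x. x * _"] cong: if_cong)
    have "(?P * M * ?Q) $$ (i, j) = (\<Sum>k=0..<n. (?P * M) $$ (i, k) * ?Q $$ (k, j))"
      using M that by (intro mult_mat_index) auto
    also have "\<dots> = (\<Sum>k=0..<n. f i * M $$ (i, k) * (if k = j then 1 / f k else 0))"
      using PM that by (intro sum.cong refl) simp
    also have "\<dots> = f i * M $$ (i, j) / f j"
      using that by (simp add: if_distrib[of "\<lambda>x. _ * x"] cong: if_cong)
    finally show ?thesis using that by (simp add: mult.commute)
  qed
  then have "?N = ?P * M * ?Q"
    using M by (intro eq_matI) auto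
  then have "similar_mat_wit ?N M ?P ?Q"
    using PQ M by (intro similar_mat_witI[of _ _ n]) auto
  then show "similar_mat ?N M" unfolding similar_mat_def by blast
qed

text \<open>Rescaling is conjugation by a diagonal matrix, and it restricts to a conjugation of the
  matrix with the first row and column removed.\<close>

lemma double_char_map_rescale:
  assumes "\<And>i. i \<in> {1..n} \<Longrightarrow> f i A \<noteq> 0"
  shows "double_char_map n (rescale f A) = double_char_map n A"
proof -
  have "char_poly (to_mat n (rescale f A)) =
      char_poly (mat n n (\<lambda>(i, j). to_mat n A $$ (i, j) * f (Suc i) A / f (Suc j) A))"
    by (intro arg_cong[of _ _ char_poly] eq_matI) (auto simp: to_mat_def rescale_def)
  also have "\<dots> = char_poly (to_mat n A)"
    using assms by (intro char_poly_diagonal_conjugate) auto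
  finally have 1: "char_poly (to_mat n (rescale f A)) = char_poly (to_mat n A)" .
  let ?D = "\<lambda>A. mat_delete (to_mat n A) 0 0"
  have "char_poly (?D (rescale f A)) =
      char_poly (mat (n - 1) (n - 1) (\<lambda>(i, j). ?D A $$ (i, j) * f (Suc (Suc i)) A / f (Suc (Suc j)) A))"
    by (intro arg_cong[of _ _ char_poly] eq_matI) (auto simp: to_mat_def rescale_def mat_delete_def)
  also have "\<dots> = char_poly (?D A)"
    using assms by (intro char_poly_diagonal_conjugate mat_delete_to_mat_carrier) auto
  finally have 2: "char_poly (?D (rescale f A)) = char_poly (?D A)" .
  show ?thesis unfolding double_char_map_def 1 2 ..
qed

section \<open>The slice of normalized matrices\<close>

definition segment_point ::
  "(nat \<Rightarrow> nat \<Rightarrow> complex) \<Rightarrow> (nat \<Rightarrow> nat \<Rightarrow> complex) \<Rightarrow> complex \<Rightarrow> nat \<Rightarrow> nat \<Rightarrow> complex"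
where
  "segment_point A B t = (\<lambda>i j. A i j + t * (B i j - A i j))"

text \<open>The only property of affine subspaces that matters below: density and irreducibility are
  both checked on the line through two points.\<close>

definition line_closed :: "(nat \<Rightarrow> nat \<Rightarrow> complex) set \<Rightarrow> bool" where
  "line_closed S \<longleftrightarrow> (\<forall>A\<in>S. \<forall>B\<in>S. \<forall>t. segment_point A B t \<in> S)"

lemma segment_point_0_1 [simp]: "segment_point A B 0 = A" "segment_point A B 1 = B"
  by (simp_all add: segment_point_def fun_eq_iff)

lemma polyfun_segment:
  assumes "f \<in> polyfun entries"
  obtains P where "\<And>t. f (segment_point A B t) = poly P t"
proof -
  have "\<exists>P. \<forall>t. f (segment_point A B t) = poly P t"
  proof (rule polyfun_univariate[OF assms])
    fix g assume "g \<in> entries"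
    then obtain i j where "g = (\<lambda>A. A i j)" by (auto simp: entries_def)
    then show "\<exists>P. \<forall>t. g (segment_point A B t) = poly P t"
      by (intro exI[of _ "[:A i j, B i j - A i j:]"]) (simp add: segment_point_def)
  qed
  then show ?thesis using that by blast
qed

lemma continuous_on_entry: "continuous_on S (\<lambda>A :: nat \<Rightarrow> nat \<Rightarrow> complex. A i j)"
  by (rule continuous_on_product_then_coordinatewise[OF
        continuous_on_product_then_coordinatewise[OF continuous_on_id]])

lemma continuous_on_polyfun_entries: "f \<in> polyfun entries \<Longrightarrow> continuous_on S f"
  by (rule polyfun_continuous_on) (auto simp: entries_def intro: continuous_on_entry)

lemma continuous_on_segment_point: "continuous_on S (segment_point A B)"
  unfolding segment_point_def
  by (intro continuous_on_coordinatewise_then_product continuous_intros)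

text \<open>On the line from \<open>A\<close> to \<open>A0\<close> the function is a nonzero
  polynomial in \<open>t\<close>, and 0 is a limit of arguments that are not among its finitely many
  roots.\<close>

lemma closure_nonvanishing:
  assumes "line_closed S" "A0 \<in> S" "\<Delta> \<in> polyfun entries" "\<Delta> A0 \<noteq> 0"
  shows "S \<subseteq> closure {A \<in> S. \<Delta> A \<noteq> 0}"
proof
  fix A assume A: "A \<in> S"
  obtain P where P: "\<And>t. \<Delta> (segment_point A A0 t) = poly P t"
    using polyfun_segment[OF assms(3)] by blast
  have "P \<noteq> 0" using P[of 1] assms(4) by auto
  then have fin: "finite {t. poly P t = 0}" by (rule poly_roots_finite)
  then have "0 islimpt - {t. poly P t = 0}"
    using islimpt_Un_finite[OF fin, of 0 "- {t. poly P t = 0}"] islimpt_UNIV[of "0::complex"] by simp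
  then have cl: "0 \<in> closure (- {t. poly P t = 0})"
    by (simp add: closure_def)
  have "segment_point A A0 ` closure (- {t. poly P t = 0}) \<subseteq> closure {A \<in> S. \<Delta> A \<noteq> 0}"
  proof (rule image_closure_subset)
    show "segment_point A A0 ` (- {t. poly P t = 0}) \<subseteq> closure {A \<in> S. \<Delta> A \<noteq> 0}"
    proof
      fix B assume "B \<in> segment_point A A0 ` (- {t. poly P t = 0})"
      then obtain t where t: "B = segment_point A A0 t" "poly P t \<noteq> 0" by blast
      then have "B \<in> S" "\<Delta> B \<noteq> 0"
        using assms(1,2) A P[of t] unfolding line_closed_def by (blast, simp)
      then show "B \<in> closure {A \<in> S. \<Delta> A \<noteq> 0}"
        by (intro subsetD[OF closure_subset] CollectI conjI)
    qed
  qed (auto intro: continuous_on_segment_point)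
  then have "segment_point A A0 0 \<in> closure {A \<in> S. \<Delta> A \<noteq> 0}"
    using cl by blast
  then show "A \<in> closure {A \<in> S. \<Delta> A \<noteq> 0}" by simp
qed

text \<open>From here on the graph enters only through one matrix with independent products, no
  longer through its ears.\<close>

locale independent_point =
  fixes n :: nat and G :: "nat pair_pre_digraph" and T :: "(nat \<times> nat) set"
    and A0 :: "nat \<Rightarrow> nat \<Rightarrow> complex"
  assumes verts: "pverts G = {1..n}"
    and indep: "independent_at n (pverts G) (parcs G) T A0"
begin

definition free :: "(nat \<times> nat) set" where
  "free = free_arcs {1..n} (parcs G) T"

text \<open>A transversal to the scaling orbits: on the open set where the tree products do not
  vanish, each orbit can be normalized to 1 along the tree. Its coordinates are the entries at
  \<open>free\<close>.\<close>

definition slice :: "(nat \<Rightarrow> nat \<Rightarrow> complex) set" where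
  "slice = {A \<in> Theta G. \<forall>i j. (j, i) \<in> T \<longrightarrow> A i j = 1}"

lemma n_pos: "1 \<le> n"
  using indep unfolding independent_at_def verts by simp

lemma arcs: "parcs G \<subseteq> {1..n} \<times> {1..n}" "T \<subseteq> parcs G" "arborescence {1..n} T"
  using indep unfolding independent_at_def verts by blast+

lemma free_facts: "finite free" "card free = card (parcs G) + 1" "free \<subseteq> {1..n} \<times> {1..n}"
  using card_free_arcs[OF indep] arcs(1) unfolding free_def verts free_arcs_def by auto

lemma A0_slice: "A0 \<in> slice"
  using indep unfolding slice_def Theta_def independent_at_def by blast

lemma A0_indep: "indep_family free (\<lambda>b. coeff (arc_product n A0 b))"
  using indep unfolding independent_at_def verts free_def by blast

lemma slice_Theta: "slice \<subseteq> Theta G"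
  unfolding slice_def by blast

lemma Theta_outside: "A \<in> Theta G \<Longrightarrow> i \<notin> {1..n} \<or> j \<notin> {1..n} \<Longrightarrow> A i j = 0"
  using arcs(1) unfolding Theta_def verts by blast

lemma slice_fixed_entry:
  assumes "(j, i) \<notin> free"
  obtains z where "\<And>A. A \<in> slice \<Longrightarrow> A i j = z"
proof (cases "(j, i) \<in> T")
  case True
  then show ?thesis using that[of 1] unfolding slice_def by blast
next
  case False
  then have "\<not> (i = j \<and> i \<in> {1..n}) \<and> (j, i) \<notin> parcs G"
    using assms unfolding free_def free_arcs_def by auto
  then show ?thesis using that[of 0] unfolding slice_def Theta_def verts by blast
qed

lemma line_closed_Theta: "line_closed (Theta G)"
  unfolding line_closed_def
proof (intro ballI allI)
  fix A B t assume AB: "A \<in> Theta G" "B \<in> Theta G"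
  have "A i j \<noteq> 0 \<or> B i j \<noteq> 0" if "segment_point A B t i j \<noteq> 0" for i j
    using that by (auto simp: segment_point_def)
  then show "segment_point A B t \<in> Theta G"
    using AB unfolding Theta_def by blast
qed

lemma line_closed_slice: "line_closed slice"
  using line_closed_Theta unfolding line_closed_def slice_def by (auto simp: segment_point_def)

text \<open>Two matrices of the slice agree at all positions that are not free, so those terms of
  the resolvent identity drop out.\<close>

lemma slice_two_point:
  assumes "A \<in> slice" "B \<in> slice"
  shows "(\<Sum>b\<in>free. Polynomial.smult (A (snd b) (fst b) - B (snd b) (fst b))
      (adj_entry n A 1 (snd b) * adj_entry n B (fst b) 1)) =
    charpoly1 n A * charpoly n B - charpoly n A * charpoly1 n B"
proof -
  let ?h = "\<lambda>b. Polynomial.smult (A (snd b) (fst b) - B (snd b) (fst b))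
      (adj_entry n A 1 (snd b) * adj_entry n B (fst b) 1)"
  have "(\<Sum>b\<in>free. ?h b) = (\<Sum>b\<in>{1..n} \<times> {1..n}. ?h b)"
  proof (rule sum.mono_neutral_left)
    show "\<forall>b\<in>{1..n} \<times> {1..n} - free. ?h b = 0"
    proof
      fix b assume "b \<in> {1..n} \<times> {1..n} - free"
      then have "(fst b, snd b) \<notin> free" by simp
      then obtain z where z: "\<And>A. A \<in> slice \<Longrightarrow> A (snd b) (fst b) = z"
        by (rule slice_fixed_entry) blast
      have "A (snd b) (fst b) - B (snd b) (fst b) = 0"
        by (simp add: z[OF assms(1)] z[OF assms(2)])
      then show "?h b = 0" by (simp only: smult_0_left)
    qed
  qed (use free_facts(3) in auto)
  also have "\<dots> = (\<Sum>j=1..n. \<Sum>i=1..n. ?h (j, i))"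
    by (simp add: sum.cartesian_product split_def)
  also have "\<dots> = (\<Sum>i=1..n. \<Sum>j=1..n. ?h (j, i))"
    by (rule sum.swap)
  finally show ?thesis
    using two_point_identity[OF n_pos, of A B] by simp
qed

definition generic :: "(nat \<Rightarrow> nat \<Rightarrow> complex) set" where
  "generic = {A \<in> slice. indep_family free (\<lambda>b. coeff (arc_product n A b))}"

lemma free_bounds: "b \<in> free \<Longrightarrow> fst b \<in> {1..n}" "b \<in> free \<Longrightarrow> snd b \<in> {1..n}"
  using free_facts(3) by auto

text \<open>The certificate of independence at \<open>A0\<close> is a single polynomial in the
  entries, and its non-vanishing locus lies in \<open>generic\<close>.\<close>

lemma generic_dense: "slice \<subseteq> closure generic"
proof -
  have "(\<lambda>A. coeff (arc_product n A b) k) \<in> polyfun entries" if "b \<in> free" for b k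
    unfolding arc_product_def using free_bounds[OF that] n_pos
    by (intro polyfun_polyD polyfun_poly_mult polyfun_poly_adj_entry) auto
  then obtain \<Delta> where \<Delta>: "\<Delta> \<in> polyfun entries" "\<Delta> A0 \<noteq> 0"
    "\<And>A. \<Delta> A \<noteq> 0 \<Longrightarrow> indep_family free (\<lambda>b. coeff (arc_product n A b))"
    using indep_family_certificate[of free "\<lambda>b k A. coeff (arc_product n A b) k", OF free_facts(1) _ A0_indep]
    by metis
  have "{A \<in> slice. \<Delta> A \<noteq> 0} \<subseteq> generic"
    unfolding generic_def using \<Delta>(3) by blast
  then have "closure {A \<in> slice. \<Delta> A \<noteq> 0} \<subseteq> closure generic"
    by (rule closure_mono)
  with closure_nonvanishing[OF line_closed_slice A0_slice \<Delta>(1,2)] show ?thesis by blast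
qed

text \<open>
  If \<open>A\<close> and \<open>B\<close> have the same image, then \<open>A - B\<close> is a linear relation between the
  products \<open>p\<^sub>i q\<^sub>j\<close> with \<open>p\<close> taken at \<open>A\<close> and \<open>q\<close> at \<open>B\<close>.
\<close>

lemma generic_locally_injective:
  assumes "A \<in> generic"
  shows "\<exists>W. openin (top_of_set slice) W \<and> A \<in> W \<and> inj_on (double_char_map n) W"
proof -
  define F where "F b k x = coeff (adj_entry n (fst x) 1 (snd b) * adj_entry n (snd x) (fst b) 1) k"
    for b :: "nat \<times> nat" and k and x :: "(nat \<Rightarrow> nat \<Rightarrow> complex) \<times> (nat \<Rightarrow> nat \<Rightarrow> complex)"
  \<comment> \<open>Polynomial functions of a pair of matrices: the certificate must allow
    \<open>p\<close> and \<open>q\<close> to be taken at different points.\<close>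
  define X where "X = {\<lambda>x. f (fst x) | f. f \<in> entries} \<union>
    {\<lambda>x :: (nat \<Rightarrow> nat \<Rightarrow> complex) \<times> (nat \<Rightarrow> nat \<Rightarrow> complex). f (snd x) | f. f \<in> entries}"
  have "F b k \<in> polyfun X" if "b \<in> free" for b k
    unfolding F_def coeff_mult using free_bounds[OF that] n_pos
    by (intro polyfun_sum polyfun.mult
        polyfun_comp[where \<phi> = fst, OF polyfun_polyD[OF polyfun_poly_adj_entry]]
        polyfun_comp[where \<phi> = snd, OF polyfun_polyD[OF polyfun_poly_adj_entry]])
      (auto simp: X_def intro!: polyfun.gen)
  moreover have "indep_family free (\<lambda>b k. F b k (A, A))"
    using assms by (simp add: generic_def F_def arc_product_def)
  ultimately obtain \<Delta> where \<Delta>: "\<Delta> \<in> polyfun X" "\<Delta> (A, A) \<noteq> 0"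
    "\<And>x. \<Delta> x \<noteq> 0 \<Longrightarrow> indep_family free (\<lambda>b k. F b k x)"
    using indep_family_certificate[OF free_facts(1), of F X "(A, A)"] by blast
  have "continuous_on UNIV g" if "g \<in> X" for g
  proof -
    have "\<exists>i j. g = (\<lambda>x. fst x i j) \<or> g = (\<lambda>x. snd x i j)"
      using that unfolding X_def entries_def by auto
    then obtain i j where "g = (\<lambda>x. fst x i j) \<or> g = (\<lambda>x. snd x i j)" by blast
    moreover have "continuous_on UNIV (\<lambda>x :: (nat \<Rightarrow> nat \<Rightarrow> complex) \<times> (nat \<Rightarrow> nat \<Rightarrow> complex). fst x i j)"
      by (rule continuous_on_compose2[OF continuous_on_entry[of UNIV] continuous_on_fst[OF continuous_on_id]]) simp
    moreover have "continuous_on UNIV (\<lambda>x :: (nat \<Rightarrow> nat \<Rightarrow> complex) \<times> (nat \<Rightarrow> nat \<Rightarrow> complex). snd x i j)"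
      by (rule continuous_on_compose2[OF continuous_on_entry[of UNIV] continuous_on_snd[OF continuous_on_id]]) simp
    ultimately show ?thesis by blast
  qed
  then have "continuous_on UNIV \<Delta>"
    by (rule polyfun_continuous_on[OF \<Delta>(1)])
  then have "open {x. \<Delta> x \<noteq> 0}"
    by (intro open_Collect_neq continuous_on_const)
  then obtain U1 U2 where U: "open U1" "open U2" "(A, A) \<in> U1 \<times> U2" "U1 \<times> U2 \<subseteq> {x. \<Delta> x \<noteq> 0}"
    using \<Delta>(2) by (elim open_prod_elim[of _ "(A, A)"]) auto
  \<comment> \<open>Intersecting both factors makes every pair of points of \<open>W\<close> lie in
    the product neighborhood.\<close>
  define W where "W = slice \<inter> (U1 \<inter> U2)"
  have "inj_on (double_char_map n) W"
  proof (rule inj_onI)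
    fix B C assume BC: "B \<in> W" "C \<in> W" and eq: "double_char_map n B = double_char_map n C"
    have ch: "charpoly n B = charpoly n C" "charpoly1 n B = charpoly1 n C"
      using vec_charpoly_double_char_map[OF n_pos] eq by metis+
    have slices: "B \<in> slice" "C \<in> slice" using BC by (auto simp: W_def)
    have "(B, C) \<in> {x. \<Delta> x \<noteq> 0}" using BC U(4) by (auto simp: W_def)
    then have ind: "indep_family free (\<lambda>b. coeff (adj_entry n B 1 (snd b) * adj_entry n C (fst b) 1))"
      using \<Delta>(3)[of "(B, C)"] by (simp add: F_def)
    have rel: "(\<Sum>b\<in>free. Polynomial.smult (B (snd b) (fst b) - C (snd b) (fst b))
        (adj_entry n B 1 (snd b) * adj_entry n C (fst b) 1)) = 0"
      unfolding slice_two_point[OF slices] ch by (simp add: mult.commute)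
    show "B = C"
    proof (intro ext)
      fix i j
      show "B i j = C i j"
      proof (cases "(j, i) \<in> free")
        case True
        then show ?thesis using indep_family_polyD[OF ind rel True] by simp
      next
        case False
        then obtain z where z: "\<And>A. A \<in> slice \<Longrightarrow> A i j = z"
          by (rule slice_fixed_entry) blast
        show ?thesis by (simp add: z[OF slices(1)] z[OF slices(2)])
      qed
    qed
  qed
  moreover have "openin (top_of_set slice) W"
    unfolding W_def using U(1,2) by (intro openin_open_Int open_Int)
  moreover have "A \<in> W"
    using U(3) assms by (simp add: W_def generic_def)
  ultimately show ?thesis by blast
qed

text \<open>With \<open>f i = 1 / \<rho> i\<close> an entry on a tree arc becomes A i j * \<rho> j /
  \<rho> i, which is 1 by the recursion for \<rho>. On the slice all \<rho> are 1, so rescaling is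
  the identity there and the image is the whole slice.\<close>

lemma normalizing_scaling:
  obtains f where "scaling_reparametrization G f" "rescale f ` rescale_domain G f = slice"
proof -
  obtain \<rho> :: "nat \<Rightarrow> (nat \<Rightarrow> nat \<Rightarrow> complex) \<Rightarrow> complex" where
    \<rho>: "\<And>i. \<rho> i \<in> polyfun entries" "\<And>A. \<rho> 1 A = 1"
    "\<And>i j A. (j, i) \<in> T \<Longrightarrow> \<rho> i A = A i j * \<rho> j A"
    "\<And>i A. (\<And>j l. (j, l) \<in> T \<Longrightarrow> A l j = 1) \<Longrightarrow> i \<in> {1..n} \<Longrightarrow> \<rho> i A = 1"
    by (rule arborescence_path_products[OF arcs(3)]) blast
  \<comment> \<open>Since \<open>inverse 0 = 0\<close>, the function \<open>f i\<close> vanishes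
    exactly where \<rho> i does, so \<open>rescale_domain\<close> excludes precisely the
    poles.\<close>
  define f where "f i A = inverse (\<rho> i A)" for i A
  define \<Delta> where "\<Delta> A = (\<Prod>i\<in>{1..n}. \<rho> i A)" for A
  have \<Delta>pf: "\<Delta> \<in> polyfun entries"
    unfolding \<Delta>_def by (intro polyfun_prod \<rho>(1))
  have dom: "rescale_domain G f = {A \<in> Theta G. \<Delta> A \<noteq> 0}"
    unfolding rescale_domain_def verts f_def \<Delta>_def by (simp add: prod_zero_iff)
  have dom_nz: "\<rho> i A \<noteq> 0" if "A \<in> rescale_domain G f" "i \<in> {1..n}" for i A
    using that unfolding rescale_domain_def verts f_def by auto
  have slice1: "\<rho> i A = 1" if "A \<in> slice" "i \<in> {1..n}" for i A
    using that \<rho>(4)[of A i] unfolding slice_def by blast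
  have "\<Delta> A0 \<noteq> 0" unfolding \<Delta>_def using slice1[OF A0_slice] by simp
  then have "Theta G \<subseteq> closure (rescale_domain G f)"
    unfolding dom using closure_nonvanishing[OF line_closed_Theta _ \<Delta>pf] A0_slice slice_Theta by blast
  moreover have "open {A. \<Delta> A \<noteq> 0}"
    by (intro open_Collect_neq continuous_on_const continuous_on_polyfun_entries \<Delta>pf)
  then have "openin (top_of_set (Theta G)) (Theta G \<inter> {A. \<Delta> A \<noteq> 0})"
    by (rule openin_open_Int)
  then have "openin (top_of_set (Theta G)) (rescale_domain G f)"
    unfolding dom by (simp add: Int_def)
  moreover have "continuous_on (rescale_domain G f) (f i)" if "i \<in> pverts G" for i
  proof -
    have "continuous_on (rescale_domain G f) (\<lambda>A. inverse (\<rho> i A))"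
      using dom_nz that verts
      by (intro continuous_on_inverse continuous_on_polyfun_entries \<rho>(1)) blast
    then show ?thesis unfolding f_def .
  qed
  ultimately have "scaling_reparametrization G f"
    unfolding scaling_reparametrization_def f_def \<rho>(2) by simp
  moreover have "rescale f ` rescale_domain G f = slice"
  proof
    show "rescale f ` rescale_domain G f \<subseteq> slice"
    proof
      fix B assume "B \<in> rescale f ` rescale_domain G f"
      then obtain A where A: "A \<in> rescale_domain G f" "B = rescale f A" by blast
      have "A \<in> Theta G" using A(1) by (simp add: rescale_domain_def)
      moreover have "A i j \<noteq> 0" if "B i j \<noteq> 0" for i j
        using that by (auto simp: A(2) rescale_def)
      ultimately have "B \<in> Theta G" unfolding Theta_def by blast
      moreover have "B i j = 1" if t: "(j, i) \<in> T" for i j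
      proof -
        have "i \<in> {1..n}" "j \<in> {1..n}" using t arcs by blast+
        then have "\<rho> i A \<noteq> 0" "\<rho> j A \<noteq> 0" using dom_nz A(1) by blast+
        then show ?thesis
          using \<rho>(3)[OF t, of A] by (simp add: A(2) rescale_def f_def field_simps)
      qed
      ultimately show "B \<in> slice" unfolding slice_def by blast
    qed
    show "slice \<subseteq> rescale f ` rescale_domain G f"
    proof
      fix A assume A: "A \<in> slice"
      have "rescale f A i j = A i j" for i j
      proof (cases "i \<in> {1..n} \<and> j \<in> {1..n}")
        case True
        then show ?thesis using slice1[OF A] by (simp add: rescale_def f_def)
      next
        case False
        then have "A i j = 0" using Theta_outside A slice_Theta by blast
        then show ?thesis by (simp add: rescale_def)
      qed
      then have "rescale f A = A" by (intro ext)
      moreover have "A \<in> rescale_domain G f"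
        using A slice_Theta slice1[OF A] unfolding rescale_domain_def verts f_def by auto
      ultimately show "A \<in> rescale f ` rescale_domain G f" by force
    qed
  qed
  ultimately show ?thesis by (rule that)
qed

lemma identifiable: "\<exists>f. identifiable_scaling_reparametrization n G f"
proof -
  obtain f where f: "scaling_reparametrization G f" "rescale f ` rescale_domain G f = slice"
    by (rule normalizing_scaling)
  have "generic \<subseteq> slice" by (auto simp: generic_def)
  then have "generically_locally_injective slice (double_char_map n)"
    unfolding generically_locally_injective_def
    using generic_dense generic_locally_injective by blast
  then show ?thesis
    using f unfolding identifiable_scaling_reparametrization_def by auto
qed

text \<open>A polynomial relation on the slice spreads over the scaling orbits, which are dense.\<close>

lemma vanishing_on_slice:
  assumes "(\<lambda>A. Q (double_char_map n A)) \<in> polyfun entries"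
    and "\<And>A. A \<in> slice \<Longrightarrow> Q (double_char_map n A) = 0" "A \<in> Theta G"
  shows "Q (double_char_map n A) = 0"
proof -
  obtain f where f: "scaling_reparametrization G f" "rescale f ` rescale_domain G f = slice"
    by (rule normalizing_scaling)
  have "Q (double_char_map n B) = 0" if "B \<in> rescale_domain G f" for B
  proof -
    have "rescale f B \<in> slice" using f(2) that by blast
    moreover have "double_char_map n (rescale f B) = double_char_map n B"
      using that by (intro double_char_map_rescale) (auto simp: rescale_domain_def verts)
    ultimately show ?thesis using assms(2) by metis
  qed
  then have "rescale_domain G f \<subseteq> {B. Q (double_char_map n B) = 0}" by blast
  moreover have "closed {B. Q (double_char_map n B) = 0}"
    by (intro closed_Collect_eq continuous_on_const continuous_on_polyfun_entries assms(1))
  ultimately have "closure (rescale_domain G f) \<subseteq> {B. Q (double_char_map n B) = 0}"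
    by (rule closure_minimal)
  moreover have "Theta G \<subseteq> closure (rescale_domain G f)"
    using f(1) by (simp add: scaling_reparametrization_def)
  ultimately show ?thesis using assms(3) by blast
qed

end

section \<open>Zariski closures of images\<close>

lemma poly_functions_eq: "poly_functions N = polyfun {\<lambda>v. vec_index v i | i. i < N}"
proof
  show "poly_functions N \<subseteq> polyfun {\<lambda>v. vec_index v i | i. i < N}"
  proof
    fix p assume "p \<in> poly_functions N"
    then show "p \<in> polyfun {\<lambda>v. vec_index v i | i. i < N}"
      by induction (auto intro: polyfun.intros)
  qed
  show "polyfun {\<lambda>v. vec_index v i | i. i < N} \<subseteq> poly_functions N"
  proof
    fix p assume "p \<in> polyfun {\<lambda>v. vec_index v i | i. i < N}"
    then show "p \<in> poly_functions N"
      by induction (auto intro: poly_functions.intros)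
  qed
qed

lemma poly_functions_polyfun:
  assumes "Q \<in> polyfun Y" "Y \<subseteq> poly_functions N"
  shows "Q \<in> poly_functions N"
  using polyfun_comp[OF assms(1), of "\<lambda>x. x" "{\<lambda>v. vec_index v i | i. i < N}"] assms(2)
  unfolding poly_functions_eq by auto

lemma closedin_zero_set:
  assumes "p \<in> poly_functions N"
  shows "closedin (zariski N) {v \<in> carrier_vec N. p v = 0}"
  unfolding closedin_zariski zero_locus_def using assms by (intro exI[of _ "{p}"]) auto

lemma vanishing_on_closure:
  assumes "p \<in> poly_functions N" "S \<subseteq> carrier_vec N" "\<And>v. v \<in> S \<Longrightarrow> p v = 0"
    and "v \<in> zariski N closure_of S"
  shows "p v = 0"
proof -
  have "zariski N closure_of S \<subseteq> {v \<in> carrier_vec N. p v = 0}"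
    using assms(2,3) by (intro closure_of_minimal closedin_zero_set assms(1)) auto
  then show ?thesis using assms(4) by blast
qed

lemma exists_separating_function:
  assumes "closedin (zariski N) C" "v \<in> carrier_vec N" "v \<notin> C"
  obtains p where "p \<in> poly_functions N" "\<And>w. w \<in> C \<Longrightarrow> p w = 0" "p v \<noteq> 0"
  using assms unfolding closedin_zariski zero_locus_def by blast

text \<open>The zero sets of \<open>p\<close> and \<open>q\<close> cover \<open>Z\<close>, so one of
  them contains it, and \<open>v\<close> rules out the first.\<close>

lemma irreducible_in_no_zero_divisors:
  assumes irr: "irreducible_in (subtopology (zariski N) X) Z"
    and p: "p \<in> poly_functions N" and q: "q \<in> poly_functions N"
    and pq: "\<And>v. v \<in> Z \<Longrightarrow> p v * q v = 0" and v: "v \<in> Z" "p v \<noteq> 0" and w: "w \<in> Z"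
  shows "q w = 0"
proof -
  let ?C = "\<lambda>p. X \<inter> {v \<in> carrier_vec N. p v = 0}"
  have cl: "closedin (subtopology (zariski N) X) (?C p)" if "p \<in> poly_functions N" for p
    using closedin_subtopology_Int_closed[OF closedin_zero_set[OF that], of X] by simp
  have sub: "Z \<subseteq> X \<inter> carrier_vec N"
    using irr unfolding irreducible_in_def by (auto simp: topspace_subtopology)
  then have "Z \<subseteq> ?C p \<union> ?C q" using pq by fastforce
  then have "Z \<subseteq> ?C p \<or> Z \<subseteq> ?C q"
    using irr cl[OF p] cl[OF q] unfolding irreducible_in_def by blast
  then show ?thesis using v w by blast
qed

text \<open>Each strict inclusion supplies a function that vanishes on the smaller set but not on
  the larger one. On the larger, irreducible set it is a non-zero-divisor, so it extends the
  independent family by one.\<close>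

lemma alg_indep_chain:
  assumes Zs: "Zs \<noteq> []" "\<And>Z. Z \<in> set Zs \<Longrightarrow> closedin (zariski N) Z"
    "\<And>Z. Z \<in> set Zs \<Longrightarrow> irreducible_in (subtopology (zariski N) X) Z"
    and sorted: "sorted_wrt (\<subset>) Zs"
  obtains g where "\<And>i. g i \<in> poly_functions N" "alg_indep (last Zs) {..<length Zs - 1} g"
proof -
  have carrier: "Z \<subseteq> carrier_vec N" if "Z \<in> set Zs" for Z
    using closedin_subset[OF Zs(2)[OF that]] by simp
  have step: "Zs ! i \<subset> Zs ! Suc i" if "Suc i < length Zs" for i
    using sorted_wrt_nth_less[OF sorted, of i "Suc i"] that by simp
  \<comment> \<open>Stated for all \<open>i\<close>, with a dummy constant beyond the end of the
    chain, so that \<open>g\<close> is total and consists of polynomial functions.\<close>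
  have "\<exists>p v. p \<in> poly_functions N \<and> (Suc i < length Zs \<longrightarrow>
      (\<forall>w\<in>Zs ! i. p w = 0) \<and> v \<in> Zs ! Suc i \<and> p v \<noteq> 0)" for i
  proof (cases "Suc i < length Zs")
    case True
    then obtain v where v: "v \<in> Zs ! Suc i" "v \<notin> Zs ! i" using step by blast
    have "v \<in> carrier_vec N" using carrier[OF nth_mem[OF True]] v(1) by blast
    from exists_separating_function[OF Zs(2) this v(2)] True
    obtain p where "p \<in> poly_functions N" "\<And>w. w \<in> Zs ! i \<Longrightarrow> p w = 0" "p v \<noteq> 0"
      by (metis Suc_lessD nth_mem)
    then show ?thesis using v(1) by blast
  next
    case False
    then show ?thesis using poly_functions.const by blast
  qed
  then obtain g v where g: "\<And>i. g i \<in> poly_functions N"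
    "\<And>i w. Suc i < length Zs \<Longrightarrow> w \<in> Zs ! i \<Longrightarrow> g i w = 0"
    "\<And>i. Suc i < length Zs \<Longrightarrow> v i \<in> Zs ! Suc i" "\<And>i. Suc i < length Zs \<Longrightarrow> g i (v i) \<noteq> 0"
    by metis
  have "k < length Zs \<Longrightarrow> alg_indep (Zs ! k) {..<k} g" for k
  proof (induction k)
    case 0
    then have "Zs ! 0 \<in> set Zs" by simp
    then have "Zs ! 0 \<noteq> {}" using Zs(3) unfolding irreducible_in_def by blast
    then show ?case by (simp add: alg_indep_empty)
  next
    case (Suc k)
    have "alg_indep (Zs ! Suc k) (insert k {..<k}) g"
    proof (rule alg_indep_extend[of _ _ "Zs ! k"])
      show "alg_indep (Zs ! k) {..<k} g" using Suc by simp
      show "Zs ! k \<subseteq> Zs ! Suc k" using step[OF Suc.prems] by blast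
      show "g k x = 0" if "x \<in> Zs ! k" for x using g(2)[OF Suc.prems that] .
      fix Q w
      assume Q: "Q \<in> polyfun (g ` insert k {..<k})"
        and 0: "\<And>x. x \<in> Zs ! Suc k \<Longrightarrow> g k x * Q x = 0" and w: "w \<in> Zs ! Suc k"
      have "Q \<in> poly_functions N"
        using g(1) by (intro poly_functions_polyfun[OF Q]) auto
      then show "Q w = 0"
        using irreducible_in_no_zero_divisors[OF Zs(3)[OF nth_mem[OF Suc.prems]] g(1) _ 0 g(3)[OF Suc.prems]
            g(4)[OF Suc.prems] w] by blast
    qed auto
    then show ?case by (simp add: lessThan_Suc)
  qed
  from this[of "length Zs - 1"] Zs(1) show ?thesis
    by (intro that[of g] g(1)) (simp add: last_conv_nth)
qed

lemma alg_indep_image: "alg_indep (c ` S) I g \<longleftrightarrow> alg_indep S I (\<lambda>i x. g i (c x))"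
  unfolding alg_indep_def by simp

section \<open>The Krull dimension of the closure of the image\<close>

context independent_point
begin

definition N :: nat where "N = 2 * n - 1"

abbreviation "c \<equiv> double_char_map n"

lemma c_carrier: "c ` S \<subseteq> carrier_vec N"
  unfolding double_char_map_def N_def by auto

lemma polyfun_c: "p \<in> poly_functions N \<Longrightarrow> (\<lambda>A. p (c A)) \<in> polyfun entries"
  unfolding poly_functions_eq N_def
  by (rule polyfun_comp) (auto intro: polyfun_double_char_map[OF n_pos])

text \<open>If neither closed set contains the image, each has an equation failing at some point of
  \<open>L\<close>. Along the line through the two points both equations are nonzero polynomials in
  \<open>t\<close>, so both fail at a common \<open>t\<close>.\<close>

lemma irreducible_closure:
  assumes L: "line_closed L" "L \<noteq> {}"
    and X: "closedin (zariski N) X" "zariski N closure_of (c ` L) \<subseteq> X"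
  shows "irreducible_in (subtopology (zariski N) X) (zariski N closure_of (c ` L))"
  unfolding irreducible_in_def
proof (intro conjI allI impI)
  let ?Z = "zariski N closure_of (c ` L)"
  have sub: "c ` L \<subseteq> ?Z" using c_carrier by (intro closure_of_subset) simp
  then show "?Z \<noteq> {}" using L(2) by blast
  show "?Z \<subseteq> topspace (subtopology (zariski N) X)"
    using X closedin_subset[OF X(1)] by (auto simp: topspace_subtopology)
  fix C D
  assume "closedin (subtopology (zariski N) X) C \<and> closedin (subtopology (zariski N) X) D \<and> ?Z \<subseteq> C \<union> D"
  then have CD: "closedin (zariski N) C" "closedin (zariski N) D" "?Z \<subseteq> C \<union> D"
    using closedin_closed_subtopology[OF X(1)] by auto
  show "?Z \<subseteq> C \<or> ?Z \<subseteq> D"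
  proof (rule ccontr)
    assume "\<not> (?Z \<subseteq> C \<or> ?Z \<subseteq> D)"
    then have "\<not> c ` L \<subseteq> C" "\<not> c ` L \<subseteq> D"
      using closure_of_minimal CD(1,2) by blast+
    then obtain A B where AB: "A \<in> L" "c A \<notin> C" "B \<in> L" "c B \<notin> D" by blast
    have "c A \<in> carrier_vec N" "c B \<in> carrier_vec N" using c_carrier by blast+
    then obtain p q where p: "p \<in> poly_functions N" "\<And>w. w \<in> C \<Longrightarrow> p w = 0" "p (c A) \<noteq> 0"
      and q: "q \<in> poly_functions N" "\<And>w. w \<in> D \<Longrightarrow> q w = 0" "q (c B) \<noteq> 0"
      using exists_separating_function[OF CD(1) _ AB(2)] exists_separating_function[OF CD(2) _ AB(4)]
      by metis
    obtain P where P: "\<And>t. p (c (segment_point A B t)) = poly P t"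
      using polyfun_segment[OF polyfun_c[OF p(1)]] by blast
    obtain Q where Q: "\<And>t. q (c (segment_point A B t)) = poly Q t"
      using polyfun_segment[OF polyfun_c[OF q(1)]] by blast
    have "P \<noteq> 0" "Q \<noteq> 0"
      using P[of 0] p(3) Q[of 1] q(3) by auto
    then have "P * Q \<noteq> 0" by simp
    then obtain t where t: "poly P t * poly Q t \<noteq> 0"
      using poly_eq_0_if_cofinite[of "{}" "P * Q"] by auto
    have "c (segment_point A B t) \<in> C \<union> D"
      using L(1) AB(1,3) sub CD(3) unfolding line_closed_def by blast
    then show False using p(2) q(2) P[of t] Q[of t] t by auto
  qed
qed

text \<open>Positions outside \<open>B\<close> are constant on \<open>L\<close>, so only the entries
  at \<open>B\<close> remain as generators. Their number is what the counting bound sees.\<close>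

lemma slice_polyfun:
  assumes f: "f \<in> polyfun entries" and "B \<subseteq> free" "L \<subseteq> slice"
    and fixed: "\<And>b A. b \<in> free - B \<Longrightarrow> A \<in> L \<Longrightarrow> A (snd b) (fst b) = A0 (snd b) (fst b)"
  shows "\<exists>h\<in>polyfun ((\<lambda>b A. A (snd b) (fst b)) ` B). \<forall>A\<in>L. f A = h A"
proof (rule polyfun_subst[OF f, where \<phi> = "\<lambda>x. x"])
  fix g :: "(nat \<Rightarrow> nat \<Rightarrow> complex) \<Rightarrow> complex"
  assume "g \<in> entries"
  then obtain i j where g: "g = (\<lambda>A. A i j)" by (auto simp: entries_def)
  consider "(j, i) \<in> B" | "(j, i) \<in> free - B" | "(j, i) \<notin> free" by blast
  then show "\<exists>h\<in>polyfun ((\<lambda>b A. A (snd b) (fst b)) ` B). \<forall>A\<in>L. g A = h A"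
  proof cases
    case 1
    then have "(\<lambda>A. A i j) \<in> polyfun ((\<lambda>b A. A (snd b) (fst b)) ` B)"
      by (intro polyfun.gen image_eqI[of _ _ "(j, i)"]) auto
    then show ?thesis unfolding g by (intro bexI[of _ "\<lambda>A. A i j"]) auto
  next
    case 2
    show ?thesis
    proof (intro bexI[of _ "\<lambda>_. A0 i j"] ballI polyfun.const)
      fix A assume "A \<in> L"
      then show "g A = A0 i j" using fixed[OF 2] by (simp add: g)
    qed
  next
    case 3
    then obtain z where z: "\<And>A. A \<in> slice \<Longrightarrow> A i j = z" by (rule slice_fixed_entry) blast
    show ?thesis
    proof (intro bexI[of _ "\<lambda>_. z"] ballI polyfun.const)
      fix A assume "A \<in> L"
      then show "g A = z" using z assms(3) by (auto simp: g)
    qed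
  qed
qed

text \<open>Polynomials vanishing on the image of the slice vanish on the whole closure, so the
  independent functions on the top of the chain stay independent on the slice, which has only
  \<open>card free\<close> coordinates.\<close>

lemma chain_length_le:
  assumes "Zs \<noteq> []" "sorted_wrt (\<subset>) Zs"
    and Zs: "\<And>Z. Z \<in> set Zs \<Longrightarrow>
      closedin (subtopology (zariski N) (zariski N closure_of (c ` Theta G))) Z \<and>
      irreducible_in (subtopology (zariski N) (zariski N closure_of (c ` Theta G))) Z"
  shows "length Zs - 1 \<le> card (parcs G) + 1"
proof (rule ccontr)
  let ?X = "zariski N closure_of (c ` Theta G)"
  let ?d = "length Zs - 1"
  assume long: "\<not> ?d \<le> card (parcs G) + 1"
  have cl: "closedin (zariski N) Z" "Z \<subseteq> ?X" if "Z \<in> set Zs" for Z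
    using Zs[OF that] closedin_closed_subtopology[of "zariski N" ?X Z] by auto
  obtain g where g: "\<And>i. g i \<in> poly_functions N" "alg_indep (last Zs) {..<?d} g"
    using alg_indep_chain[OF assms(1) cl(1) _ assms(2)] Zs by blast
  have "alg_indep (c ` slice) {..<?d} g"
  proof (rule alg_indep_transfer[OF g(2), where \<phi> = "\<lambda>x. x"])
    fix Q v
    assume Q: "Q \<in> polyfun (g ` {..<?d})" and 0: "\<And>x. x \<in> c ` slice \<Longrightarrow> Q x = 0"
      and v: "v \<in> last Zs"
    have Qpf: "Q \<in> poly_functions N"
      using g(1) by (intro poly_functions_polyfun[OF Q]) auto
    have "Q (c A) = 0" if "A \<in> Theta G" for A
      using vanishing_on_slice[OF polyfun_c[OF Qpf] _ that] 0 by blast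
    moreover have "v \<in> ?X" using v cl(2)[OF last_in_set[OF assms(1)]] by blast
    ultimately show "Q v = 0"
      using vanishing_on_closure[OF Qpf c_carrier, of "Theta G"] by blast
  qed simp
  then have "alg_indep slice {..<?d} (\<lambda>i A. g i (c A))"
    unfolding alg_indep_image .
  moreover have "\<not> alg_indep slice {..<?d} (\<lambda>i A. g i (c A))"
  proof (rule not_alg_indep[OF free_facts(1)])
    show "card free < card {..<?d}" using long free_facts(2) by simp
    show "\<exists>h\<in>polyfun ((\<lambda>b A. A (snd b) (fst b)) ` free). \<forall>A\<in>slice. g i (c A) = h A" for i
      by (rule slice_polyfun[OF polyfun_c[OF g(1)]]) auto
  qed simp
  ultimately show False by blast
qed

text \<open>The coordinate subspace of the slice through \<open>A0\<close> in the directions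
  \<open>B\<close>; these form the members of the maximal chain.\<close>

definition subslice :: "(nat \<times> nat) set \<Rightarrow> (nat \<Rightarrow> nat \<Rightarrow> complex) set" where
  "subslice B = {A \<in> slice. \<forall>b\<in>free - B. A (snd b) (fst b) = A0 (snd b) (fst b)}"

lemma subslice_facts: "A0 \<in> subslice B" "subslice B \<subseteq> slice" "line_closed (subslice B)"
  using A0_slice line_closed_slice unfolding subslice_def line_closed_def
  by (auto simp: segment_point_def)

lemma subslice_mono: "B \<subseteq> B' \<Longrightarrow> subslice B \<subseteq> subslice B'"
  unfolding subslice_def by blast

text \<open>
  Functionals dual to the products \<open>p\<^sub>i q\<^sub>j\<close> at \<open>A0\<close> turn the two-point identity into
  functions on the image that restrict to the free coordinates up to higher order terms.
\<close>

lemma subslice_alg_indep: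
  assumes B: "B \<subseteq> free"
  obtains Y where "\<And>b. Y b \<in> poly_functions N" "alg_indep (c ` subslice B) B Y"
proof -
  obtain K w where K: "finite K" "\<And>a b. a \<in> free \<Longrightarrow> b \<in> free \<Longrightarrow>
      (\<Sum>k\<in>K. w a k * coeff (arc_product n A0 b) k) = (if a = b then 1 else 0)"
    using indep_family_dual[OF free_facts(1) A0_indep] by blast
  \<comment> \<open>The dual functional applied to the right-hand side of the two-point identity
    with second matrix \<open>A0\<close>. That side depends on \<open>A\<close> only through its
    image, which is the argument \<open>v\<close>.\<close>
  define Y where "Y b v = (\<Sum>k\<in>K. w b k * coeff (vec_charpoly1 n v * charpoly n A0 -
      vec_charpoly n v * charpoly1 n A0) k)" for b v
  have monom_pf: "(\<lambda>v. monom (vec_index v i) k) \<in> polyfun_poly {\<lambda>v. vec_index v i | i. i < N}"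
    if "i < N" for i k
    unfolding polyfun_poly_def
  proof (intro CollectI allI)
    fix l
    show "(\<lambda>v. coeff (monom (vec_index v i) k) l) \<in> polyfun {\<lambda>v. vec_index v i | i. i < N}"
      using that by (cases "k = l") (auto intro: polyfun.gen polyfun.const)
  qed
  have "Y b \<in> poly_functions N" for b
    unfolding poly_functions_eq Y_def vec_charpoly_def vec_charpoly1_def
    by (intro polyfun_sum polyfun.mult[OF polyfun.const] polyfun_polyD polyfun_poly_diff
        polyfun_poly_mult polyfun_poly_add polyfun_poly_sum polyfun_poly_const monom_pf)
      (auto simp: N_def)
  moreover have "alg_indep (subslice B) B (\<lambda>b A. Y b (c A))"
  proof (rule alg_indep_if_tangents)
    show finB: "finite B" using B free_facts(1) by (rule finite_subset)
    fix \<xi> :: "nat \<times> nat \<Rightarrow> complex"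
    \<comment> \<open>The straight line through \<open>A0\<close> in the prescribed direction \<xi>;
      its difference from \<open>A0\<close> supplies the factor \<open>t\<close> that is divided out
      below.\<close>
    define \<gamma> where "\<gamma> t i j = A0 i j + (if (j, i) \<in> B then t * \<xi> (j, i) else 0)" for t i j
    have \<gamma>0: "\<gamma> 0 = A0" by (simp add: \<gamma>_def fun_eq_iff)
    have \<gamma>_slice: "\<gamma> t \<in> slice" for t
    proof -
      have "(i = j \<and> i \<in> pverts G) \<or> (j, i) \<in> parcs G" if "\<gamma> t i j \<noteq> 0" for i j
      proof (cases "(j, i) \<in> B")
        case True
        then show ?thesis using B unfolding free_def free_arcs_def verts by auto
      next
        case False
        then have "A0 i j \<noteq> 0" using that by (simp add: \<gamma>_def)
        then show ?thesis using A0_slice unfolding slice_def Theta_def by blast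
      qed
      then have "\<gamma> t \<in> Theta G" unfolding Theta_def by blast
      moreover have "\<gamma> t i j = 1" if "(j, i) \<in> T" for i j
      proof -
        have "(j, i) \<notin> B" using B that unfolding free_def free_arcs_def by blast
        then show ?thesis using A0_slice that unfolding slice_def \<gamma>_def by simp
      qed
      ultimately show ?thesis unfolding slice_def by blast
    qed
    then have "\<gamma> t \<in> subslice B" for t
      unfolding subslice_def \<gamma>_def by auto
    moreover have "((\<lambda>t. Y b (c (\<gamma> t)) / t) \<longlongrightarrow> \<xi> b) (at 0)" if b: "b \<in> B" for b
    proof -
      define H where "H b' t = (\<Sum>k\<in>K. w b k *
          coeff (adj_entry n (\<gamma> t) 1 (snd b') * adj_entry n A0 (fst b') 1) k)" for b' t
      have Yt: "Y b (c (\<gamma> t)) / t = (\<Sum>b'\<in>B. \<xi> b' * H b' t)" if "t \<noteq> 0" for t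
      proof -
        have "Y b (c (\<gamma> t)) = (\<Sum>k\<in>K. w b k * coeff (charpoly1 n (\<gamma> t) * charpoly n A0 -
            charpoly n (\<gamma> t) * charpoly1 n A0) k)"
          unfolding Y_def vec_charpoly_double_char_map[OF n_pos] ..
        also have "\<dots> = (\<Sum>k\<in>K. w b k * (\<Sum>b'\<in>free. (\<gamma> t (snd b') (fst b') - A0 (snd b') (fst b')) *
            coeff (adj_entry n (\<gamma> t) 1 (snd b') * adj_entry n A0 (fst b') 1) k))"
          unfolding slice_two_point[OF \<gamma>_slice A0_slice, symmetric] by (simp add: coeff_sum)
        also have "\<dots> = (\<Sum>b'\<in>free. (\<gamma> t (snd b') (fst b') - A0 (snd b') (fst b')) * H b' t)"
          unfolding H_def sum_distrib_left by (subst sum.swap) (simp add: mult.left_commute)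
        also have "\<dots> = (\<Sum>b'\<in>B. t * \<xi> b' * H b' t)"
          using B free_facts(1) by (intro sum.mono_neutral_cong_right) (auto simp: \<gamma>_def)
        also have "\<dots> = t * (\<Sum>b'\<in>B. \<xi> b' * H b' t)"
          by (simp add: sum_distrib_left mult.assoc)
        finally show ?thesis using that by simp
      qed
      have "continuous_on UNIV (H b')" if "b' \<in> B" for b'
      proof -
        have b': "fst b' \<in> {1..n}" "snd b' \<in> {1..n}" using that B free_bounds by blast+
        have cont_\<gamma>: "continuous_on UNIV (\<lambda>t. \<gamma> t)"
          unfolding \<gamma>_def
        proof (intro continuous_on_coordinatewise_then_product)
          fix i j
          show "continuous_on UNIV (\<lambda>t. A0 i j + (if (j, i) \<in> B then t * \<xi> (j, i) else 0))"
            by (cases "(j, i) \<in> B") (simp_all add: continuous_on_add continuous_on_mult_right)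
        qed
        have "(\<lambda>A. \<Sum>k\<in>K. w b k * coeff (adj_entry n A 1 (snd b') * adj_entry n A0 (fst b') 1) k)
            \<in> polyfun entries"
          using b' n_pos
          by (intro polyfun_sum polyfun.mult[OF polyfun.const] polyfun_polyD polyfun_poly_mult
              polyfun_poly_const polyfun_poly_adj_entry) auto
        then have cont: "continuous_on UNIV
            (\<lambda>A. \<Sum>k\<in>K. w b k * coeff (adj_entry n A 1 (snd b') * adj_entry n A0 (fst b') 1) k)"
          by (rule continuous_on_polyfun_entries)
        show ?thesis
          unfolding H_def by (rule continuous_on_compose2[OF cont cont_\<gamma>]) simp
      qed
      then have "((\<lambda>t. \<Sum>b'\<in>B. \<xi> b' * H b' t) \<longlongrightarrow> (\<Sum>b'\<in>B. \<xi> b' * H b' 0)) (at 0)"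
        by (intro tendsto_sum tendsto_mult tendsto_const) (auto simp: continuous_on_def)
      \<comment> \<open>At \<open>t = 0\<close> both \<open>p\<close> and \<open>q\<close> are taken
        at \<open>A0\<close>, where the functionals are dual to the products.\<close>
      moreover have "(\<Sum>b'\<in>B. \<xi> b' * H b' 0) = \<xi> b"
      proof -
        have "H b' 0 = (if b = b' then 1 else 0)" if "b' \<in> B" for b'
          using K(2)[of b b'] that b B unfolding H_def \<gamma>0 arc_product_def by blast
        then have "(\<Sum>b'\<in>B. \<xi> b' * H b' 0) = (\<Sum>b'\<in>B. \<xi> b' * (if b = b' then 1 else 0))"
          by (intro sum.cong) auto
        then show ?thesis using b finB by (simp add: if_distrib[of "\<lambda>x. _ * x"] cong: if_cong)
      qed
      ultimately have "((\<lambda>t. \<Sum>b'\<in>B. \<xi> b' * H b' t) \<longlongrightarrow> \<xi> b) (at 0)" by simp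
      then show ?thesis
        by (rule Lim_transform_eventually) (auto simp: eventually_at_filter Yt)
    qed
    ultimately show "\<exists>\<gamma>. (\<forall>t. \<gamma> t \<in> subslice B) \<and>
        (\<forall>i\<in>B. ((\<lambda>t. Y i (c (\<gamma> t)) / t) \<longlongrightarrow> \<xi> i) (at 0))" by blast
  qed
  ultimately show ?thesis
    using that[of Y] unfolding alg_indep_image by blast
qed

text \<open>If the closures coincided, the \<open>card B'\<close> functions independent on the
  larger subslice would stay independent on the smaller one, where everything is polynomial in only
  \<open>card B\<close> entries.\<close>

lemma closure_subslice_strict:
  assumes "B \<subset> B'" "B' \<subseteq> free"
  shows "zariski N closure_of (c ` subslice B) \<subset> zariski N closure_of (c ` subslice B')"
proof
  let ?Z = "\<lambda>B. zariski N closure_of (c ` subslice B)"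
  show "?Z B \<subseteq> ?Z B'"
    using assms(1) by (intro closure_of_mono image_mono subslice_mono) blast
  show "?Z B \<noteq> ?Z B'"
  proof
    assume eq: "?Z B = ?Z B'"
    have fin: "finite B'" using assms(2) free_facts(1) by (rule finite_subset)
    obtain Y where Y: "\<And>b. Y b \<in> poly_functions N" "alg_indep (c ` subslice B') B' Y"
      using subslice_alg_indep[OF assms(2)] by blast
    have "alg_indep (c ` subslice B) B' Y"
    proof (rule alg_indep_transfer[OF Y(2), where \<phi> = "\<lambda>x. x"])
      fix Q v
      assume Q: "Q \<in> polyfun (Y ` B')" and 0: "\<And>x. x \<in> c ` subslice B \<Longrightarrow> Q x = 0"
        and v: "v \<in> c ` subslice B'"
      have Qpf: "Q \<in> poly_functions N"
        using Y(1) by (intro poly_functions_polyfun[OF Q]) auto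
      have "c ` subslice B' \<subseteq> ?Z B'" using c_carrier by (intro closure_of_subset) simp
      then have "v \<in> ?Z B" using v eq by blast
      then show "Q v = 0" using vanishing_on_closure[OF Qpf c_carrier 0] by blast
    qed simp
    then have "alg_indep (subslice B) B' (\<lambda>b A. Y b (c A))"
      unfolding alg_indep_image .
    moreover have "\<not> alg_indep (subslice B) B' (\<lambda>b A. Y b (c A))"
    proof (rule not_alg_indep[OF _ fin])
      show "finite B" using assms(1) fin by (meson finite_subset psubset_imp_subset)
      show "card B < card B'" using assms(1) fin by (rule psubset_card_mono[rotated])
      show "\<exists>h\<in>polyfun ((\<lambda>b A. A (snd b) (fst b)) ` B). \<forall>A\<in>subslice B. Y i (c A) = h A" for i
        using assms by (intro slice_polyfun polyfun_c Y(1)) (auto simp: subslice_def)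
    qed
    ultimately show False by blast
  qed
qed

text \<open>Releasing the free entries one after the other produces a chain of closures that attains
  the upper bound.\<close>

lemma zariski_dim_image: "zariski_dim N (c ` Theta G) = enat (card (parcs G) + 1)"
proof -
  let ?X = "zariski N closure_of (c ` Theta G)"
  let ?T = "subtopology (zariski N) ?X"
  let ?m = "card (parcs G) + 1"
  have closX: "closedin (zariski N) ?X" by simp
  obtain e where e: "bij_betw e {..<?m} free"
    using ex_bij_betw_nat_finite[OF free_facts(1)] unfolding free_facts(2) atLeast0LessThan by blast
  define Z where "Z k = zariski N closure_of (c ` subslice (e ` {..<k}))" for k
  have Z_strict: "Z i \<subset> Z j" if "i < j" "j \<le> ?m" for i j
    unfolding Z_def
  proof (rule closure_subslice_strict)
    show "e ` {..<j} \<subseteq> free" using e that(2) unfolding bij_betw_def by fastforce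
    have "inj_on e {..<j}" using e that(2) unfolding bij_betw_def by (auto intro: inj_on_subset)
    then have "e k \<noteq> e i" if "k < i" for k
      using inj_onD[of e "{..<j}" k i] that \<open>i < j\<close> by fastforce
    then have "e i \<notin> e ` {..<i}" by fastforce
    moreover have "e i \<in> e ` {..<j}" "e ` {..<i} \<subseteq> e ` {..<j}" using that(1) by auto
    ultimately show "e ` {..<i} \<subset> e ` {..<j}" by blast
  qed
  have Z_sub: "Z k \<subseteq> ?X" for k
    unfolding Z_def using subslice_facts(2) slice_Theta by (intro closure_of_mono image_mono) blast
  \<comment> \<open>It runs from no released entry to all of them, so it has \<open>Suc ?m\<close>
    members and \<open>?m\<close> strict inclusions.\<close>
  define Zs where "Zs = map Z [0..<Suc ?m]"
  have "closedin ?T A \<and> irreducible_in ?T A" if A: "A \<in> set Zs" for A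
  proof -
    obtain k where k: "A = Z k" using A unfolding Zs_def by auto
    have "closedin (zariski N) (Z k)" unfolding Z_def by simp
    then have "closedin ?T (Z k)"
      using Z_sub closX by (simp add: closedin_closed_subtopology)
    moreover have "irreducible_in ?T (Z k)"
      using irreducible_closure[OF subslice_facts(3) _ closX] Z_sub[of k] subslice_facts(1)
      unfolding Z_def by blast
    ultimately show ?thesis unfolding k by blast
  qed
  moreover have "sorted_wrt (\<subset>) Zs"
    unfolding Zs_def sorted_wrt_iff_nth_less by (auto intro!: Z_strict simp del: upt_Suc)
  moreover have "Zs \<noteq> []" "length Zs - 1 = ?m" by (simp_all add: Zs_def)
  ultimately have "enat ?m \<le> krull_dim ?T"
    unfolding krull_dim_def by (intro Sup_upper CollectI exI[of _ Zs]) simp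
  moreover have "krull_dim ?T \<le> enat ?m"
    unfolding krull_dim_def
  proof (rule Sup_least)
    fix x assume "x \<in> {enat (length Zs - 1) | Zs. Zs \<noteq> [] \<and>
      (\<forall>Z\<in>set Zs. closedin ?T Z \<and> irreducible_in ?T Z) \<and> sorted_wrt (\<subset>) Zs}"
    then obtain Zs where "x = enat (length Zs - 1)" "Zs \<noteq> []" "sorted_wrt (\<subset>) Zs"
      "\<forall>Z\<in>set Zs. closedin ?T Z \<and> irreducible_in ?T Z" by blast
    then show "x \<le> enat ?m" using chain_length_le[of Zs] by simp
  qed
  ultimately show ?thesis unfolding zariski_dim_def by (rule antisym[rotated])
qed

end

theorem theorem1p2:
  fixes n :: nat and G :: "nat pair_pre_digraph"
  assumes "pair_digraph G"
    and "pverts G = {1..n}"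
    and "\<exists>Ps. nontrivial_ear_decomposition G Ps"
  shows "(\<exists>f. identifiable_scaling_reparametrization n G f) \<and>
         zariski_dim (2 * n - 1) (double_char_map n ` Theta G) = enat (card (parcs G) + 1)"
proof -
  obtain T A0 where "independent_at n (pverts G) (parcs G) T A0"
    using assms(2,3) independent_at_ear_decomposition by blast
  then interpret independent_point n G T A0
    using assms(2) by unfold_locales
  show ?thesis
    using identifiable zariski_dim_image unfolding N_def by blast
qed

end
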